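(* Let $a_1^0,\ldots,a_n^0\in\mathbb C$ be pairwise distinct and let $B_1^0,\ldots,B_n^0$ be complex $p\times p$ matrices with $\sum_{i=1}^n B_i^0=0$, defining the Fuchsian system $\frac{dy}{dz}=\Bigl(\sum_{i=1}^n\frac{B_i^0}{z-a_i^0}\Bigr)y$. Suppose that, with respect to some fundamental matrix, the monodromy matrices $G_1,\ldots,G_n$ of the system all have the block upper-triangular form $$G_i=\begin{pmatrix} G_i^1 & & * \\ & \ddots & \\ 0 & & G_i^k\end{pmatrix},\qquad i=1,\ldots,n,$$ with $k\ge 2$ diagonal blocks, where $G_i^s$ has size $m^s\times m^s$ ($s=1,\ldots,k$, $m^1+\cdots+m^k=p$), the block sizes being the same for all $i$. If the exponents $\beta_i^j$ of the system satisfy $$\operatorname{Re}\beta_i^j>-\frac{1}{n(p-m^k)},\qquad i=1,\ldots,n,\quad j=1,\ldots,p,$$ then there exists a constant matrix $C\in{\rm GL}(p,\mathbb C)$ such that all matrices $CB_i^0C^{-1}$, $i=1,\ldots,n$, have the same block upper-triangular form (diagonal blocks of sizes $m^1,\ldots,m^k$, zeros below them) as the monodromy matrices.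
   Context: Monodromy: fix a non-singular point $z_0$ and a fundamental matrix $Y(z)$ near $z_0$; analytic continuation of $Y$ along a loop $\gamma$ in $\overline{\mathbb C}\setminus\{a_1^0,\ldots,a_n^0\}$ based at $z_0$ yields $Y(z)G_\gamma$ with $G_\gamma\in{\rm GL}(p,\mathbb C)$; the monodromy matrix $G_i$ corresponds to a simple loop $\gamma_i$ encircling $a_i^0$ only, and $G_1,\ldots,G_n$ generate the monodromy group. The exponents $\beta_i^1,\ldots,\beta_i^p$ of the system at $a_i^0$ are the eigenvalues (with multiplicity) of the residue matrix $B_i^0$. *)

theory Defs
  imports "HOL-Analysis.Analysis" "Jordan_Normal_Form.Char_Poly"
begin

definition block_of :: "nat list \<Rightarrow> nat \<Rightarrow> nat" where
  "block_of ms j = (LEAST s. j < sum_list (take (Suc s) ms))"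

definition block_upper_tri :: "nat list \<Rightarrow> complex mat \<Rightarrow> bool" where
  "block_upper_tri ms M \<longleftrightarrow>
     M \<in> carrier_mat (sum_list ms) (sum_list ms) \<and>
     (\<forall>j < sum_list ms. \<forall>l < sum_list ms. block_of ms l < block_of ms j \<longrightarrow> M $$ (j, l) = 0)"

definition fuchs_coeff ::
  "nat \<Rightarrow> nat \<Rightarrow> (nat \<Rightarrow> complex) \<Rightarrow> (nat \<Rightarrow> complex mat) \<Rightarrow> complex \<Rightarrow> complex mat" where
  "fuchs_coeff p n a B z = mat p p (\<lambda>(j, l). \<Sum>i<n. B i $$ (j, l) / (z - a i))"

text \<open>Phi(t) is the value at gamma(t) of the analytic continuation along the (piecewise C1)
  path gamma of the matrix solution with initial value Y0 at gamma(0); equivalently Phi solves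
  the pulled-back linear ODE  Phi'(t) = A(gamma t) gamma'(t) Phi(t),  Phi(0) = Y0.\<close>
definition continuation_along ::
  "nat \<Rightarrow> (complex \<Rightarrow> complex mat) \<Rightarrow> (real \<Rightarrow> complex) \<Rightarrow> complex mat \<Rightarrow> (real \<Rightarrow> complex mat) \<Rightarrow> bool" where
  "continuation_along p A \<gamma> Y0 \<Phi> \<longleftrightarrow>
     \<Phi> 0 = Y0 \<and>
     (\<forall>t\<in>{0..1}. \<Phi> t \<in> carrier_mat p p) \<and>
     (\<forall>j<p. \<forall>k<p. continuous_on {0..1} (\<lambda>t. \<Phi> t $$ (j, k))) \<and>
     (\<exists>S. finite S \<and> (\<forall>t\<in>{0..1} - S. \<forall>j<p. \<forall>k<p.
        ((\<lambda>t. \<Phi> t $$ (j, k)) has_vector_derivative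
           (\<Sum>l<p. A (\<gamma> t) $$ (j, l) * vector_derivative \<gamma> (at t) * \<Phi> t $$ (l, k)))
        (at t within {0..1})))"

text \<open>Monodromy matrix of the loop gamma w.r.t. the fundamental matrix with value Y0 at the base point:
  continuation of Y along gamma gives Y G, so G = Y0^{-1} Phi(1).\<close>
definition monodromy_of :: "complex mat \<Rightarrow> (real \<Rightarrow> complex mat) \<Rightarrow> complex mat \<Rightarrow> bool" where
  "monodromy_of Y0 \<Phi> G \<longleftrightarrow> \<Phi> 1 = Y0 * G"

end

theory Submission
  imports "HOL-Complex_Analysis.Complex_Analysis" "Jordan_Normal_Form.Schur_Decomposition" Defs
begin

text \<open>
  Let \<open>d\<close> be the total size of some of the leading blocks, but not of all. Block-triangular monodromy
  says that the span \<open>F z\<close> of the first \<open>d\<close> columns of the fundamental matrix is a single-valued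
  field of \<open>d\<close>-dimensional subspaces. Since the singularities are Fuchsian, its Pluecker coordinates
  have moderate growth, so \<open>F\<close> is rational and has a polynomial frame \<open>x\<close>. Choose one whose
  column degrees \<open>e j\<close> have minimal sum; it is then independent at every point and at infinity, and
  \<open>A x - x' = x H\<close> with \<open>H\<close> having simple poles at the \<open>a i\<close> only. The residue \<open>R i\<close> of \<open>H\<close> is the
  restriction of \<open>B i\<close> to an invariant subspace, and comparing with the behaviour at infinity gives
  \<open>\<Sum>i. tr (R i) = - (\<Sum>j. e j)\<close>. The bound on the exponents forces this integer to be \<open>> - 1\<close>, so
  all \<open>e j\<close> vanish: \<open>F\<close> is constant and therefore invariant under every \<open>B i\<close>. For all \<open>d\<close>
  simultaneously, a value of the fundamental matrix is the required change of basis.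
\<close>

section \<open>Linear differential systems on convex domains\<close>

text \<open>The exponent bound is calibrated to squeeze an integer. A proper union of leading blocks
  has size \<open>d\<close> at most p - m^k, and each residue \<open>R i\<close> has
  \<open>d\<close> eigenvalues, all of them exponents at \<open>a i\<close>. Its trace therefore has
  real part above -d/(n(p - m^k)) \<ge> -1/n, and the \<open>n\<close> traces together exceed -1.
  That their sum is exactly minus the total column degree comes from \<Sum> \<open>B i\<close> = 0:
  the coefficient matrix then decays like 1/z^2 at infinity, so there the degrees enter only through
  the derivative \<open>x'\<close>.

  The obstacle is analytic: solutions are multivalued and must be controlled near each singular
  point and at infinity. What descends to the plane is the subspace, not the solution. It is
  described as a graph over the first \<open>d\<close> coordinates, whose entries are quotients of
  minors. The denominator, the top minor, does not vanish identically, because conjugation by the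
  initial value makes the fundamental matrix the identity at the base point. Growth of the numerator
  and a lower bound for the denominator then make the quotient rational.\<close>

lemma index_mult_sum:
  assumes "A \<in> carrier_mat m q" "B \<in> carrier_mat q r" "i < m" "j < r"
  shows "(A * B) $$ (i, j) = (\<Sum>l<q. A $$ (i, l) * B $$ (l, j))"
  using assms by (auto simp: scalar_prod_def lessThan_atLeast0)

lemma primitive_exists_convex:
  assumes "convex D" "open D" "f holomorphic_on D"
  shows "\<exists>g. g c = 0 \<and> (\<forall>z\<in>D. (g has_field_derivative f z) (at z))"
proof -
  obtain g where g: "\<And>z. z \<in> D \<Longrightarrow> (g has_field_derivative f z) (at z within D)"
    using holomorphic_convex_primitive'[OF \<open>convex D\<close> \<open>open D\<close> \<open>f holomorphic_on D\<close>] by blast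
  have "((\<lambda>z. g z - g c) has_field_derivative f z) (at z)" if "z \<in> D" for z
    using DERIV_diff[OF g[OF that] DERIV_const] that \<open>open D\<close> by (simp add: at_within_open[of z D])
  then show ?thesis by (intro exI[of _ "\<lambda>z. g z - g c"]) auto
qed

text \<open>Integration along the segment from \<open>c\<close> gains a factor 1/(k+1). Iterated,
  this produces the factorials that make the Picard series converge on all of \<open>D\<close>, even
  when \<open>D\<close> is unbounded.\<close>

lemma norm_bound_along_segment:
  fixes f f' :: "complex \<Rightarrow> complex"
  assumes "convex D" "c \<in> D" "z \<in> D" "f c = 0"
    and der: "\<And>w. w \<in> D \<Longrightarrow> (f has_field_derivative f' w) (at w)"
    and bound: "\<And>w. w \<in> D \<Longrightarrow> norm (f' w) \<le> b * norm (w - c) ^ k"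
  shows "norm (f z) \<le> b * norm (z - c) ^ Suc k / Suc k"
proof -
  define h where "h s = c + of_real s * (z - c)" for s :: real
  have h_in: "h s \<in> D" if "0 \<le> s" "s \<le> 1" for s
  proof -
    have "h s = (1 - s) *\<^sub>R c + s *\<^sub>R z" by (simp add: h_def scaleR_conv_of_real algebra_simps)
    then show ?thesis using assms(1-3) that by (simp add: convex_def)
  qed
  have hder: "((\<lambda>s. f (h s)) has_vector_derivative (z - c) * f' (h s)) (at s)" if "0 \<le> s" "s \<le> 1" for s
  proof -
    have "(h has_vector_derivative (z - c)) (at s)"
      unfolding h_def by (auto intro!: derivative_eq_intros)
    from field_vector_diff_chain_at[OF this der[OF h_in[OF that]]] show ?thesis by (simp add: o_def)
  qed
  have "norm (f (h 1) - f (h 0)) \<le> b * norm (z - c) ^ Suc k * 1 ^ Suc k / Suc k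
        - b * norm (z - c) ^ Suc k * 0 ^ Suc k / Suc k"
  proof (rule differentiable_bound_general[where a=0 and b=1])
    show "(0::real) < 1" by simp
    show "continuous_on {0..1} (\<lambda>s. f (h s))"
      using hder by (intro continuous_at_imp_continuous_on ballI has_vector_derivative_continuous) auto
    show "continuous_on {0..1} (\<lambda>s::real. b * norm (z - c) ^ Suc k * s ^ Suc k / Suc k)"
      by (intro continuous_intros) auto
    fix s :: real assume s: "0 < s" "s < 1"
    show "((\<lambda>s. f (h s)) has_vector_derivative (z - c) * f' (h s)) (at s)" using hder s by auto
    have "((\<lambda>s::real. b * norm (z - c) ^ Suc k * s ^ Suc k / Suc k) has_field_derivative
       b * norm (z - c) ^ Suc k * (real (Suc k) * s ^ k) / Suc k) (at s)"
      by (rule derivative_eq_intros refl | simp)+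
    then show "((\<lambda>s::real. b * norm (z - c) ^ Suc k * s ^ Suc k / Suc k) has_vector_derivative
       b * norm (z - c) ^ Suc k * s ^ k) (at s)"
      by (simp add: has_real_derivative_iff_has_vector_derivative mult.assoc del: of_nat_Suc power_Suc)
    have "norm (f' (h s)) \<le> b * norm (h s - c) ^ k" using bound h_in s by auto
    also have "norm (h s - c) = s * norm (z - c)" using s by (simp add: h_def norm_mult)
    finally have "norm ((z - c) * f' (h s)) \<le> norm (z - c) * (b * (s * norm (z - c)) ^ k)"
      by (simp add: norm_mult mult_left_mono)
    then show "norm ((z - c) * f' (h s)) \<le> b * norm (z - c) ^ Suc k * s ^ k"
      by (simp add: power_mult_distrib mult_ac)
  qed
  then show ?thesis using \<open>f c = 0\<close> by (simp add: h_def)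
qed

text \<open>Picard iteration, with convexity providing the primitives. The explicit exponential
  bound is part of the conclusion because, on a half plane in a logarithmic coordinate, it becomes
  the moderate growth of solutions at a singular point.\<close>

lemma linear_ode_exists:
  fixes A :: "complex \<Rightarrow> nat \<Rightarrow> nat \<Rightarrow> complex" and p :: nat and K :: real
  assumes D: "convex D" "open D" "c \<in> D"
    and hol: "\<And>i j. i < p \<Longrightarrow> j < p \<Longrightarrow> (\<lambda>z. A z i j) holomorphic_on D"
    and bound: "\<And>z i j. z \<in> D \<Longrightarrow> i < p \<Longrightarrow> j < p \<Longrightarrow> norm (A z i j) \<le> K"
  shows "\<exists>U :: complex \<Rightarrow> nat \<Rightarrow> nat \<Rightarrow> complex.
    (\<forall>i<p. \<forall>j<p. U c i j = (if i = j then 1 else 0)) \<and>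
    (\<forall>z\<in>D. \<forall>i<p. \<forall>j<p. ((\<lambda>z. U z i j) has_field_derivative (\<Sum>l<p. A z i l * U z l j)) (at z) \<and>
        norm (U z i j) \<le> exp (p * K * norm (z - c)))"
proof (cases "p = 0")
  case True
  then show ?thesis by auto
next
  case False
  then have "0 < p" by simp
  then have K: "K \<ge> 0" using bound[OF \<open>c \<in> D\<close>, of 0 0] norm_ge_zero order_trans by blast
  \<comment> \<open>A total choice of primitive, so that the iterates can be defined by plain
    recursion before they are known to be holomorphic.\<close>
  define prim where "prim f = (SOME g. g c = 0 \<and> (\<forall>z\<in>D. (g has_field_derivative f z) (at z)))"
    for f :: "complex \<Rightarrow> complex"
  have prim: "prim f c = 0 \<and> (\<forall>z\<in>D. (prim f has_field_derivative f z) (at z))"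
    if "f holomorphic_on D" for f
    unfolding prim_def by (rule someI_ex[OF primitive_exists_convex[OF D(1,2) that]])
  \<comment> \<open>\<open>T k\<close> is the \<open>k\<close>-fold iterated integral of the
    Peano-Baker series; the solution is the sum over \<open>k\<close>.\<close>
  define T :: "nat \<Rightarrow> nat \<Rightarrow> nat \<Rightarrow> complex \<Rightarrow> complex" where
    "T = rec_nat (\<lambda>i j z. if i = j then 1 else 0) (\<lambda>k T i j. prim (\<lambda>w. \<Sum>l<p. A w i l * T l j w))"
  have T0: "T 0 i j z = (if i = j then 1 else 0)" for i j z by (simp add: T_def)
  have TS: "T (Suc k) i j = prim (\<lambda>w. \<Sum>l<p. A w i l * T k l j w)" for k i j by (simp add: T_def)
  have Thol: "T k i j holomorphic_on D" if "i < p" "j < p" for k i j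
    using that
  proof (induction k arbitrary: i j)
    case 0
    have "T 0 i j = (\<lambda>z. if i = j then 1 else 0)" by (simp add: T0 fun_eq_iff)
    then show ?case by simp
  next
    case (Suc k)
    have "(\<lambda>w. \<Sum>l<p. A w i l * T k l j w) holomorphic_on D"
      using Suc hol by (intro holomorphic_intros) auto
    from prim[OF this] show ?case unfolding TS
      using D(2) by (auto simp: holomorphic_on_open)
  qed
  have Tint: "(\<lambda>w. \<Sum>l<p. A w i l * T k l j w) holomorphic_on D" if "i < p" "j < p" for k i j
    using that hol Thol by (intro holomorphic_intros) auto
  note TSd = prim[OF Tint, folded TS]
  have Tb: "norm (T k i j z) \<le> (p * K) ^ k / fact k * norm (z - c) ^ k"
    if "i < p" "j < p" "z \<in> D" for k i j z
    using that
  proof (induction k arbitrary: i j z)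
    case 0
    then show ?case by (simp add: T0)
  next
    case (Suc k)
    have "norm (T (Suc k) i j z) \<le> ((p * K) ^ Suc k / fact k) * norm (z - c) ^ Suc k / Suc k"
    proof (rule norm_bound_along_segment[OF D(1) D(3) \<open>z \<in> D\<close>])
      show "T (Suc k) i j c = 0" using TSd Suc.prems by blast
      fix w assume w: "w \<in> D"
      show "(T (Suc k) i j has_field_derivative (\<Sum>l<p. A w i l * T k l j w)) (at w)"
        using TSd Suc.prems w by blast
      have "norm (\<Sum>l<p. A w i l * T k l j w) \<le> (\<Sum>l<p. K * ((p * K) ^ k / fact k * norm (w - c) ^ k))"
        using bound[OF w] Suc.IH[OF _ _ w] Suc.prems K
        by (intro sum_norm_le) (simp only: norm_mult, intro mult_mono, auto)
      also have "\<dots> = (p * K) ^ Suc k / fact k * norm (w - c) ^ k" by simp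
      finally show "norm (\<Sum>l<p. A w i l * T k l j w) \<le> (p * K) ^ Suc k / fact k * norm (w - c) ^ k" .
    qed
    then show ?case by (simp add: field_simps)
  qed
  \<comment> \<open>Term \<open>k\<close> differentiates to \<open>A\<close> times term
    \<open>k - 1\<close>, so the differentiated series lags by one index; it starts with 0 because
    \<open>T 0\<close> is constant.\<close>
  define T' where "T' k i j z = (case k of 0 \<Rightarrow> 0 | Suc m \<Rightarrow> \<Sum>l<p. A z i l * T m l j z)" for k i j z
  have ex: "\<exists>g g'. \<forall>z\<in>D. (\<lambda>k. T k i j z) sums g z \<and> (\<lambda>k. T' k i j z) sums g' z
      \<and> (g has_field_derivative g' z) (at z)" if ij: "i < p" "j < p" for i j
  proof (rule series_and_derivative_comparison_local[OF D(2)])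
    fix k z assume z: "z \<in> D"
    show "(T k i j has_field_derivative T' k i j z) (at z)"
    proof (cases k)
      case 0
      have "T 0 i j = (\<lambda>z. if i = j then 1 else 0)" by (simp add: T0 fun_eq_iff)
      then show ?thesis using 0 by (simp add: T'_def)
    next
      case (Suc m)
      then show ?thesis using TSd[OF ij, of m] z by (simp add: T'_def)
    qed
  next
    fix z assume z: "z \<in> D"
    define R where "R = norm (z - c) + 1"
    have R: "norm (y - c) \<le> R" if "y \<in> ball z 1" for y
      using that norm_triangle_ineq[of "y - z" "z - c"] by (simp add: R_def dist_norm norm_minus_commute)
    have "summable (\<lambda>k. (p * K * R) ^ k / fact k)"
      using summable_exp[of "p * K * R"] by (simp add: field_simps)
    moreover have "norm (T k i j y) \<le> (p * K * R) ^ k / fact k" if "y \<in> ball z 1 \<inter> D" for y k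
    proof -
      have "norm (T k i j y) \<le> (p * K) ^ k / fact k * norm (y - c) ^ k" using Tb ij that by auto
      also have "\<dots> \<le> (p * K) ^ k / fact k * R ^ k"
        using R that K by (intro mult_left_mono power_mono) auto
      finally show ?thesis by (simp add: power_mult_distrib)
    qed
    ultimately show "\<exists>d h. 0 < d \<and> summable h \<and>
       (\<forall>\<^sub>F k in sequentially. \<forall>y\<in>ball z d \<inter> D. norm (T k i j y) \<le> h k)"
      by (intro exI[of _ 1] exI[of _ "\<lambda>k. (p * K * R) ^ k / fact k"]) auto
  qed
  define V where "V i j z = (\<Sum>k. T k i j z)" for i j z
  have V: "\<exists>v'. (\<lambda>k. T k i j z) sums V i j z \<and> (\<lambda>k. T' k i j z) sums v'
      \<and> (V i j has_field_derivative v') (at z)" if ij: "i < p" "j < p" and z: "z \<in> D" for i j z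
  proof -
    obtain g g' where g: "\<forall>z\<in>D. (\<lambda>k. T k i j z) sums g z \<and> (\<lambda>k. T' k i j z) sums g' z
      \<and> (g has_field_derivative g' z) (at z)" using ex[OF ij] by (elim exE)
    then have gV: "g y = V i j y" if "y \<in> D" for y
      using that sums_unique unfolding V_def by blast
    have "(V i j has_field_derivative g' z) (at z)"
      by (rule has_field_derivative_transform_within_open[of g _ _ D]) (use g gV z D(2) in auto)
    then show ?thesis using g gV[OF z] z by (intro exI[of _ "g' z"]) auto
  qed
  show ?thesis
  proof (intro exI[of _ "\<lambda>z i j. V i j z"] conjI allI impI ballI)
    fix i j assume ij: "i < p" "j < p"
    have "T k i j c = 0" if "k \<noteq> 0" for k
      using TSd[OF ij] that by (cases k) auto
    then have "(\<lambda>k. T k i j c) sums (\<Sum>k\<in>{0}. T k i j c)"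
      by (intro sums_finite) auto
    then show "V i j c = (if i = j then 1 else 0)"
      unfolding V_def by (simp add: T0 sums_iff)
  next
    fix z i j assume z: "z \<in> D" and ij: "i < p" "j < p"
    obtain v' where v': "(\<lambda>k. T k i j z) sums V i j z" "(\<lambda>k. T' k i j z) sums v'"
      "(V i j has_field_derivative v') (at z)" using V[OF ij z] by blast
    have "(\<lambda>k. \<Sum>l<p. A z i l * T k l j z) sums (\<Sum>l<p. A z i l * V l j z)"
      by (intro sums_sum sums_mult) (use V ij z in blast)
    moreover have "(\<lambda>k. T' (Suc k) i j z) sums v'"
      using v'(2) by (subst sums_Suc_iff) (simp add: T'_def)
    ultimately have "v' = (\<Sum>l<p. A z i l * V l j z)"
      by (simp add: T'_def sums_unique2)
    then show "((\<lambda>z. V i j z) has_field_derivative (\<Sum>l<p. A z i l * V l j z)) (at z)"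
      using v'(3) by simp
    have "(\<lambda>k. (p * K * norm (z - c)) ^ k / fact k) sums exp (p * K * norm (z - c))"
      using exp_converges[of "p * K * norm (z - c)"] by (simp add: field_simps)
    then show "norm (V i j z) \<le> exp (p * K * norm (z - c))"
      using norm_sums_le[OF v'(1)] Tb[OF ij z] by (simp add: power_mult_distrib field_simps)
  qed
qed

text \<open>The inverse fundamental matrix solves the adjoint equation; having both at hand yields
  invertibility and uniqueness of solutions without further estimates.\<close>
lemma fundamental_matrix_exists:
  fixes A :: "complex \<Rightarrow> nat \<Rightarrow> nat \<Rightarrow> complex" and p :: nat and K :: real
  assumes D: "convex D" "open D" "c \<in> D"
    and hol: "\<And>i j. i < p \<Longrightarrow> j < p \<Longrightarrow> (\<lambda>z. A z i j) holomorphic_on D"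
    and bound: "\<And>z i j. z \<in> D \<Longrightarrow> i < p \<Longrightarrow> j < p \<Longrightarrow> norm (A z i j) \<le> K"
  obtains U Z :: "complex \<Rightarrow> complex mat"
  where "\<And>z. U z \<in> carrier_mat p p" "\<And>z. Z z \<in> carrier_mat p p" "U c = 1\<^sub>m p"
    and "\<And>z. z \<in> D \<Longrightarrow> Z z * U z = 1\<^sub>m p" "\<And>z. z \<in> D \<Longrightarrow> U z * Z z = 1\<^sub>m p"
    and "\<And>z i j. z \<in> D \<Longrightarrow> i < p \<Longrightarrow> j < p \<Longrightarrow>
           ((\<lambda>z. U z $$ (i, j)) has_field_derivative (\<Sum>l<p. A z i l * U z $$ (l, j))) (at z)"
    and "\<And>z i j. z \<in> D \<Longrightarrow> i < p \<Longrightarrow> j < p \<Longrightarrow>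
           ((\<lambda>z. Z z $$ (i, j)) has_field_derivative - (\<Sum>l<p. Z z $$ (i, l) * A z l j)) (at z)"
    and "\<And>z i j. z \<in> D \<Longrightarrow> i < p \<Longrightarrow> j < p \<Longrightarrow> norm (U z $$ (i, j)) \<le> exp (p * K * norm (z - c))"
proof -
  obtain u where u: "\<forall>i<p. \<forall>j<p. u c i j = (if i = j then 1 else 0)"
    "\<forall>z\<in>D. \<forall>i<p. \<forall>j<p. ((\<lambda>z. u z i j) has_field_derivative (\<Sum>l<p. A z i l * u z l j)) (at z) \<and>
        norm (u z i j) \<le> exp (p * K * norm (z - c))"
    using linear_ode_exists[OF D, of p A K] hol bound by auto
  \<comment> \<open>The inverse must satisfy Z' = - Z A. Its transpose solves a system with
    coefficient matrix minus the transpose of \<open>A\<close>, to which the same existence result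
    applies.\<close>
  have "\<exists>w. (\<forall>i<p. \<forall>j<p. w c i j = (if i = j then 1 else 0)) \<and>
    (\<forall>z\<in>D. \<forall>i<p. \<forall>j<p. ((\<lambda>z. w z i j) has_field_derivative (\<Sum>l<p. - A z l i * w z l j)) (at z) \<and>
        norm (w z i j) \<le> exp (p * K * norm (z - c)))"
  proof (rule linear_ode_exists[OF D])
    show "(\<lambda>z. - A z j i) holomorphic_on D" if "i < p" "j < p" for i j
      using hol that by (intro holomorphic_on_minus) auto
    show "norm (- A z j i) \<le> K" if "z \<in> D" "i < p" "j < p" for z i j
      using bound that by simp
  qed
  then obtain w where w: "\<forall>i<p. \<forall>j<p. w c i j = (if i = j then 1 else 0)"
    "\<forall>z\<in>D. \<forall>i<p. \<forall>j<p. ((\<lambda>z. w z i j) has_field_derivative (\<Sum>l<p. - A z l i * w z l j)) (at z)"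
    by auto
  define U where "U z = mat p p (\<lambda>(i, j). u z i j)" for z
  define Z where "Z z = mat p p (\<lambda>(i, j). w z j i)" for z
  have ZU: "Z z * U z = 1\<^sub>m p" if z: "z \<in> D" for z
  proof (rule eq_matI)
    fix i j assume "i < dim_row (1\<^sub>m p :: complex mat)" "j < dim_col (1\<^sub>m p :: complex mat)"
    then have ij: "i < p" "j < p" by auto
    have "((\<lambda>z. \<Sum>l<p. w z l i * u z l j) has_field_derivative 0) (at z)" if z: "z \<in> D" for z
    proof -
      have "((\<lambda>z. \<Sum>l<p. w z l i * u z l j) has_field_derivative
         (\<Sum>l<p. (\<Sum>m<p. - A z m l * w z m i) * u z l j + (\<Sum>m<p. A z l m * u z m j) * w z l i)) (at z)"
        using u(2) w(2) z ij by (intro DERIV_sum DERIV_mult) auto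
      also have "(\<Sum>l<p. (\<Sum>m<p. - A z m l * w z m i) * u z l j + (\<Sum>m<p. A z l m * u z m j) * w z l i)
         = - (\<Sum>l<p. \<Sum>m<p. A z m l * w z m i * u z l j) + (\<Sum>l<p. \<Sum>m<p. A z l m * w z l i * u z m j)"
        by (simp add: sum.distrib sum_subtractf sum_distrib_right sum_distrib_left sum_negf mult_ac)
      also have "(\<Sum>l<p. \<Sum>m<p. A z l m * w z l i * u z m j) = (\<Sum>l<p. \<Sum>m<p. A z m l * w z m i * u z l j)"
        by (rule sum.swap)
      finally show ?thesis by simp
    qed
    then have "\<exists>k. \<forall>z\<in>D. (\<Sum>l<p. w z l i * u z l j) = k"
      using has_field_derivative_zero_constant[OF D(1)] by (blast intro: has_field_derivative_at_within)
    then obtain k where k: "\<And>z. z \<in> D \<Longrightarrow> (\<Sum>l<p. w z l i * u z l j) = k" by blast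
    have "(\<Sum>l<p. w c l i * u c l j) = (\<Sum>l<p. if l = i then (if i = j then 1 else 0) else 0)"
      using u(1) w(1) ij by (intro sum.cong) auto
    then have "k = (if i = j then 1 else 0)" using k[OF D(3)] ij by simp
    then show "(Z z * U z) $$ (i, j) = 1\<^sub>m p $$ (i, j)"
      using ij k[OF z] by (subst index_mult_sum[of _ p p _ p]) (auto simp: Z_def U_def)
  qed (auto simp: Z_def U_def)
  have UZ: "U z * Z z = 1\<^sub>m p" if z: "z \<in> D" for z
    by (rule mat_mult_left_right_inverse[OF _ _ ZU[OF z]]) (auto simp: U_def Z_def)
  show ?thesis
  proof (rule that[of U Z, OF _ _ _ ZU UZ])
    show "U c = 1\<^sub>m p" using u(1) by (intro eq_matI) (auto simp: U_def)
    fix z i j assume *: "z \<in> D" "i < p" "j < p"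
    show "((\<lambda>z. U z $$ (i, j)) has_field_derivative (\<Sum>l<p. A z i l * U z $$ (l, j))) (at z)"
      using u(2) * by (simp add: U_def)
    have "(\<Sum>l<p. - A z l j * w z l i) = - (\<Sum>l<p. w z l i * A z l j)"
      by (simp add: sum_negf mult_ac)
    then show "((\<lambda>z. Z z $$ (i, j)) has_field_derivative - (\<Sum>l<p. Z z $$ (i, l) * A z l j)) (at z)"
      using w(2)[rule_format, OF *(1,3,2)] * by (simp add: Z_def)
    show "norm (U z $$ (i, j)) \<le> exp (p * K * norm (z - c))" using u(2) * by (simp add: U_def)
  qed (auto simp: U_def Z_def)
qed

section \<open>Square systems and traces\<close>

definition indep_cols :: "nat \<Rightarrow> nat \<Rightarrow> (nat \<Rightarrow> nat \<Rightarrow> complex) \<Rightarrow> bool" where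
  "indep_cols p d X \<longleftrightarrow> (\<forall>c. (\<forall>l<p. (\<Sum>j<d. X l j * c j) = 0) \<longrightarrow> (\<forall>j<d. c j = 0))"

lemma indep_colsD:
  assumes "indep_cols p d X" "\<And>l. l < p \<Longrightarrow> (\<Sum>j<d. X l j * c j) = 0" "j < d"
  shows "c j = 0"
  using assms unfolding indep_cols_def by blast

lemma det_nonzero_of_indep_cols:
  assumes "indep_cols d d X"
  shows "det (mat d d (\<lambda>(l, j). X l j)) \<noteq> 0"
proof
  define M where "M = mat d d (\<lambda>(l, j). X l j)"
  have M: "M \<in> carrier_mat d d" by (simp add: M_def)
  assume "det (mat d d (\<lambda>(l, j). X l j)) = 0"
  then obtain v where v: "v \<in> carrier_vec d" "v \<noteq> 0\<^sub>v d" "M *\<^sub>v v = 0\<^sub>v d"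
    using det_0_iff_vec_prod_zero[OF M] by (auto simp: M_def)
  have "(\<Sum>j<d. X l j * vec_index v j) = 0" if "l < d" for l
  proof -
    have "vec_index (M *\<^sub>v v) l = 0" using v(3) that by simp
    then show ?thesis using that v(1) by (simp add: M_def scalar_prod_def lessThan_atLeast0)
  qed
  then have "\<forall>j<d. vec_index v j = 0" using assms unfolding indep_cols_def by blast
  then have "v = 0\<^sub>v d" using v(1) by (intro eq_vecI) auto
  then show False using v(2) by simp
qed

text \<open>Stated over a commutative ring because it serves both numerical matrices and polynomial
  ones, where it yields Cramer's rule with a polynomial denominator.\<close>

lemma adjugate_entries:
  fixes X :: "nat \<Rightarrow> nat \<Rightarrow> 'a :: comm_ring_1"
  obtains Y where "\<And>i j. i < d \<Longrightarrow> j < d \<Longrightarrow>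
      (\<Sum>k<d. X i k * Y k j) = (if i = j then det (mat d d (\<lambda>(l, j). X l j)) else 0)"
    and "\<And>i j. i < d \<Longrightarrow> j < d \<Longrightarrow>
      (\<Sum>k<d. Y i k * X k j) = (if i = j then det (mat d d (\<lambda>(l, j). X l j)) else 0)"
proof -
  define M where "M = mat d d (\<lambda>(l, j). X l j)"
  have M: "M \<in> carrier_mat d d" by (simp add: M_def)
  note adj = adj_mat[OF M]
  show ?thesis
  proof (rule that[of "\<lambda>i j. adj_mat M $$ (i, j)"], fold M_def)
    fix i j assume ij: "i < d" "j < d"
    have "(\<Sum>k<d. X i k * adj_mat M $$ (k, j)) = (M * adj_mat M) $$ (i, j)"
      using ij by (subst index_mult_sum[OF M adj(1) ij]) (auto simp: M_def intro!: sum.cong)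
    then show "(\<Sum>k<d. X i k * adj_mat M $$ (k, j)) = (if i = j then det M else 0)"
      using adj(2) ij by simp
    have "(\<Sum>k<d. adj_mat M $$ (i, k) * X k j) = (adj_mat M * M) $$ (i, j)"
      using ij by (subst index_mult_sum[OF adj(1) M ij]) (auto simp: M_def intro!: sum.cong)
    then show "(\<Sum>k<d. adj_mat M $$ (i, k) * X k j) = (if i = j then det M else 0)"
      using adj(3) ij by simp
  qed
qed

lemma square_system_solvable:
  fixes X :: "nat \<Rightarrow> nat \<Rightarrow> complex"
  assumes "indep_cols d d X"
  obtains c where "\<And>l. l < d \<Longrightarrow> (\<Sum>j<d. X l j * c j) = v l"
proof -
  define D where "D = det (mat d d (\<lambda>(l, j). X l j))"
  have D: "D \<noteq> 0" unfolding D_def by (rule det_nonzero_of_indep_cols[OF assms])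
  obtain Y where Y: "\<And>i j. i < d \<Longrightarrow> j < d \<Longrightarrow> (\<Sum>k<d. X i k * Y k j) = (if i = j then D else 0)"
    unfolding D_def by (rule adjugate_entries[where X=X and d=d]) blast
  show ?thesis
  proof (rule that[of "\<lambda>j. (\<Sum>m<d. Y j m * v m) / D"])
    fix l assume l: "l < d"
    have "(\<Sum>j<d. X l j * (\<Sum>m<d. Y j m * v m)) = (\<Sum>j<d. \<Sum>m<d. X l j * Y j m * v m)"
      by (simp add: sum_distrib_left mult.assoc)
    also have "\<dots> = (\<Sum>m<d. (\<Sum>j<d. X l j * Y j m) * v m)"
      by (subst sum.swap) (simp add: sum_distrib_right)
    also have "\<dots> = (\<Sum>m<d. if m = l then D * v m else 0)" using Y l by (intro sum.cong) auto
    also have "\<dots> = D * v l" using l by simp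
    finally show "(\<Sum>j<d. X l j * ((\<Sum>m<d. Y j m * v m) / D)) = v l"
      using D by (simp add: sum_divide_distrib[symmetric])
  qed
qed

text \<open>Schur triangularisation and cyclic invariance of the trace; \<open>es\<close> lists the
  roots of the characteristic polynomial with repetition.\<close>

lemma trace_eq_sum_eigenvalues:
  fixes R :: "complex mat"
  assumes R: "R \<in> carrier_mat d d"
  obtains es where "length es = d" "\<And>e. e \<in> set es \<Longrightarrow> eigenvalue R e" "(\<Sum>j<d. R $$ (j, j)) = sum_list es"
proof -
  obtain es where es: "char_poly R = (\<Prod>e\<leftarrow>es. [:- e, 1:])" "length es = d"
    using char_poly_factorized[OF R] by auto
  obtain T P Q where TPQ: "schur_decomposition R es = (T, P, Q)" by (cases "schur_decomposition R es")
  from schur_decomposition[OF R es(1) TPQ]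
  have sim: "similar_mat_wit R T P Q" and diag: "diag_mat T = es" by auto
  from similar_mat_witD2[OF R sim]
  have PQ: "P * Q = 1\<^sub>m d" "Q * P = 1\<^sub>m d" "R = P * T * Q"
    and c: "T \<in> carrier_mat d d" "P \<in> carrier_mat d d" "Q \<in> carrier_mat d d" by auto
  have "(\<Sum>j<d. R $$ (j, j)) = (\<Sum>j<d. \<Sum>l<d. (P * T) $$ (j, l) * Q $$ (l, j))"
    unfolding PQ(3) using c by (intro sum.cong refl index_mult_sum) auto
  also have "\<dots> = (\<Sum>l<d. \<Sum>j<d. Q $$ (l, j) * (P * T) $$ (j, l))"
    by (subst sum.swap) (simp add: mult.commute)
  also have "\<dots> = (\<Sum>l<d. (Q * (P * T)) $$ (l, l))"
    using c by (intro sum.cong refl index_mult_sum[symmetric]) auto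
  also have "Q * (P * T) = (Q * P) * T" by (rule assoc_mult_mat[symmetric, OF c(3) c(2) c(1)])
  also have "\<dots> = T" using c PQ by simp
  also have "(\<Sum>l<d. T $$ (l, l)) = sum_list es"
    unfolding diag[symmetric] diag_mat_def using c by (simp add: sum_list_sum_nth lessThan_atLeast0)
  finally have tr: "(\<Sum>j<d. R $$ (j, j)) = sum_list es" .
  have "eigenvalue R e" if "e \<in> set es" for e
    unfolding eigenvalue_root_char_poly[OF R] es(1) poly_prod_list
    using that by (auto simp: prod_list_zero_iff image_iff)
  then show ?thesis using that es(2) tr by blast
qed

text \<open>The columns of \<open>X\<close> span a \<open>B\<close>-invariant subspace on which
  \<open>B\<close> acts by \<open>R\<close>. If \<open>v\<close> is an eigenvector of
  \<open>R\<close>, then \<open>X v\<close> is one of \<open>B\<close>, non-zero by independence; so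
  all \<open>d\<close> eigenvalues of \<open>R\<close> obey the bound for \<open>B\<close>.
  Strictness survives summation because \<open>0 < d\<close>.\<close>

lemma Re_trace_restriction_gt:
  fixes B :: "complex mat" and b :: real
  assumes B: "B \<in> carrier_mat p p" and X: "indep_cols p d X" and "0 < d"
    and BX: "\<And>l j. l < p \<Longrightarrow> j < d \<Longrightarrow> (\<Sum>m<p. B $$ (l, m) * X m j) = (\<Sum>k<d. X l k * R k j)"
    and ev: "\<And>\<beta>. eigenvalue B \<beta> \<Longrightarrow> b < Re \<beta>"
  shows "real d * b < Re (\<Sum>j<d. R j j)"
proof -
  define Rm where "Rm = mat d d (\<lambda>(k, j). R k j)"
  have Rm: "Rm \<in> carrier_mat d d" by (simp add: Rm_def)
  have "eigenvalue B \<beta>" if \<beta>: "eigenvalue Rm \<beta>" for \<beta>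
  proof -
    obtain v where v: "v \<in> carrier_vec d" "v \<noteq> 0\<^sub>v d" "Rm *\<^sub>v v = \<beta> \<cdot>\<^sub>v v"
      using \<beta> Rm unfolding eigenvalue_def eigenvector_def by auto
    have Rv: "(\<Sum>j<d. R k j * vec_index v j) = \<beta> * vec_index v k" if "k < d" for k
    proof -
      have "vec_index (Rm *\<^sub>v v) k = (\<Sum>j<d. R k j * vec_index v j)"
        using that v(1) by (simp add: Rm_def scalar_prod_def lessThan_atLeast0)
      then show ?thesis using v that by simp
    qed
    define u where "u = vec p (\<lambda>l. \<Sum>j<d. X l j * vec_index v j)"
    have u: "u \<in> carrier_vec p" by (simp add: u_def)
    have "B *\<^sub>v u = \<beta> \<cdot>\<^sub>v u"
    proof (rule eq_vecI)
      fix l assume "l < dim_vec (\<beta> \<cdot>\<^sub>v u)"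
      then have l: "l < p" by (simp add: u_def)
      have "vec_index (B *\<^sub>v u) l = (\<Sum>m<p. B $$ (l, m) * (\<Sum>j<d. X m j * vec_index v j))"
        using l B by (simp add: u_def scalar_prod_def lessThan_atLeast0)
      also have "\<dots> = (\<Sum>j<d. (\<Sum>m<p. B $$ (l, m) * X m j) * vec_index v j)"
        by (simp add: sum_distrib_left sum_distrib_right mult.assoc) (rule sum.swap)
      also have "\<dots> = (\<Sum>j<d. (\<Sum>k<d. X l k * R k j) * vec_index v j)" using BX l by simp
      also have "\<dots> = (\<Sum>k<d. X l k * (\<Sum>j<d. R k j * vec_index v j))"
        by (simp add: sum_distrib_left sum_distrib_right mult.assoc) (rule sum.swap)
      also have "\<dots> = (\<Sum>k<d. X l k * (\<beta> * vec_index v k))" using Rv by simp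
      also have "\<dots> = vec_index (\<beta> \<cdot>\<^sub>v u) l" using l by (simp add: u_def sum_distrib_left mult_ac)
      finally show "vec_index (B *\<^sub>v u) l = vec_index (\<beta> \<cdot>\<^sub>v u) l" .
    qed (use B in \<open>simp add: u_def\<close>)
    moreover have "u \<noteq> 0\<^sub>v p"
    proof
      assume "u = 0\<^sub>v p"
      then have "vec_index u l = 0" if "l < p" for l using that by simp
      then have "\<forall>l<p. (\<Sum>j<d. X l j * vec_index v j) = 0" by (simp add: u_def)
      then have "\<forall>j<d. vec_index v j = 0" using X unfolding indep_cols_def by blast
      then have "v = 0\<^sub>v d" using v(1) by (intro eq_vecI) auto
      then show False using v(2) by simp
    qed
    ultimately show ?thesis using u B unfolding eigenvalue_def eigenvector_def by auto
  qed
  then have Rev: "b < Re \<beta>" if "eigenvalue Rm \<beta>" for \<beta> using that ev by blast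
  obtain es where es: "length es = d" "\<And>e. e \<in> set es \<Longrightarrow> eigenvalue Rm e"
    "(\<Sum>j<d. Rm $$ (j, j)) = sum_list es"
    using trace_eq_sum_eigenvalues[OF Rm] by blast
  have "(\<Sum>j<d. b) < (\<Sum>j<d. Re (es ! j))"
    using \<open>0 < d\<close> es Rev by (intro sum_strict_mono) auto
  also have "\<dots> = Re (sum_list es)" using es(1) by (simp add: sum_list_sum_nth lessThan_atLeast0)
  also have "sum_list es = (\<Sum>j<d. R j j)" unfolding es(3)[symmetric] by (simp add: Rm_def)
  finally show ?thesis by simp
qed

section \<open>Polynomial frames\<close>

lemma coeff_mult_at_degree_bounds:
  fixes f g :: "'a :: comm_ring_1 poly"
  assumes "degree f \<le> m" "degree g \<le> k"
  shows "coeff (f * g) (m + k) = coeff f m * coeff g k"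
proof -
  have "coeff (f * g) (m + k) = (\<Sum>i\<le>m + k. if i = m then coeff f m * coeff g k else 0)"
    unfolding coeff_mult
  proof (intro sum.cong refl)
    fix i assume "i \<in> {..m + k}"
    consider "i < m" | "i = m" | "i > m" by linarith
    then show "coeff f i * coeff g (m + k - i) = (if i = m then coeff f m * coeff g k else 0)"
    proof cases
      case 1
      then have "coeff g (m + k - i) = 0" using assms by (intro coeff_eq_0) auto
      then show ?thesis using 1 by simp
    next
      case 3
      then have "coeff f i = 0" using assms by (intro coeff_eq_0) auto
      then show ?thesis using 3 by simp
    qed auto
  qed
  then show ?thesis by simp
qed

lemma coeff_combination_top:
  fixes x k :: "nat \<Rightarrow> complex poly"
  assumes "\<And>j. j < d \<Longrightarrow> degree (x j) \<le> e j"
    and "\<And>j m. j < d \<Longrightarrow> N < m + e j \<Longrightarrow> coeff (k j) m = 0"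
  shows "coeff (\<Sum>j<d. x j * k j) N
    = (\<Sum>j<d. coeff (x j) (e j) * (if e j \<le> N then coeff (k j) (N - e j) else 0))"
  unfolding coeff_sum
proof (intro sum.cong refl)
  fix j assume "j \<in> {..<d}"
  then have j: "j < d" by simp
  show "coeff (x j * k j) N = coeff (x j) (e j) * (if e j \<le> N then coeff (k j) (N - e j) else 0)"
  proof (cases "e j \<le> N")
    case True
    have "degree (k j) \<le> N - e j" using assms(2)[OF j] True by (intro degree_le) auto
    from coeff_mult_at_degree_bounds[OF assms(1)[OF j] this] show ?thesis using True by simp
  next
    \<comment> \<open>For \<open>N < e j\<close> the difference \<open>N - e j\<close> would
      truncate to 0, hence the conditional in the statement. The vanishing assumption then covers
      every \<open>m\<close>, so \<open>k j\<close> is zero.\<close>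
    case False
    then have "k j = 0" using assms(2)[OF j] by (intro poly_eqI) auto
    then show ?thesis by simp
  qed
qed

text \<open>Forney's predictable degree property: no cancellation occurs between the leading terms.\<close>
lemma coeff_zero_of_combination_degree:
  fixes x :: "nat \<Rightarrow> nat \<Rightarrow> complex poly" and k :: "nat \<Rightarrow> complex poly"
  assumes deg: "\<And>l j. l < p \<Longrightarrow> j < d \<Longrightarrow> degree (x l j) \<le> e j"
    and lead: "indep_cols p d (\<lambda>l j. coeff (x l j) (e j))"
    and D: "\<And>l. l < p \<Longrightarrow> degree (\<Sum>j<d. x l j * k j) \<le> D"
    and "j < d" "D < m + e j"
  shows "coeff (k j) m = 0"
proof (rule ccontr)
  assume nz: "coeff (k j) m \<noteq> 0"
  \<comment> \<open>Degrees of all occurring terms, weighted by the column bounds. A violating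
    coefficient pushes the maximum \<open>N\<close> above \<open>D\<close>.\<close>
  define A where "A = {m + e j | m j. j < d \<and> coeff (k j) m \<noteq> 0}"
  have "A \<subseteq> (\<Union>j<d. (\<lambda>m. m + e j) ` {..degree (k j)})"
    unfolding A_def using le_degree by fastforce
  then have fin: "finite A" by (rule finite_subset) auto
  have "m + e j \<in> A" using nz \<open>j < d\<close> by (auto simp: A_def)
  define N where "N = Max A"
  have "m + e j \<le> N" unfolding N_def using fin \<open>m + e j \<in> A\<close> by simp
  have "N \<in> A" unfolding N_def using fin \<open>m + e j \<in> A\<close> by (intro Max_in) auto
  then obtain m' j' where m': "N = m' + e j'" "j' < d" "coeff (k j') m' \<noteq> 0" by (auto simp: A_def)
  have max: "coeff (k i) r = 0" if "i < d" "N < r + e i" for i r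
  proof (rule ccontr)
    assume "coeff (k i) r \<noteq> 0"
    then have "r + e i \<in> A" using that by (auto simp: A_def)
    from Max_ge[OF fin this] show False using that by (simp add: N_def)
  qed
  \<comment> \<open>These are the coefficients of maximal weight. The leading-coefficient matrix
    times \<open>c\<close> is the coefficient of degree \<open>N\<close> of the combination, which
    is zero because \<open>N\<close> exceeds \<open>D\<close>.\<close>
  define c where "c i = (if e i \<le> N then coeff (k i) (N - e i) else 0)" for i
  have "(\<Sum>i<d. coeff (x l i) (e i) * c i) = 0" if "l < p" for l
  proof -
    have "coeff (\<Sum>i<d. x l i * k i) N = 0"
      using D[OF that] \<open>m + e j \<le> N\<close> \<open>D < m + e j\<close> by (intro coeff_eq_0) auto
    then show ?thesis using coeff_combination_top[of d "x l" e N k] deg that max by (simp add: c_def)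
  qed
  then have "c j' = 0" by (rule indep_colsD[OF lead _ m'(2)])
  then show False using m' by (simp add: c_def)
qed

lemma poly_eq_of_cofinite:
  fixes f g :: "complex poly"
  assumes "finite S" "\<And>z. z \<notin> S \<Longrightarrow> poly f z = poly g z"
  shows "f = g"
proof (rule ccontr)
  assume "f \<noteq> g"
  then have "finite {z. poly (f - g) z = 0}" by (intro poly_roots_finite) simp
  moreover have "- S \<subseteq> {z. poly (f - g) z = 0}" using assms(2) by auto
  ultimately have "finite (- S)" using finite_subset by blast
  then show False using \<open>finite S\<close> by (metis Compl_UNIV_eq finite_compl infinite_UNIV_char_0)
qed

text \<open>Vectors are functions of which only the entries below \<open>p\<close> count, which is
  the purpose of \<open>F_cong\<close>. \<open>F_top\<close> says that \<open>F z\<close> projects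
  injectively to its first \<open>d\<close> coordinates; this bounds its dimension by
  \<open>d\<close> and reduces coordinates in a frame to a square system.\<close>

locale subspace_family =
  fixes p d :: nat and F :: "complex \<Rightarrow> (nat \<Rightarrow> complex) \<Rightarrow> bool" and S0 :: "complex set"
  assumes S0: "finite S0" and dp: "d \<le> p"
    and F_zero: "z \<notin> S0 \<Longrightarrow> F z (\<lambda>l. 0)"
    and F_add: "z \<notin> S0 \<Longrightarrow> F z u \<Longrightarrow> F z v \<Longrightarrow> F z (\<lambda>l. u l + v l)"
    and F_scale: "z \<notin> S0 \<Longrightarrow> F z u \<Longrightarrow> F z (\<lambda>l. u l * c)"
    and F_cong: "z \<notin> S0 \<Longrightarrow> F z u \<Longrightarrow> (\<And>l. l < p \<Longrightarrow> u l = v l) \<Longrightarrow> F z v"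
    and F_top: "z \<notin> S0 \<Longrightarrow> F z u \<Longrightarrow> (\<And>l. l < d \<Longrightarrow> u l = 0) \<Longrightarrow> l < p \<Longrightarrow> u l = 0"
begin

lemma F_sum:
  fixes r :: nat
  assumes "z \<notin> S0" "\<And>j. j < r \<Longrightarrow> F z (\<lambda>l. v l j)"
  shows "F z (\<lambda>l. \<Sum>j<r. v l j * c j)"
  using assms(2)
proof (induction r)
  case 0
  then show ?case using F_zero assms by simp
next
  case (Suc r)
  have "F z (\<lambda>l. (\<Sum>j<r. v l j * c j) + v l r * c r)"
    by (rule F_add[OF assms(1)]) (use Suc F_scale assms in auto)
  then show ?case by simp
qed

definition frame_at :: "(nat \<Rightarrow> nat \<Rightarrow> complex poly) \<Rightarrow> complex \<Rightarrow> bool" where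
  "frame_at x z \<longleftrightarrow> (\<forall>j<d. F z (\<lambda>l. poly (x l j) z)) \<and> indep_cols p d (\<lambda>l j. poly (x l j) z)"

definition poly_frame :: "(nat \<Rightarrow> nat \<Rightarrow> complex poly) \<Rightarrow> bool" where
  "poly_frame x \<longleftrightarrow> (\<exists>S. finite S \<and> (\<forall>z. z \<notin> S \<longrightarrow> frame_at x z))"

lemma poly_frameE:
  assumes "poly_frame x"
  obtains S where "finite S" "S0 \<subseteq> S" "\<And>z. z \<notin> S \<Longrightarrow> frame_at x z"
proof -
  obtain S where "finite S" "\<forall>z. z \<notin> S \<longrightarrow> frame_at x z" using assms unfolding poly_frame_def by blast
  then show ?thesis using S0 by (intro that[of "S \<union> S0"]) auto
qed

text \<open>By \<open>F_top\<close>, a combination that vanishes in the first \<open>d\<close> rows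
  vanishes altogether. So the top minor of a frame is a legitimate denominator in Cramer's
  rule.\<close>

lemma frame_at_top:
  assumes z: "z \<notin> S0" and x: "frame_at x z"
  shows "indep_cols d d (\<lambda>l j. poly (x l j) z)"
  unfolding indep_cols_def
proof (intro allI impI)
  fix c j assume c: "\<forall>l<d. (\<Sum>j<d. poly (x l j) z * c j) = 0" and j: "j < d"
  have "F z (\<lambda>l. \<Sum>j<d. poly (x l j) z * c j)"
    using x by (intro F_sum[OF z]) (auto simp: frame_at_def)
  from F_top[OF z this] c have "\<forall>l<p. (\<Sum>j<d. poly (x l j) z * c j) = 0" by simp
  then show "c j = 0" using x j unfolding frame_at_def indep_cols_def by blast
qed

lemma frame_at_span:
  assumes z: "z \<notin> S0" and x: "frame_at x z" and v: "F z v"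
  obtains c where "\<And>l. l < p \<Longrightarrow> v l = (\<Sum>j<d. poly (x l j) z * c j)"
proof -
  obtain c where c: "\<And>l. l < d \<Longrightarrow> (\<Sum>j<d. poly (x l j) z * c j) = v l"
    using square_system_solvable[OF frame_at_top[OF z x]] by blast
  have "F z (\<lambda>l. \<Sum>j<d. poly (x l j) z * c j)"
    using x by (intro F_sum[OF z]) (auto simp: frame_at_def)
  then have "F z (\<lambda>l. v l + (\<Sum>j<d. poly (x l j) z * c j) * (- 1))"
    by (intro F_add[OF z] F_scale[OF z] v)
  from F_top[OF z this] c have "v l + (\<Sum>j<d. poly (x l j) z * c j) * (- 1) = 0" if "l < p" for l
    using that by simp
  then have "v l = (\<Sum>j<d. poly (x l j) z * c j)" if "l < p" for l using that by (simp add: add_eq_0_iff)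
  then show ?thesis using that by blast
qed

text \<open>A Steinitz exchange over functions of \<open>z\<close>. The factor \<open>g\<close> and
  the coefficients \<open>c j\<close> vary with the point, so that the lemma covers both division of
  a column combination by a linear factor and combinations with powers of \<open>z\<close>.\<close>

lemma poly_frame_exchange:
  assumes x: "poly_frame x" and j0: "j0 < d" and "finite S'"
    and g: "\<And>z. z \<notin> S' \<Longrightarrow> g z \<noteq> 0" and c0: "\<And>z. z \<notin> S' \<Longrightarrow> c j0 z \<noteq> 0"
    and y: "\<And>z l. z \<notin> S' \<Longrightarrow> l < p \<Longrightarrow> g z * poly (y l) z = (\<Sum>j<d. poly (x l j) z * c j z)"
  shows "poly_frame (\<lambda>l j. if j = j0 then y l else x l j)"
proof -
  obtain S where S: "finite S" "S0 \<subseteq> S" "\<And>z. z \<notin> S \<Longrightarrow> frame_at x z" using poly_frameE[OF x] by blast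
  have "frame_at (\<lambda>l j. if j = j0 then y l else x l j) z" if "z \<notin> S \<union> S'" for z
  proof -
    have z: "z \<notin> S0" "z \<notin> S'" and fx: "frame_at x z" using that S by auto
    have "F z (\<lambda>l. \<Sum>j<d. poly (x l j) z * (c j z / g z))"
      using fx by (intro F_sum[OF z(1)]) (auto simp: frame_at_def)
    then have Fy: "F z (\<lambda>l. poly (y l) z)"
    proof (rule F_cong[OF z(1)])
      fix l assume l: "l < p"
      have "(\<Sum>j<d. poly (x l j) z * (c j z / g z)) = (\<Sum>j<d. poly (x l j) z * c j z) / g z"
        by (simp add: sum_divide_distrib)
      then show "(\<Sum>j<d. poly (x l j) z * (c j z / g z)) = poly (y l) z"
        unfolding y[OF z(2) l, symmetric] using g[OF z(2)] by simp
    qed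
    have "indep_cols p d (\<lambda>l j. poly (if j = j0 then y l else x l j) z)"
      unfolding indep_cols_def
    proof (intro allI impI)
      fix b j assume b: "\<forall>l<p. (\<Sum>j<d. poly (if j = j0 then y l else x l j) z * b j) = 0" and j: "j < d"
      \<comment> \<open>A relation among the new columns, multiplied by \<open>g z\<close> and with
        the new column expanded, is a relation among the old ones with these coefficients.\<close>
      define b' where "b' i = (if i = j0 then 0 else g z * b i) + b j0 * c i z" for i
      have "(\<Sum>i<d. poly (x l i) z * b' i) = 0" if l: "l < p" for l
      proof -
        have "(\<Sum>i<d. poly (x l i) z * b' i)
           = (\<Sum>i<d. poly (x l i) z * (if i = j0 then 0 else g z * b i)) + b j0 * (g z * poly (y l) z)"
          unfolding y[OF z(2) l] by (simp add: b'_def algebra_simps sum.distrib sum_distrib_left)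
        also have "(\<Sum>i<d. poly (x l i) z * (if i = j0 then 0 else g z * b i))
           = (\<Sum>i\<in>{..<d} - {j0}. g z * (poly (x l i) z * b i))"
          using j0 by (subst sum.remove[of _ j0]) (auto intro!: sum.cong)
        also have "\<dots> = g z * (\<Sum>i\<in>{..<d} - {j0}. poly (x l i) z * b i)" by (simp add: sum_distrib_left)
        also have "\<dots> + b j0 * (g z * poly (y l) z)
           = g z * (\<Sum>i<d. poly (if i = j0 then y l else x l i) z * b i)"
          using j0 by (subst (2) sum.remove[of _ j0]) (auto simp: algebra_simps intro!: sum.cong)
        finally show ?thesis using b l by simp
      qed
      then have b': "\<forall>i<d. b' i = 0" using fx unfolding frame_at_def indep_cols_def by blast
      then have "b j0 = 0" using j0 c0[OF z(2)] by (auto simp: b'_def)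
      then show "b j = 0" using b' j g[OF z(2)] by (auto simp: b'_def split: if_splits)
    qed
    moreover have "F z (\<lambda>l. poly (if j = j0 then y l else x l j) z)" if "j < d" for j
      using fx Fy that by (cases "j = j0") (auto simp: frame_at_def)
    ultimately show ?thesis unfolding frame_at_def by blast
  qed
  then show ?thesis unfolding poly_frame_def using S(1) \<open>finite S'\<close> by (intro exI[of _ "S \<union> S'"]) auto
qed

text \<open>A frame whose column degree bounds have minimal sum is independent at every point and has
  independent leading coefficients: otherwise some column could be replaced by one of lower degree.\<close>
lemma minimal_poly_frame:
  assumes "poly_frame x0"
  obtains x e where "poly_frame x" "\<And>l j. l < p \<Longrightarrow> j < d \<Longrightarrow> degree (x l j) \<le> e j"
    and "\<And>z. indep_cols p d (\<lambda>l j. poly (x l j) z)"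
    and "indep_cols p d (\<lambda>l j. coeff (x l j) (e j))"
proof -
  define P where "P = (\<lambda>(x, e :: nat \<Rightarrow> nat). poly_frame x \<and> (\<forall>l<p. \<forall>j<d. degree (x l j) \<le> e j))"
  define \<mu> where "\<mu> = (\<lambda>(x :: nat \<Rightarrow> nat \<Rightarrow> complex poly, e :: nat \<Rightarrow> nat). \<Sum>j<d. e j)"
  have "degree (x0 l j) \<le> (\<Sum>l<p. degree (x0 l j))" if "l < p" for l j
    using that by (intro member_le_sum) auto
  then have "P (x0, \<lambda>j. \<Sum>l<p. degree (x0 l j))" unfolding P_def using assms by simp
  then obtain xe where xe: "P xe" "\<And>y. P y \<Longrightarrow> \<mu> xe \<le> \<mu> y" using ex_has_least_nat[of P] by blast
  obtain x e where "xe = (x, e)" by (cases xe)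
  with xe have x: "poly_frame x" and deg: "\<And>l j. l < p \<Longrightarrow> j < d \<Longrightarrow> degree (x l j) \<le> e j"
    and min: "\<And>x' e'. poly_frame x' \<Longrightarrow> (\<forall>l<p. \<forall>j<d. degree (x' l j) \<le> e' j) \<Longrightarrow>
      (\<Sum>j<d. e j) \<le> (\<Sum>j<d. e' j)"
    by (auto simp: P_def \<mu>_def)
  have no_exchange: False
    if j0: "j0 < d" "0 < e j0" and fin: "finite S'"
      and g: "\<And>z. z \<notin> S' \<Longrightarrow> g z \<noteq> 0" "\<And>z. z \<notin> S' \<Longrightarrow> c j0 z \<noteq> 0"
      and y: "\<And>z l. z \<notin> S' \<Longrightarrow> l < p \<Longrightarrow> g z * poly (y l) z = (\<Sum>j<d. poly (x l j) z * c j z)"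
      and degy: "\<And>l. l < p \<Longrightarrow> degree (y l) < e j0" for j0 S' g c y
  proof -
    define e' where "e' = e(j0 := e j0 - 1)"
    have "\<forall>l<p. \<forall>j<d. degree (if j = j0 then y l else x l j) \<le> e' j"
      using degy deg by (auto simp: e'_def less_Suc_eq_le[symmetric] j0)
    from min[OF poly_frame_exchange[OF x j0(1) fin g y] this]
    have "(\<Sum>j<d. e j) \<le> (\<Sum>j<d. e' j)" by simp
    moreover have "(\<Sum>j<d. e' j) < (\<Sum>j<d. e j)"
      using j0 by (intro sum_strict_mono_ex1) (auto simp: e'_def)
    ultimately show False by simp
  qed
  obtain S where S: "finite S" "S0 \<subseteq> S" "\<And>z. z \<notin> S \<Longrightarrow> frame_at x z" using poly_frameE[OF x] by blast
  obtain z1 where z1: "z1 \<notin> S" using ex_new_if_finite[OF infinite_UNIV_char_0 S(1)] by blast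
  have ind1: "indep_cols p d (\<lambda>l j. poly (x l j) z1)" using S(3)[OF z1] by (simp add: frame_at_def)
  \<comment> \<open>The column to replace is one of largest degree bound among those occurring in
    the relation; then the whole combination has degree at most \<open>e j0\<close>.\<close>
  have argmax: "\<exists>j0<d. c j0 \<noteq> 0 \<and> (\<forall>j<d. c j \<noteq> 0 \<longrightarrow> e j \<le> e j0)"
    if "j < d" "c j \<noteq> 0" for c :: "nat \<Rightarrow> complex" and j
  proof -
    define J where "J = {j. j < d \<and> c j \<noteq> 0}"
    have J: "finite J" "J \<noteq> {}" using that by (auto simp: J_def)
    then obtain j0 where "j0 \<in> J" "e j0 = Max (e ` J)" using Max_in[of "e ` J"] by fastforce
    then show ?thesis using J by (intro exI[of _ j0]) (auto simp: J_def)
  qed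
  \<comment> \<open>If only constant columns occur, a relation at one point holds at every point, in
    particular at \<open>z1\<close>, where the frame is independent. This ensures
    \<open>0 < e j0\<close>, so that there is room to lower the degree.\<close>
  have const: False
    if "j0 < d" "c j0 \<noteq> 0" "\<And>j. j < d \<Longrightarrow> c j \<noteq> 0 \<Longrightarrow> e j = 0"
      and z: "\<And>l. l < p \<Longrightarrow> (\<Sum>j<d. poly (x l j) z * c j) = 0" for c j0 z
  proof -
    have "(\<Sum>j<d. poly (x l j) z1 * c j) = 0" if l: "l < p" for l
    proof -
      have "poly (x l j) z1 * c j = poly (x l j) z * c j" if "j < d" for j
      proof (cases "c j = 0")
        case False
        then have "degree (x l j) = 0" using deg[OF l \<open>j < d\<close>] \<open>\<And>j. j < d \<Longrightarrow> c j \<noteq> 0 \<Longrightarrow> e j = 0\<close> that by fastforce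
        then obtain q where "x l j = [:q:]" by (rule degree_eq_zeroE)
        then show ?thesis by simp
      qed simp
      then have "(\<Sum>j<d. poly (x l j) z1 * c j) = (\<Sum>j<d. poly (x l j) z * c j)"
        by (intro sum.cong) auto
      then show ?thesis using z[OF l] by simp
    qed
    from indep_colsD[OF ind1 this \<open>j0 < d\<close>] show False using \<open>c j0 \<noteq> 0\<close> by simp
  qed
  have A: "indep_cols p d (\<lambda>l j. poly (x l j) z)" for z
    unfolding indep_cols_def
  proof (intro allI impI, rule ccontr)
    fix c j assume c: "\<forall>l<p. (\<Sum>j<d. poly (x l j) z * c j) = 0" and j: "j < d" "c j \<noteq> 0"
    obtain j0 where j0: "j0 < d" "c j0 \<noteq> 0" "\<And>j. j < d \<Longrightarrow> c j \<noteq> 0 \<Longrightarrow> e j \<le> e j0"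
      using argmax[of j c] j by blast
    have e0: "0 < e j0"
    proof (rule ccontr)
      assume "\<not> 0 < e j0"
      then show False using const[of j0 c z] j0 c by fastforce
    qed
    \<comment> \<open>The dependent combination vanishes at \<open>z\<close>; dividing it by the
      linear factor at \<open>z\<close> gives a replacement column of lower degree.\<close>
    define w where "w l = (\<Sum>j<d. Polynomial.smult (c j) (x l j))" for l
    have "poly (w l) z = 0" if "l < p" for l
      using c that by (simp add: w_def poly_sum mult.commute)
    then have "\<forall>l. \<exists>y. l < p \<longrightarrow> w l = [:- z, 1:] * y"
      by (auto simp: poly_eq_0_iff_dvd dvd_def)
    then obtain y where y: "\<And>l. l < p \<Longrightarrow> w l = [:- z, 1:] * y l" by metis
    have degw: "degree (w l) \<le> e j0" if "l < p" for l
      unfolding w_def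
    proof (rule degree_sum_le)
      fix i assume "i \<in> {..<d}"
      then show "degree (Polynomial.smult (c i) (x l i)) \<le> e j0"
        using deg[OF that, of i] j0(3)[of i] by (cases "c i = 0") auto
    qed simp
    have degy: "degree (y l) < e j0" if "l < p" for l
    proof (cases "y l = 0")
      case False
      then have "degree (w l) = Suc (degree (y l))" using y[OF that]
        by (simp add: degree_mult_eq del: mult_pCons_left)
      then show ?thesis using degw[OF that] by simp
    qed (use e0 in simp)
    show False
    proof (rule no_exchange[of j0 "{z}" "\<lambda>s. s - z" "\<lambda>j s. c j" y])
      fix s l assume l: "l < p"
      have "poly (w l) s = (\<Sum>j<d. poly (x l j) s * c j)" by (simp add: w_def poly_sum mult.commute)
      then show "(s - z) * poly (y l) s = (\<Sum>j<d. poly (x l j) s * c j)"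
        using y[OF l] by (simp add: algebra_simps)
    qed (use j0 e0 degy in auto)
  qed
  have B: "indep_cols p d (\<lambda>l j. coeff (x l j) (e j))"
    unfolding indep_cols_def
  proof (intro allI impI, rule ccontr)
    fix c j assume c: "\<forall>l<p. (\<Sum>j<d. coeff (x l j) (e j) * c j) = 0" and j: "j < d" "c j \<noteq> 0"
    obtain j0 where j0: "j0 < d" "c j0 \<noteq> 0" "\<And>j. j < d \<Longrightarrow> c j \<noteq> 0 \<Longrightarrow> e j \<le> e j0"
      using argmax[of j c] j by blast
    have e0: "0 < e j0"
    proof (rule ccontr)
      assume "\<not> 0 < e j0"
      then have e: "\<And>j. j < d \<Longrightarrow> c j \<noteq> 0 \<Longrightarrow> e j = 0" using j0 by fastforce
      have "(\<Sum>j<d. poly (x l j) 0 * c j) = (\<Sum>j<d. coeff (x l j) (e j) * c j)" for l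
      proof (intro sum.cong refl)
        fix j assume "j \<in> {..<d}"
        then show "poly (x l j) 0 * c j = coeff (x l j) (e j) * c j"
          using e[of j] by (cases "c j = 0") (auto simp: poly_0_coeff_0)
      qed
      then show False using const[of j0 c 0] j0 c e by auto
    qed
    \<comment> \<open>The powers of \<open>z\<close> raise all columns to the common degree
      \<open>e j0\<close>; the relation between the leading coefficients then cancels the top
      term.\<close>
    define y where "y l = (\<Sum>j<d. x l j * monom (c j) (e j0 - e j))" for l
    have degy: "degree (y l) < e j0" if l: "l < p" for l
    proof -
      have t: "degree (x l i * monom (c i) (e j0 - e i)) \<le> e j0
          \<and> coeff (x l i * monom (c i) (e j0 - e i)) (e j0) = coeff (x l i) (e i) * c i" if i: "i < d" for i
      proof (cases "c i = 0")
        case False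
        then have ei: "e i \<le> e j0" using j0(3) i by blast
        have "degree (monom (c i) (e j0 - e i)) \<le> e j0 - e i" by (rule degree_monom_le)
        then show ?thesis
          using coeff_mult_at_degree_bounds[OF deg[OF l i], of "monom (c i) (e j0 - e i)" "e j0 - e i"]
            degree_mult_le[of "x l i" "monom (c i) (e j0 - e i)"] deg[OF l i] ei by auto
      qed simp
      have "degree (y l) \<le> e j0" unfolding y_def by (rule degree_sum_le) (use t in auto)
      moreover have "coeff (y l) (e j0) = 0" using c l t by (simp add: y_def coeff_sum)
      ultimately show ?thesis using e0
        by (metis degree_0 leading_coeff_0_iff le_neq_implies_less)
    qed
    show False
    proof (rule no_exchange[of j0 "{0}" "\<lambda>s. 1" "\<lambda>j s. s ^ (e j0 - e j) * c j" y])
      fix s l assume l: "l < p"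
      show "1 * poly (y l) s = (\<Sum>j<d. poly (x l j) s * (s ^ (e j0 - e j) * c j))"
        by (simp add: y_def poly_sum poly_monom mult_ac)
    qed (use j0 e0 degy in auto)
  qed
  show ?thesis using that[OF x deg A B] .
qed

text \<open>Cramer's rule gives rational coefficients with denominator the top minor. Take a common
  denominator \<open>q\<close> of least degree. At a root of \<open>q\<close> the numerators form a
  relation between the columns of \<open>x\<close>, so by independence at that point they all vanish
  there and a linear factor cancels. Hence \<open>q\<close> is constant.\<close>

lemma frame_coefficients_polynomial:
  assumes x: "poly_frame x" and ind: "\<And>z. indep_cols p d (\<lambda>l j. poly (x l j) z)"
    and "finite S'" and w: "\<And>z. z \<notin> S' \<Longrightarrow> F z (\<lambda>l. poly (w l) z)"
  shows "\<exists>k. \<forall>l<p. w l = (\<Sum>j<d. x l j * k j)"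
proof -
  obtain S where S: "finite S" "S0 \<subseteq> S" "\<And>z. z \<notin> S \<Longrightarrow> frame_at x z" using poly_frameE[OF x] by blast
  define \<delta> where "\<delta> = det (mat d d (\<lambda>(l, j). x l j))"
  obtain Y where Y: "\<And>i j. i < d \<Longrightarrow> j < d \<Longrightarrow> (\<Sum>k<d. Y i k * x k j) = (if i = j then \<delta> else 0)"
    unfolding \<delta>_def by (rule adjugate_entries[where X=x and d=d]) blast
  have \<delta>: "poly \<delta> z \<noteq> 0" if "z \<notin> S" for z
  proof -
    have "poly \<delta> z = det (mat d d (\<lambda>(l, j). poly (x l j) z))"
      unfolding \<delta>_def by (rule poly_det_cong) auto
    then show ?thesis using det_nonzero_of_indep_cols[OF frame_at_top[of z x]] S that by auto
  qed
  obtain z1 where "z1 \<notin> S" using ex_new_if_finite[OF infinite_UNIV_char_0 S(1)] by blast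
  then have \<delta>0: "\<delta> \<noteq> 0" using \<delta> by force
  define k0 where "k0 j = (\<Sum>m<d. Y j m * w m)" for j
  \<comment> \<open>\<open>k0\<close> uses only the first \<open>d\<close> rows of \<open>w\<close>;
    that the remaining rows agree as well follows pointwise, because \<open>w\<close> lies in the
    span of the frame.\<close>
  have k0: "\<delta> * w l = (\<Sum>j<d. x l j * k0 j)" if l: "l < p" for l
  proof (rule poly_eq_of_cofinite[of "S \<union> S'"])
    fix z assume "z \<notin> S \<union> S'"
    then have z: "z \<notin> S0" "frame_at x z" "F z (\<lambda>l. poly (w l) z)" using S w by auto
    obtain c where c: "\<And>l. l < p \<Longrightarrow> poly (w l) z = (\<Sum>j<d. poly (x l j) z * c j)"
      using frame_at_span[OF z] by blast
    have "poly (k0 j) z = poly \<delta> z * c j" if j: "j < d" for j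
    proof -
      have "poly (k0 j) z = (\<Sum>m<d. poly (Y j m) z * (\<Sum>i<d. poly (x m i) z * c i))"
        using c dp by (simp add: k0_def poly_sum)
      also have "\<dots> = (\<Sum>i<d. poly (\<Sum>m<d. Y j m * x m i) z * c i)"
        by (simp add: poly_sum sum_distrib_left sum_distrib_right mult.assoc) (rule sum.swap)
      also have "\<dots> = (\<Sum>i<d. if i = j then poly \<delta> z * c i else 0)"
        using Y j by (intro sum.cong) auto
      finally show ?thesis using j by simp
    qed
    then show "poly (\<delta> * w l) z = poly (\<Sum>j<d. x l j * k0 j) z"
      using c[OF l] by (simp add: poly_sum sum_distrib_left mult_ac)
  qed (use S \<open>finite S'\<close> in auto)
  define Q where "Q q \<longleftrightarrow> q \<noteq> 0 \<and> (\<exists>k. \<forall>l<p. q * w l = (\<Sum>j<d. x l j * k j))" for q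
  have "Q \<delta>" using \<delta>0 k0 by (auto simp: Q_def)
  then obtain q where q: "Q q" "\<And>q'. Q q' \<Longrightarrow> degree q \<le> degree q'" using ex_has_least_nat[of Q] by blast
  obtain k where "q \<noteq> 0" and k: "\<And>l. l < p \<Longrightarrow> q * w l = (\<Sum>j<d. x l j * k j)"
    using q(1) by (auto simp: Q_def)
  have "degree q = 0"
  proof (rule ccontr)
    assume "degree q \<noteq> 0"
    then obtain \<rho> where "poly q \<rho> = 0"
      using fundamental_theorem_of_algebra[of q] constant_degree[of q] by auto
    then obtain q' where q': "q = [:- \<rho>, 1:] * q'" by (auto simp: poly_eq_0_iff_dvd dvd_def)
    have "poly (k j) \<rho> = 0" if "j < d" for j
    proof (rule indep_colsD[OF ind[of \<rho>] _ that])
      fix l assume "l < p"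
      from arg_cong[OF k[OF this], of "\<lambda>f. poly f \<rho>"]
      show "(\<Sum>j<d. poly (x l j) \<rho> * poly (k j) \<rho>) = 0" using \<open>poly q \<rho> = 0\<close> by (simp add: poly_sum)
    qed
    then have "\<forall>j. \<exists>f. j < d \<longrightarrow> k j = [:- \<rho>, 1:] * f" by (auto simp: poly_eq_0_iff_dvd dvd_def)
    then obtain k' where k': "\<And>j. j < d \<Longrightarrow> k j = [:- \<rho>, 1:] * k' j" by metis
    have "q' * w l = (\<Sum>j<d. x l j * k' j)" if "l < p" for l
    proof -
      have "[:- \<rho>, 1:] * (q' * w l) = (\<Sum>j<d. x l j * ([:- \<rho>, 1:] * k' j))"
        using k[OF that] k' by (simp only: q' mult.assoc) (simp del: mult_pCons_left)
      also have "\<dots> = [:- \<rho>, 1:] * (\<Sum>j<d. x l j * k' j)"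
        by (simp only: sum_distrib_left mult.left_commute)
      finally show ?thesis by (subst (asm) mult_cancel_left) simp
    qed
    then have "Q q'" using \<open>q \<noteq> 0\<close> q' by (auto simp: Q_def)
    from q(2)[OF this] show False using \<open>q \<noteq> 0\<close> q' by (auto simp: degree_mult_eq simp del: mult_pCons_left)
  qed
  then obtain r where r: "q = [:r:]" by (rule degree_eq_zeroE)
  then have "r \<noteq> 0" using \<open>q \<noteq> 0\<close> by auto
  show ?thesis
  proof (intro exI[of _ "\<lambda>j. Polynomial.smult (1 / r) (k j)"] allI impI)
    fix l assume "l < p"
    have "w l = Polynomial.smult (1 / r) (q * w l)" using r \<open>r \<noteq> 0\<close> by simp
    also have "\<dots> = (\<Sum>j<d. x l j * Polynomial.smult (1 / r) (k j))"
      unfolding k[OF \<open>l < p\<close>] by (simp add: smult_sum2)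
    finally show "w l = (\<Sum>j<d. x l j * Polynomial.smult (1 / r) (k j))" .
  qed
qed

end

section \<open>Interpolation at the singular points\<close>

lemma monic_prod_linear_factors:
  fixes a :: "'i \<Rightarrow> complex"
  assumes "finite A"
  shows "degree (\<Prod>k\<in>A. [:- a k, 1:]) = card A \<and> coeff (\<Prod>k\<in>A. [:- a k, 1:]) (card A) = 1"
  using assms
proof (induction A rule: finite_induct)
  case (insert k A)
  define P where "P = (\<Prod>k\<in>A. [:- a k, 1:])"
  have IH: "degree P = card A" "coeff P (card A) = 1" using insert by (auto simp: P_def)
  then have "P \<noteq> 0" by auto
  then have "degree ([:- a k, 1:] * P) = Suc (card A)"
    using IH by (subst degree_mult_eq) auto
  moreover have "coeff ([:- a k, 1:] * P) (Suc (card A)) = 1"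
    using coeff_mult_at_degree_bounds[of "[:- a k, 1:]" 1 P "card A"] IH by simp
  ultimately show ?case using insert by (simp add: P_def del: mult_pCons_left)
qed simp

context
  fixes n :: nat and a :: "nat \<Rightarrow> complex"
begin

definition node_poly :: "complex poly" where
  "node_poly = (\<Prod>k<n. [:- a k, 1:])"

definition conode_poly :: "nat \<Rightarrow> complex poly" where
  "conode_poly i = (\<Prod>k\<in>{..<n} - {i}. [:- a k, 1:])"

lemma node_poly_degree: "degree node_poly = n" "coeff node_poly n = 1"
  unfolding node_poly_def using monic_prod_linear_factors[of "{..<n}" a] by auto

lemma conode_poly_degree:
  assumes "i < n"
  shows "degree (conode_poly i) = n - 1" "coeff (conode_poly i) (n - 1) = 1"
  unfolding conode_poly_def using monic_prod_linear_factors[of "{..<n} - {i}" a] assms by auto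

lemma poly_node_poly: "poly node_poly z = (\<Prod>k<n. z - a k)"
  by (simp add: node_poly_def poly_prod)

lemma poly_conode_poly: "poly (conode_poly i) z = (\<Prod>k\<in>{..<n} - {i}. z - a k)"
  by (simp add: conode_poly_def poly_prod)

lemma poly_node_poly_split: "i < n \<Longrightarrow> poly node_poly z = (z - a i) * poly (conode_poly i) z"
  unfolding poly_node_poly poly_conode_poly by (subst prod.remove[of _ i]) auto

lemma conode_poly_at_node:
  assumes "inj_on a {..<n}" "i < n" "j < n"
  shows "poly (conode_poly i) (a j) = 0 \<longleftrightarrow> i \<noteq> j"
  using assms unfolding poly_conode_poly by (auto simp: inj_on_def)

text \<open>The residue theorem for \<open>T / node_poly\<close>: the right side sums the finite
  residues, and the left side is minus the residue at infinity. Lagrange interpolation reduces it to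
  comparing leading coefficients.\<close>

lemma lagrange_top_coeff:
  assumes inj: "inj_on a {..<n}" and T: "degree T < n"
  shows "coeff T (n - 1) = (\<Sum>i<n. poly T (a i) / poly (conode_poly i) (a i))"
proof -
  define L where "L = (\<Sum>i<n. Polynomial.smult (poly T (a i) / poly (conode_poly i) (a i)) (conode_poly i))"
  have "degree L \<le> n - 1" unfolding L_def
    by (rule degree_sum_le) (auto intro!: order_trans[OF degree_smult_le] simp: conode_poly_degree)
  then have "degree L < n" using T by linarith
  have "T = L"
  proof (rule poly_eqI_degree[of "a ` {..<n}"])
    show "degree T < card (a ` {..<n})" "degree L < card (a ` {..<n})"
      using T \<open>degree L < n\<close> inj by (auto simp: card_image)
    fix s assume "s \<in> a ` {..<n}"
    then obtain j where j: "j < n" "s = a j" by auto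
    have "poly L s = (\<Sum>i<n. if i = j then poly T (a j) else 0)"
      unfolding L_def poly_sum poly_smult j(2)
      using conode_poly_at_node[OF inj _ j(1)] by (intro sum.cong refl) auto
    then show "poly T s = poly L s" using j by simp
  qed
  then have "coeff T (n - 1) = coeff L (n - 1)" by simp
  also have "\<dots> = (\<Sum>i<n. poly T (a i) / poly (conode_poly i) (a i))"
    unfolding L_def coeff_sum using conode_poly_degree by (intro sum.cong) auto
  finally show ?thesis .
qed

end

text \<open>The numerator of the covariant derivative, i.e. of \<open>(\<Sum>i. B i / (z - a i)) x - x'\<close>
  over the common denominator \<open>\<Prod>i. (z - a i)\<close>.\<close>
definition nabla_num ::
  "nat \<Rightarrow> nat \<Rightarrow> (nat \<Rightarrow> complex) \<Rightarrow> (nat \<Rightarrow> complex mat) \<Rightarrow> (nat \<Rightarrow> complex poly) \<Rightarrow> nat \<Rightarrow> complex poly" where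
  "nabla_num p n a B x l = (\<Sum>i<n. \<Sum>m<p. Polynomial.smult (B i $$ (l, m)) (conode_poly n a i * x m))
     - node_poly n a * pderiv (x l)"

text \<open>The derivative term carries the factor \<open>node_poly\<close> and drops out at a node,
  as do the summands of the other poles: only the residue \<open>B i\<close> acts.\<close>

lemma nabla_num_at_node:
  assumes "inj_on a {..<n}" "i < n"
  shows "poly (nabla_num p n a B x l) (a i)
    = (\<Sum>m<p. B i $$ (l, m) * poly (x m) (a i)) * poly (conode_poly n a i) (a i)"
proof -
  have "poly (nabla_num p n a B x l) (a i)
    = (\<Sum>k<n. (\<Sum>m<p. B k $$ (l, m) * poly (x m) (a i)) * poly (conode_poly n a k) (a i))"
    using assms poly_node_poly_split[of i n a "a i"]
    by (simp add: nabla_num_def poly_sum sum_distrib_left sum_distrib_right mult_ac)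
  also have "\<dots> = (\<Sum>k<n. if k = i then (\<Sum>m<p. B i $$ (l, m) * poly (x m) (a i)) * poly (conode_poly n a i) (a i) else 0)"
    using conode_poly_at_node[OF assms(1) _ assms(2)] by (intro sum.cong) auto
  finally show ?thesis using assms by simp
qed

text \<open>Since the \<open>B i\<close> sum to zero, the first part has no coefficient in degree
  \<open>n - 1 + e\<close>; only the derivative contributes there, with factor \<open>e\<close>.
  This is the source of the column degrees in the trace identity.\<close>

lemma nabla_num_top:
  assumes "0 < n" "l < p"
    and B_sum: "\<And>l m. l < p \<Longrightarrow> m < p \<Longrightarrow> (\<Sum>i<n. B i $$ (l, m)) = 0"
    and deg: "\<And>l. l < p \<Longrightarrow> degree (x l) \<le> e"
  shows "degree (nabla_num p n a B x l) \<le> n - 1 + e"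
    and "coeff (nabla_num p n a B x l) (n - 1 + e) = - of_nat e * coeff (x l) e"
proof -
  define U where "U = (\<Sum>i<n. \<Sum>m<p. Polynomial.smult (B i $$ (l, m)) (conode_poly n a i * x m))"
  define V where "V = node_poly n a * pderiv (x l)"
  have "degree (conode_poly n a i * x m) \<le> n - 1 + e" if "i < n" "m < p" for i m
    using degree_mult_le[of "conode_poly n a i" "x m"] conode_poly_degree[OF that(1)] deg[OF that(2)] by simp
  then have degU: "degree U \<le> n - 1 + e" unfolding U_def
    by (intro degree_sum_le) (auto intro: order_trans[OF degree_smult_le])
  have "coeff U (n - 1 + e) = (\<Sum>i<n. \<Sum>m<p. B i $$ (l, m) * coeff (x m) e)"
    unfolding U_def coeff_sum coeff_smult
  proof (intro sum.cong refl)
    fix i m assume "i \<in> {..<n}" "m \<in> {..<p}"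
    then show "B i $$ (l, m) * coeff (conode_poly n a i * x m) (n - 1 + e) = B i $$ (l, m) * coeff (x m) e"
      using coeff_mult_at_degree_bounds[of "conode_poly n a i" "n - 1" "x m" e] conode_poly_degree[of i n a] deg
      by auto
  qed
  also have "\<dots> = (\<Sum>m<p. (\<Sum>i<n. B i $$ (l, m)) * coeff (x m) e)"
    by (subst sum.swap) (simp add: sum_distrib_right)
  also have "\<dots> = 0" using B_sum assms by simp
  finally have cU: "coeff U (n - 1 + e) = 0" .
  have "degree V \<le> n - 1 + e \<and> coeff V (n - 1 + e) = of_nat e * coeff (x l) e"
  proof (cases e)
    case 0
    then have "pderiv (x l) = 0" using deg[OF \<open>l < p\<close>] by (simp add: pderiv_eq_0_iff)
    then show ?thesis using 0 by (simp add: V_def)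
  next
    case (Suc e')
    have d: "degree (pderiv (x l)) \<le> e'" using deg[OF \<open>l < p\<close>] Suc by (simp add: degree_pderiv)
    have eq: "n - 1 + e = n + e'" using Suc \<open>0 < n\<close> by simp
    have "degree V \<le> n + e'"
      unfolding V_def using degree_mult_le[of "node_poly n a" "pderiv (x l)"] d node_poly_degree[of n a] by simp
    moreover have "coeff V (n + e') = of_nat e * coeff (x l) e"
      unfolding V_def
      using coeff_mult_at_degree_bounds[of "node_poly n a" n "pderiv (x l)" e'] d node_poly_degree[of n a] Suc
      by (simp add: coeff_pderiv)
    ultimately show ?thesis unfolding eq by simp
  qed
  with degU cU show "degree (nabla_num p n a B x l) \<le> n - 1 + e"
    "coeff (nabla_num p n a B x l) (n - 1 + e) = - of_nat e * coeff (x l) e"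
    unfolding nabla_num_def U_def[symmetric] V_def[symmetric] by (auto intro: degree_diff_le)
qed

section \<open>Column degrees as a sum of traces\<close>

context subspace_family
begin

text \<open>The algebraic half of the argument. The differential system enters only through the
  existence of some polynomial frame and the closure of \<open>F\<close> under the covariant
  derivative.\<close>

theorem nabla_invariant_constant:
  fixes n :: nat and a :: "nat \<Rightarrow> complex" and B :: "nat \<Rightarrow> complex mat"
  assumes inj: "inj_on a {..<n}" and n: "0 < n" and d: "0 < d"
    and B: "\<And>i. i < n \<Longrightarrow> B i \<in> carrier_mat p p"
    and B_sum: "\<And>l m. l < p \<Longrightarrow> m < p \<Longrightarrow> (\<Sum>i<n. B i $$ (l, m)) = 0"
    and ev: "\<And>i \<beta>. i < n \<Longrightarrow> eigenvalue (B i) \<beta> \<Longrightarrow> - 1 / (real n * real d) < Re \<beta>"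
    and frame: "poly_frame x0"
    and nabla: "\<And>x S. finite S \<Longrightarrow> (\<And>z. z \<notin> S \<Longrightarrow> F z (\<lambda>l. poly (x l) z)) \<Longrightarrow>
      \<exists>S'. finite S' \<and> (\<forall>z. z \<notin> S' \<longrightarrow> F z (\<lambda>l. poly (nabla_num p n a B x l) z))"
  obtains S where "finite S"
    and "\<And>z i v. z \<notin> S \<Longrightarrow> i < n \<Longrightarrow> F z v \<Longrightarrow> F z (\<lambda>l. \<Sum>m<p. B i $$ (l, m) * v m)"
proof -
  obtain x e where x: "poly_frame x" and deg: "\<And>l j. l < p \<Longrightarrow> j < d \<Longrightarrow> degree (x l j) \<le> e j"
    and ind: "\<And>z. indep_cols p d (\<lambda>l j. poly (x l j) z)"
    and lead: "indep_cols p d (\<lambda>l j. coeff (x l j) (e j))"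
    using minimal_poly_frame[OF frame] by blast
  obtain S where S: "finite S" "S0 \<subseteq> S" "\<And>z. z \<notin> S \<Longrightarrow> frame_at x z" using poly_frameE[OF x] by blast
  define W where "W j = nabla_num p n a B (\<lambda>l. x l j)" for j
  have "\<exists>k. \<forall>l<p. W j l = (\<Sum>i<d. x l i * k i)" if j: "j < d" for j
  proof -
    have "F z (\<lambda>l. poly (x l j) z)" if "z \<notin> S" for z using S(3)[OF that] j by (simp add: frame_at_def)
    from nabla[OF S(1), OF this] obtain S' where S': "finite S'"
      "\<And>z. z \<notin> S' \<Longrightarrow> F z (\<lambda>l. poly (W j l) z)" unfolding W_def by blast
    show ?thesis by (rule frame_coefficients_polynomial[OF x ind S'])
  qed
  then have "\<forall>j. \<exists>k. j < d \<longrightarrow> (\<forall>l<p. W j l = (\<Sum>i<d. x l i * k i))" by blast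
  \<comment> \<open>\<open>K j i / node_poly\<close> is the entry in row \<open>i\<close> and column
    \<open>j\<close> of the connection matrix of the frame. By predictable degrees,
    \<open>K j i\<close> has degree at most \<open>n - 1 + e j - e i\<close>; on the diagonal this
    is \<open>n - 1\<close>.\<close>
  then obtain K where K: "\<And>j l. j < d \<Longrightarrow> l < p \<Longrightarrow> W j l = (\<Sum>i<d. x l i * K j i)" by metis
  have W_top: "degree (W j l) \<le> n - 1 + e j"
    "coeff (W j l) (n - 1 + e j) = - of_nat (e j) * coeff (x l j) (e j)" if "j < d" "l < p" for j l
    unfolding W_def by (intro nabla_num_top n that B_sum deg; assumption)+
  have K_high: "coeff (K j i) m = 0" if "j < d" "i < d" "n - 1 + e j < m + e i" for j i m
  proof (rule coeff_zero_of_combination_degree[OF deg lead _ that(2,3)])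
    fix l assume "l < p"
    then show "degree (\<Sum>i<d. x l i * K j i) \<le> n - 1 + e j"
      using K[OF \<open>j < d\<close>] W_top(1)[OF \<open>j < d\<close>] by simp
  qed
  have K_top: "coeff (K j j) (n - 1) = - of_nat (e j)" if j: "j < d" for j
  proof -
    \<comment> \<open>Comparing coefficients of degree \<open>n - 1 + e j\<close> in column
      \<open>j\<close>, the leading-coefficient matrix annihilates this vector: the top coefficients
      of \<open>K j\<close> plus \<open>e j\<close> times a unit vector.\<close>
    define c where "c i = (if e i \<le> n - 1 + e j then coeff (K j i) (n - 1 + e j - e i) else 0)
      + (if i = j then of_nat (e j) else 0)" for i
    have "(\<Sum>i<d. coeff (x l i) (e i) * c i) = 0" if l: "l < p" for l
    proof -
      have "(\<Sum>i<d. coeff (x l i) (e i) * (if e i \<le> n - 1 + e j then coeff (K j i) (n - 1 + e j - e i) else 0))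
         = coeff (W j l) (n - 1 + e j)"
        unfolding K[OF j l] using deg[OF l] K_high[OF j] by (intro coeff_combination_top[symmetric]) auto
      also have "\<dots> = - of_nat (e j) * coeff (x l j) (e j)"
        by (rule W_top(2)[OF j l])
      finally have 1: "(\<Sum>i<d. coeff (x l i) (e i) * (if e i \<le> n - 1 + e j then coeff (K j i) (n - 1 + e j - e i) else 0))
         = - of_nat (e j) * coeff (x l j) (e j)" .
      have 2: "(\<Sum>i<d. coeff (x l i) (e i) * (if i = j then of_nat (e j) else 0)) = of_nat (e j) * coeff (x l j) (e j)"
        using j by (simp add: if_distrib cong: if_cong)
      show ?thesis unfolding c_def distrib_left sum.distrib 1 2 by simp
    qed
    then have "c j = 0" by (rule indep_colsD[OF lead _ j])
    then show ?thesis by (simp add: c_def add_eq_0_iff)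
  qed
  define T where "T = (\<Sum>j<d. K j j)"
  have "degree T \<le> n - 1" unfolding T_def
    using K_high by (intro degree_sum_le degree_le) auto
  then have "degree T < n" using n by simp
  have "coeff T (n - 1) = - of_nat (\<Sum>j<d. e j)"
    unfolding T_def coeff_sum using K_top by (simp add: sum_negf)
  then have trace_sum: "- of_nat (\<Sum>j<d. e j) = (\<Sum>i<n. poly T (a i) / poly (conode_poly n a i) (a i))"
    using lagrange_top_coeff[OF inj \<open>degree T < n\<close>] by simp
  \<comment> \<open>The value of \<open>conode_poly\<close> at \<open>a i\<close> is the derivative
    of \<open>node_poly\<close> there, so this is the residue at \<open>a i\<close> of the
    connection matrix.\<close>
  define R where "R i k j = poly (K j k) (a i) / poly (conode_poly n a i) (a i)" for i k j
  have BX: "(\<Sum>m<p. B i $$ (l, m) * poly (x m j) (a i)) = (\<Sum>k<d. poly (x l k) (a i) * R i k j)"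
    if i: "i < n" and l: "l < p" and j: "j < d" for i l j
  proof -
    have nz: "poly (conode_poly n a i) (a i) \<noteq> 0" using conode_poly_at_node[OF inj i i] by simp
    have "(\<Sum>m<p. B i $$ (l, m) * poly (x m j) (a i)) * poly (conode_poly n a i) (a i) = poly (W j l) (a i)"
      unfolding W_def using nabla_num_at_node[OF inj i] by simp
    also have "\<dots> = (\<Sum>k<d. poly (x l k) (a i) * R i k j) * poly (conode_poly n a i) (a i)"
      unfolding K[OF j l] R_def using nz by (simp add: poly_sum sum_distrib_right)
    finally show ?thesis using nz by simp
  qed
  have tr: "- 1 / real n < Re (\<Sum>j<d. R i j j)" if i: "i < n" for i
  proof -
    have "real d * (- 1 / (real n * real d)) < Re (\<Sum>j<d. R i j j)"
      by (rule Re_trace_restriction_gt[OF B[OF i] ind[of "a i"] d BX[OF i] ev[OF i]])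
    then show ?thesis using d by (simp add: field_simps)
  qed
  have "- real (\<Sum>j<d. e j) = Re (- of_nat (\<Sum>j<d. e j))" by simp
  also have "\<dots> = (\<Sum>i<n. Re (\<Sum>j<d. R i j j))"
    unfolding trace_sum by (simp add: T_def R_def poly_sum sum_divide_distrib)
  also have "\<dots> > (\<Sum>i<n. - 1 / real n)" using tr n by (intro sum_strict_mono) auto
  finally have "real (\<Sum>j<d. e j) < 1" using n by (simp add: field_simps)
  then have "(\<Sum>j<d. e j) = 0" by linarith
  then have e0: "e j = 0" if "j < d" for j using that by simp
  \<comment> \<open>With constant columns, invariance of their span under \<open>B i\<close>,
    established at the single point \<open>a i\<close>, transfers to every other point.\<close>
  have const: "poly (x l j) z = poly (x l j) w" if "l < p" "j < d" for l j z w
  proof -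
    have "degree (x l j) = 0" using deg[OF that] e0[OF that(2)] by simp
    then obtain q where "x l j = [:q:]" by (rule degree_eq_zeroE)
    then show ?thesis by simp
  qed
  show ?thesis
  proof (rule that[OF S(1)])
    fix z i v assume z: "z \<notin> S" and i: "i < n" and v: "F z v"
    have z0: "z \<notin> S0" and fz: "frame_at x z" using S z by auto
    obtain c where c: "\<And>l. l < p \<Longrightarrow> v l = (\<Sum>j<d. poly (x l j) z * c j)"
      using frame_at_span[OF z0 fz v] by blast
    have "F z (\<lambda>l. \<Sum>k<d. poly (x l k) z * (\<Sum>j<d. R i k j * c j))"
      using fz by (intro F_sum[OF z0]) (auto simp: frame_at_def)
    then show "F z (\<lambda>l. \<Sum>m<p. B i $$ (l, m) * v m)"
    proof (rule F_cong[OF z0])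
      fix l assume l: "l < p"
      have "(\<Sum>k<d. poly (x l k) z * (\<Sum>j<d. R i k j * c j))
         = (\<Sum>j<d. (\<Sum>k<d. poly (x l k) (a i) * R i k j) * c j)"
        using const[OF l, of _ z "a i"]
        by (simp add: sum_distrib_left sum_distrib_right mult.assoc) (rule sum.swap)
      also have "\<dots> = (\<Sum>j<d. (\<Sum>m<p. B i $$ (l, m) * poly (x m j) (a i)) * c j)"
        using BX[OF i l] by simp
      also have "\<dots> = (\<Sum>m<p. B i $$ (l, m) * (\<Sum>j<d. poly (x m j) (a i) * c j))"
        by (simp add: sum_distrib_left sum_distrib_right mult.assoc) (rule sum.swap)
      also have "\<dots> = (\<Sum>m<p. B i $$ (l, m) * v m)"
        using c const[of _ _ z "a i"] by (intro sum.cong) auto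
      finally show "(\<Sum>k<d. poly (x l k) z * (\<Sum>j<d. R i k j * c j)) = (\<Sum>m<p. B i $$ (l, m) * v m)" .
    qed
  qed
qed

end

section \<open>Analytic continuation along paths\<close>

lemma has_vector_derivative_join_left:
  fixes f g :: "real \<Rightarrow> 'a :: real_normed_vector"
  assumes "(f has_vector_derivative f') (at (2 * t))" "t < 1/2"
  shows "((\<lambda>s. if s \<le> 1/2 then f (2 * s) else g (2 * s - 1)) has_vector_derivative 2 *\<^sub>R f') (at t)"
proof (rule has_vector_derivative_transform_within_open[of "\<lambda>s. f (2 * s)" _ _ "{..<1/2}"])
  have "((*) 2 has_vector_derivative 2) (at t)"
    by (simp add: has_vector_derivative_def has_derivative_def bounded_linear_mult_left)
  from vector_diff_chain_at[OF this assms(1)]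
  show "((\<lambda>s. f (2 * s)) has_vector_derivative 2 *\<^sub>R f') (at t)" by (simp add: o_def)
qed (use assms in auto)

lemma has_vector_derivative_join_right:
  fixes f g :: "real \<Rightarrow> 'a :: real_normed_vector"
  assumes "(g has_vector_derivative g') (at (2 * t - 1))" "1/2 < t"
  shows "((\<lambda>s. if s \<le> 1/2 then f (2 * s) else g (2 * s - 1)) has_vector_derivative 2 *\<^sub>R g') (at t)"
proof (rule has_vector_derivative_transform_within_open[of "\<lambda>s. g (2 * s - 1)" _ _ "{1/2<..}"])
  have "((\<lambda>s. 2 * s - 1) has_vector_derivative 2) (at t)"
    by (auto intro!: derivative_eq_intros simp: has_real_derivative_iff_has_vector_derivative[symmetric])
  from vector_diff_chain_at[OF this assms(1)]
  show "((\<lambda>s. g (2 * s - 1)) has_vector_derivative 2 *\<^sub>R g') (at t)" by (simp add: o_def)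
qed (use assms in auto)

lemma continuation_along_mult_right:
  assumes \<Phi>: "continuation_along p A \<gamma> Y \<Phi>" and C: "C \<in> carrier_mat p p"
  shows "continuation_along p A \<gamma> (Y * C) (\<lambda>t. \<Phi> t * C)"
proof -
  obtain S where S: "finite S" "\<And>t j k. t \<in> {0..1} - S \<Longrightarrow> j < p \<Longrightarrow> k < p \<Longrightarrow>
      ((\<lambda>t. \<Phi> t $$ (j, k)) has_vector_derivative
       (\<Sum>l<p. A (\<gamma> t) $$ (j, l) * vector_derivative \<gamma> (at t) * \<Phi> t $$ (l, k))) (at t within {0..1})"
    using \<Phi> unfolding continuation_along_def by blast
  have car: "\<Phi> t \<in> carrier_mat p p" if "t \<in> {0..1}" for t
    using \<Phi> that unfolding continuation_along_def by blast
  have cont: "continuous_on {0..1} (\<lambda>t. \<Phi> t $$ (j, k))" if "j < p" "k < p" for j k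
    using \<Phi> that unfolding continuation_along_def by blast
  have entry: "(\<Phi> t * C) $$ (j, k) = (\<Sum>m<p. \<Phi> t $$ (j, m) * C $$ (m, k))"
    if "t \<in> {0..1}" "j < p" "k < p" for t j k
    using index_mult_sum[OF car C] that by blast
  show ?thesis
    unfolding continuation_along_def
  proof (intro conjI ballI allI impI)
    show "\<Phi> 0 * C = Y * C" using \<Phi> by (simp add: continuation_along_def)
    show "\<Phi> t * C \<in> carrier_mat p p" if "t \<in> {0..1}" for t using car[OF that] C by simp
    fix j k assume jk: "j < p" "k < p"
    have "continuous_on {0..1} (\<lambda>t. \<Sum>m<p. \<Phi> t $$ (j, m) * C $$ (m, k))"
      using cont jk by (intro continuous_intros) auto
    then show "continuous_on {0..1} (\<lambda>t. (\<Phi> t * C) $$ (j, k))"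
      by (rule continuous_on_eq) (use entry jk in auto)
  next
    have "((\<lambda>t. (\<Phi> t * C) $$ (j, k)) has_vector_derivative
       (\<Sum>l<p. A (\<gamma> t) $$ (j, l) * vector_derivative \<gamma> (at t) * (\<Phi> t * C) $$ (l, k))) (at t within {0..1})"
      if t: "t \<in> {0..1} - S" and jk: "j < p" "k < p" for t j k
    proof (rule has_vector_derivative_transform[where f = "\<lambda>t. \<Sum>m<p. \<Phi> t $$ (j, m) * C $$ (m, k)"])
      show "t \<in> {0..1}" using t by simp
      show "(\<Phi> s * C) $$ (j, k) = (\<Sum>m<p. \<Phi> s $$ (j, m) * C $$ (m, k))" if "s \<in> {0..1}" for s
        using entry that jk by blast
      have "((\<lambda>t. \<Sum>m<p. \<Phi> t $$ (j, m) * C $$ (m, k)) has_vector_derivative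
        (\<Sum>m<p. (\<Sum>l<p. A (\<gamma> t) $$ (j, l) * vector_derivative \<gamma> (at t) * \<Phi> t $$ (l, m)) * C $$ (m, k)))
        (at t within {0..1})"
        using S(2)[OF t jk(1)] by (intro has_vector_derivative_sum has_vector_derivative_mult_left) auto
      also have "(\<Sum>m<p. (\<Sum>l<p. A (\<gamma> t) $$ (j, l) * vector_derivative \<gamma> (at t) * \<Phi> t $$ (l, m)) * C $$ (m, k))
        = (\<Sum>l<p. A (\<gamma> t) $$ (j, l) * vector_derivative \<gamma> (at t) * (\<Sum>m<p. \<Phi> t $$ (l, m) * C $$ (m, k)))"
        by (simp add: sum_distrib_left sum_distrib_right mult.assoc) (rule sum.swap)
      also have "\<dots> = (\<Sum>l<p. A (\<gamma> t) $$ (j, l) * vector_derivative \<gamma> (at t) * (\<Phi> t * C) $$ (l, k))"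
        using entry t jk by (intro sum.cong) auto
      finally show "((\<lambda>t. \<Sum>m<p. \<Phi> t $$ (j, m) * C $$ (m, k)) has_vector_derivative
        (\<Sum>l<p. A (\<gamma> t) $$ (j, l) * vector_derivative \<gamma> (at t) * (\<Phi> t * C) $$ (l, k))) (at t within {0..1})" .
    qed
    then show "\<exists>S. finite S \<and> (\<forall>t\<in>{0..1} - S. \<forall>j<p. \<forall>k<p.
       ((\<lambda>t. (\<Phi> t * C) $$ (j, k)) has_vector_derivative
       (\<Sum>l<p. A (\<gamma> t) $$ (j, l) * vector_derivative \<gamma> (at t) * (\<Phi> t * C) $$ (l, k))) (at t within {0..1}))"
      using S(1) by blast
  qed
qed

text \<open>Invariance under a constant gauge transformation, expressed by the intertwining relation
  \<open>A z * C = C * A' z\<close>.\<close>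

lemma continuation_along_mult_left:
  assumes \<Phi>: "continuation_along p A' \<gamma> Y \<Phi>" and C: "C \<in> carrier_mat p p"
    and A: "\<And>z. A z \<in> carrier_mat p p" "\<And>z. A' z \<in> carrier_mat p p" and AC: "\<And>z. A z * C = C * A' z"
  shows "continuation_along p A \<gamma> (C * Y) (\<lambda>t. C * \<Phi> t)"
proof -
  obtain S where S: "finite S" "\<And>t j k. t \<in> {0..1} - S \<Longrightarrow> j < p \<Longrightarrow> k < p \<Longrightarrow>
      ((\<lambda>t. \<Phi> t $$ (j, k)) has_vector_derivative
       (\<Sum>l<p. A' (\<gamma> t) $$ (j, l) * vector_derivative \<gamma> (at t) * \<Phi> t $$ (l, k))) (at t within {0..1})"
    using \<Phi> unfolding continuation_along_def by blast
  have car: "\<Phi> t \<in> carrier_mat p p" if "t \<in> {0..1}" for t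
    using \<Phi> that unfolding continuation_along_def by blast
  have cont: "continuous_on {0..1} (\<lambda>t. \<Phi> t $$ (j, k))" if "j < p" "k < p" for j k
    using \<Phi> that unfolding continuation_along_def by blast
  have entry: "(C * \<Phi> t) $$ (j, k) = (\<Sum>m<p. C $$ (j, m) * \<Phi> t $$ (m, k))"
    if "t \<in> {0..1}" "j < p" "k < p" for t j k
    using index_mult_sum[OF C car] that by blast
  have AC_entry: "(\<Sum>m<p. C $$ (j, m) * A' z $$ (m, l)) = (\<Sum>m<p. A z $$ (j, m) * C $$ (m, l))"
    if "j < p" "l < p" for z j l
    using index_mult_sum[OF C A(2) that] index_mult_sum[OF A(1) C that] AC by simp
  show ?thesis
    unfolding continuation_along_def
  proof (intro conjI ballI allI impI)
    show "C * \<Phi> 0 = C * Y" using \<Phi> by (simp add: continuation_along_def)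
    show "C * \<Phi> t \<in> carrier_mat p p" if "t \<in> {0..1}" for t using car[OF that] C by simp
    fix j k assume jk: "j < p" "k < p"
    have "continuous_on {0..1} (\<lambda>t. \<Sum>m<p. C $$ (j, m) * \<Phi> t $$ (m, k))"
      using cont jk by (intro continuous_intros) auto
    then show "continuous_on {0..1} (\<lambda>t. (C * \<Phi> t) $$ (j, k))"
      by (rule continuous_on_eq) (use entry jk in auto)
  next
    have "((\<lambda>t. (C * \<Phi> t) $$ (j, k)) has_vector_derivative
       (\<Sum>l<p. A (\<gamma> t) $$ (j, l) * vector_derivative \<gamma> (at t) * (C * \<Phi> t) $$ (l, k))) (at t within {0..1})"
      if t: "t \<in> {0..1} - S" and jk: "j < p" "k < p" for t j k
    proof (rule has_vector_derivative_transform[where f = "\<lambda>t. \<Sum>m<p. C $$ (j, m) * \<Phi> t $$ (m, k)"])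
      define v where "v = vector_derivative \<gamma> (at t)"
      show "t \<in> {0..1}" using t by simp
      show "(C * \<Phi> s) $$ (j, k) = (\<Sum>m<p. C $$ (j, m) * \<Phi> s $$ (m, k))" if "s \<in> {0..1}" for s
        using entry that jk by blast
      have "((\<lambda>t. \<Sum>m<p. C $$ (j, m) * \<Phi> t $$ (m, k)) has_vector_derivative
        (\<Sum>m<p. C $$ (j, m) * (\<Sum>l<p. A' (\<gamma> t) $$ (m, l) * v * \<Phi> t $$ (l, k))))
        (at t within {0..1})"
        using S(2)[OF t _ jk(2), folded v_def]
        by (intro has_vector_derivative_sum has_vector_derivative_mult_right) auto
      also have "(\<Sum>m<p. C $$ (j, m) * (\<Sum>l<p. A' (\<gamma> t) $$ (m, l) * v * \<Phi> t $$ (l, k)))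
        = (\<Sum>m<p. \<Sum>l<p. (C $$ (j, m) * A' (\<gamma> t) $$ (m, l)) * (v * \<Phi> t $$ (l, k)))"
        by (simp add: sum_distrib_left mult.assoc)
      also have "\<dots> = (\<Sum>l<p. (\<Sum>m<p. C $$ (j, m) * A' (\<gamma> t) $$ (m, l)) * (v * \<Phi> t $$ (l, k)))"
        by (subst sum.swap) (simp add: sum_distrib_right)
      also have "\<dots> = (\<Sum>l<p. (\<Sum>m<p. A (\<gamma> t) $$ (j, m) * C $$ (m, l)) * (v * \<Phi> t $$ (l, k)))"
        using AC_entry jk by simp
      also have "\<dots> = (\<Sum>l<p. \<Sum>m<p. A (\<gamma> t) $$ (j, m) * v * (C $$ (m, l) * \<Phi> t $$ (l, k)))"
        by (simp add: sum_distrib_left sum_distrib_right mult_ac)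
      also have "\<dots> = (\<Sum>m<p. A (\<gamma> t) $$ (j, m) * v * (\<Sum>l<p. C $$ (m, l) * \<Phi> t $$ (l, k)))"
        by (subst sum.swap) (simp add: sum_distrib_left)
      also have "\<dots> = (\<Sum>l<p. A (\<gamma> t) $$ (j, l) * v * (C * \<Phi> t) $$ (l, k))"
        using entry t jk by (intro sum.cong) auto
      finally show "((\<lambda>t. \<Sum>m<p. C $$ (j, m) * \<Phi> t $$ (m, k)) has_vector_derivative
        (\<Sum>l<p. A (\<gamma> t) $$ (j, l) * vector_derivative \<gamma> (at t) * (C * \<Phi> t) $$ (l, k))) (at t within {0..1})"
        unfolding v_def .
    qed
    then show "\<exists>S. finite S \<and> (\<forall>t\<in>{0..1} - S. \<forall>j<p. \<forall>k<p.
       ((\<lambda>t. (C * \<Phi> t) $$ (j, k)) has_vector_derivative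
       (\<Sum>l<p. A (\<gamma> t) $$ (j, l) * vector_derivative \<gamma> (at t) * (C * \<Phi> t) $$ (l, k))) (at t within {0..1}))"
      using S(1) by blast
  qed
qed

lemma continuation_along_join:
  assumes \<Phi>1: "continuation_along p A \<gamma>1 Y \<Phi>1" and \<Phi>2: "continuation_along p A \<gamma>2 (\<Phi>1 1) \<Phi>2"
    and \<gamma>: "valid_path \<gamma>1" "valid_path \<gamma>2"
  shows "continuation_along p A (\<gamma>1 +++ \<gamma>2) Y (\<lambda>t. if t \<le> 1/2 then \<Phi>1 (2 * t) else \<Phi>2 (2 * t - 1))"
proof -
  obtain S1 where S1: "finite S1" "\<And>t j k. t \<in> {0..1} - S1 \<Longrightarrow> j < p \<Longrightarrow> k < p \<Longrightarrow>
      ((\<lambda>t. \<Phi>1 t $$ (j, k)) has_vector_derivative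
       (\<Sum>l<p. A (\<gamma>1 t) $$ (j, l) * vector_derivative \<gamma>1 (at t) * \<Phi>1 t $$ (l, k))) (at t within {0..1})"
    using \<Phi>1 unfolding continuation_along_def by blast
  obtain S2 where S2: "finite S2" "\<And>t j k. t \<in> {0..1} - S2 \<Longrightarrow> j < p \<Longrightarrow> k < p \<Longrightarrow>
      ((\<lambda>t. \<Phi>2 t $$ (j, k)) has_vector_derivative
       (\<Sum>l<p. A (\<gamma>2 t) $$ (j, l) * vector_derivative \<gamma>2 (at t) * \<Phi>2 t $$ (l, k))) (at t within {0..1})"
    using \<Phi>2 unfolding continuation_along_def by blast
  obtain D1 D2 where D: "finite D1" "\<forall>t\<in>{0..1} - D1. \<gamma>1 differentiable at t"
      "finite D2" "\<forall>t\<in>{0..1} - D2. \<gamma>2 differentiable at t"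
    using \<gamma> by (auto simp: valid_path_def piecewise_C1_differentiable_on_def C1_differentiable_on_eq)
  define \<Phi> where "\<Phi> t = (if t \<le> 1/2 then \<Phi>1 (2 * t) else \<Phi>2 (2 * t - 1))" for t
  \<comment> \<open>Besides the exceptional times of both solutions, the times where a path is not
    differentiable are removed, since \<open>vector_derivative\<close> carries no information there.
    Removing 0, 1/2 and 1 turns one-sided derivatives into two-sided ones.\<close>
  define S where "S = {0, 1/2, 1} \<union> (\<lambda>t. t / 2) ` (S1 \<union> D1) \<union> (\<lambda>t. (t + 1) / 2) ` (S2 \<union> D2)"
  have finS: "finite S" using S1(1) S2(1) D by (simp add: S_def)
  have \<Phi>_entry: "\<Phi> t $$ (j, k) = (if t \<le> 1/2 then \<Phi>1 (2 * t) $$ (j, k) else \<Phi>2 (2 * t - 1) $$ (j, k))" for t j k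
    by (simp add: \<Phi>_def)
  have der: "((\<lambda>t. \<Phi> t $$ (j, k)) has_vector_derivative
       (\<Sum>l<p. A ((\<gamma>1 +++ \<gamma>2) t) $$ (j, l) * vector_derivative (\<gamma>1 +++ \<gamma>2) (at t) * \<Phi> t $$ (l, k))) (at t within {0..1})"
    if t: "t \<in> {0..1} - S" and jk: "j < p" "k < p" for t j k
  proof -
    have t01: "0 < t" "t < 1" "t \<noteq> 1/2" using t by (auto simp: S_def less_le)
    consider "t < 1/2" | "1/2 < t" using t01(3) by linarith
    then show ?thesis
    proof cases
      case 1
      have "2 * t \<notin> S1 \<union> D1"
      proof
        assume "2 * t \<in> S1 \<union> D1"
        then have "(2 * t) / 2 \<in> S" unfolding S_def by blast
        then show False using t by simp
      qed
      then have s: "2 * t \<in> {0..1} - S1" "2 * t \<in> {0..1} - D1" using t01 1 by auto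
      have w: "at (2 * t) within {0..1} = at (2 * t)" using t01 1 by (intro at_within_interior) auto
      have "(\<gamma>1 has_vector_derivative vector_derivative \<gamma>1 (at (2 * t))) (at (2 * t))"
        using D(2) s(2) vector_derivative_works by blast
      from has_vector_derivative_join_left[OF this 1]
      have der\<gamma>: "((\<gamma>1 +++ \<gamma>2) has_vector_derivative 2 *\<^sub>R vector_derivative \<gamma>1 (at (2 * t))) (at t)"
        unfolding joinpaths_def .
      have at_t: "(\<gamma>1 +++ \<gamma>2) t = \<gamma>1 (2 * t)" "\<Phi> t = \<Phi>1 (2 * t)"
        using 1 by (auto simp: joinpaths_def \<Phi>_def)
      from der\<gamma> have vd: "vector_derivative (\<gamma>1 +++ \<gamma>2) (at t) = 2 * vector_derivative \<gamma>1 (at (2 * t))"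
        by (simp add: vector_derivative_at scaleR_conv_of_real)
      have "((\<lambda>t. \<Phi> t $$ (j, k)) has_vector_derivative
         2 *\<^sub>R (\<Sum>l<p. A (\<gamma>1 (2 * t)) $$ (j, l) * vector_derivative \<gamma>1 (at (2 * t)) * \<Phi>1 (2 * t) $$ (l, k))) (at t)"
        unfolding \<Phi>_entry by (rule has_vector_derivative_join_left[OF S1(2)[OF s(1) jk, unfolded w] 1])
      then have "((\<lambda>t. \<Phi> t $$ (j, k)) has_vector_derivative
       (\<Sum>l<p. A ((\<gamma>1 +++ \<gamma>2) t) $$ (j, l) * vector_derivative (\<gamma>1 +++ \<gamma>2) (at t) * \<Phi> t $$ (l, k))) (at t)"
        by (simp add: vd at_t scaleR_conv_of_real sum_distrib_left mult_ac)
      then show ?thesis by (rule has_vector_derivative_at_within)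
    next
      case 2
      have "2 * t - 1 \<notin> S2 \<union> D2"
      proof
        assume "2 * t - 1 \<in> S2 \<union> D2"
        then have "((2 * t - 1) + 1) / 2 \<in> S" unfolding S_def by blast
        then show False using t by simp
      qed
      then have s: "2 * t - 1 \<in> {0..1} - S2" "2 * t - 1 \<in> {0..1} - D2" using t01 2 by auto
      have w: "at (2 * t - 1) within {0..1} = at (2 * t - 1)" using t01 2 by (intro at_within_interior) auto
      have "(\<gamma>2 has_vector_derivative vector_derivative \<gamma>2 (at (2 * t - 1))) (at (2 * t - 1))"
        using D(4) s(2) vector_derivative_works by blast
      from has_vector_derivative_join_right[OF this 2]
      have der\<gamma>: "((\<gamma>1 +++ \<gamma>2) has_vector_derivative 2 *\<^sub>R vector_derivative \<gamma>2 (at (2 * t - 1))) (at t)"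
        unfolding joinpaths_def .
      have at_t: "(\<gamma>1 +++ \<gamma>2) t = \<gamma>2 (2 * t - 1)" "\<Phi> t = \<Phi>2 (2 * t - 1)"
        using 2 by (auto simp: joinpaths_def \<Phi>_def)
      from der\<gamma> have vd: "vector_derivative (\<gamma>1 +++ \<gamma>2) (at t) = 2 * vector_derivative \<gamma>2 (at (2 * t - 1))"
        by (simp add: vector_derivative_at scaleR_conv_of_real)
      have "((\<lambda>t. \<Phi> t $$ (j, k)) has_vector_derivative
         2 *\<^sub>R (\<Sum>l<p. A (\<gamma>2 (2 * t - 1)) $$ (j, l) * vector_derivative \<gamma>2 (at (2 * t - 1)) * \<Phi>2 (2 * t - 1) $$ (l, k))) (at t)"
        unfolding \<Phi>_entry by (rule has_vector_derivative_join_right[OF S2(2)[OF s(1) jk, unfolded w] 2])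
      then have "((\<lambda>t. \<Phi> t $$ (j, k)) has_vector_derivative
       (\<Sum>l<p. A ((\<gamma>1 +++ \<gamma>2) t) $$ (j, l) * vector_derivative (\<gamma>1 +++ \<gamma>2) (at t) * \<Phi> t $$ (l, k))) (at t)"
        by (simp add: vd at_t scaleR_conv_of_real sum_distrib_left mult_ac)
      then show ?thesis by (rule has_vector_derivative_at_within)
    qed
  qed
  have cont: "continuous_on {0..1} (\<lambda>t. \<Phi> t $$ (j, k))" if jk: "j < p" "k < p" for j k
  proof -
    have "path ((\<lambda>t. \<Phi>1 t $$ (j, k)) +++ (\<lambda>t. \<Phi>2 t $$ (j, k)))"
      using \<Phi>1 \<Phi>2 jk
      by (intro path_join_imp) (auto simp: path_def continuation_along_def pathstart_def pathfinish_def)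
    then show ?thesis by (simp add: path_def joinpaths_def \<Phi>_entry)
  qed
  have "continuation_along p A (\<gamma>1 +++ \<gamma>2) Y \<Phi>"
    unfolding continuation_along_def
  proof (intro conjI)
    show "\<Phi> 0 = Y" using \<Phi>1 by (simp add: \<Phi>_def continuation_along_def)
    show "\<forall>t\<in>{0..1}. \<Phi> t \<in> carrier_mat p p"
      using \<Phi>1 \<Phi>2 by (auto simp: \<Phi>_def continuation_along_def)
  qed (use cont der finS in blast)+
  then show ?thesis by (simp add: \<Phi>_def[abs_def])
qed

text \<open>Parallel transport as a relation between end points, quantified over all admissible
  paths, so that joining paths becomes multiplication of matrices. For \<open>z = w\<close> it
  contains the monodromy along every loop.\<close>

definition transports ::
  "nat \<Rightarrow> (complex \<Rightarrow> complex mat) \<Rightarrow> complex set \<Rightarrow> complex \<Rightarrow> complex \<Rightarrow> complex mat \<Rightarrow> bool" where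
  "transports p A \<Sigma> z w T \<longleftrightarrow> (\<exists>\<gamma> \<Phi>. valid_path \<gamma> \<and> pathstart \<gamma> = z \<and> pathfinish \<gamma> = w \<and>
     path_image \<gamma> \<subseteq> - \<Sigma> \<and> continuation_along p A \<gamma> (1\<^sub>m p) \<Phi> \<and> \<Phi> 1 = T)"

lemma transports_carrier: "transports p A \<Sigma> z w T \<Longrightarrow> T \<in> carrier_mat p p"
  unfolding transports_def continuation_along_def by auto

lemma transports_trans:
  assumes "transports p A \<Sigma> z w T" "transports p A \<Sigma> w v T'"
  shows "transports p A \<Sigma> z v (T' * T)"
proof -
  have T: "T \<in> carrier_mat p p" using assms(1) by (rule transports_carrier)
  obtain \<gamma>1 \<Phi>1 where 1: "valid_path \<gamma>1" "pathstart \<gamma>1 = z" "pathfinish \<gamma>1 = w"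
     "path_image \<gamma>1 \<subseteq> - \<Sigma>" "continuation_along p A \<gamma>1 (1\<^sub>m p) \<Phi>1" "\<Phi>1 1 = T"
    using assms(1) unfolding transports_def by blast
  obtain \<gamma>2 \<Phi>2 where 2: "valid_path \<gamma>2" "pathstart \<gamma>2 = w" "pathfinish \<gamma>2 = v"
     "path_image \<gamma>2 \<subseteq> - \<Sigma>" "continuation_along p A \<gamma>2 (1\<^sub>m p) \<Phi>2" "\<Phi>2 1 = T'"
    using assms(2) unfolding transports_def by blast
  have "continuation_along p A \<gamma>2 (\<Phi>1 1) (\<lambda>t. \<Phi>2 t * T)"
    using continuation_along_mult_right[OF 2(5) T] T 1(6) by simp
  from continuation_along_join[OF 1(5) this 1(1) 2(1)]
  show ?thesis unfolding transports_def
    using 1 2 path_image_join_subset[of \<gamma>1 \<gamma>2]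
    by (intro exI[of _ "\<gamma>1 +++ \<gamma>2"]
        exI[of _ "\<lambda>t. if t \<le> 1/2 then \<Phi>1 (2 * t) else \<Phi>2 (2 * t - 1) * T"]) (auto intro: valid_path_join)
qed

text \<open>The pulled-back system is solved on a convex domain, where any two points are joined by
  a segment. Its image under \<open>\<phi>\<close> may wind around a singular point when
  \<open>\<phi>\<close> involves the exponential; one lemma thus serves discs and punctured discs
  alike.\<close>

lemma transports_chart:
  assumes D: "convex D" "open D"
    and \<phi>: "\<And>s. s \<in> D \<Longrightarrow> (\<phi> has_field_derivative \<phi>' s) (at s)" "\<And>s. s \<in> D \<Longrightarrow> \<phi> s \<notin> \<Sigma>"
    and car: "\<And>s. U s \<in> carrier_mat p p" "\<And>s. Z s \<in> carrier_mat p p"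
    and UZ: "\<And>s. s \<in> D \<Longrightarrow> U s * Z s = 1\<^sub>m p"
    and U: "\<And>s i j. s \<in> D \<Longrightarrow> i < p \<Longrightarrow> j < p \<Longrightarrow> ((\<lambda>s. U s $$ (i, j)) has_field_derivative
        (\<Sum>l<p. A (\<phi> s) $$ (i, l) * \<phi>' s * U s $$ (l, j))) (at s)"
    and s: "s1 \<in> D" "s2 \<in> D"
  shows "transports p A \<Sigma> (\<phi> s1) (\<phi> s2) (U s2 * Z s1)"
proof -
  define h where "h = linepath s1 s2"
  have img: "path_image h \<subseteq> D" unfolding h_def using D(1) s by (simp add: closed_segment_subset)
  then have h_in: "h t \<in> D" if "t \<in> {0..1}" for t using that by (auto simp: path_image_def)
  have h_der: "(h has_vector_derivative s2 - s1) (at t)" for t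
    unfolding h_def by (rule has_vector_derivative_linepath_within)
  have vp: "valid_path (\<phi> \<circ> h)"
    using \<phi>(1) D(2) img unfolding h_def
    by (intro valid_path_compose_holomorphic[of _ _ D]) (auto simp: holomorphic_on_open)
  have vd: "vector_derivative (\<phi> \<circ> h) (at t) = (s2 - s1) * \<phi>' (h t)" if "t \<in> {0..1}" for t
    by (rule vector_derivative_at[OF field_vector_diff_chain_at[OF h_der \<phi>(1)[OF h_in[OF that]]]])
  have der: "((\<lambda>t. U (h t) $$ (j, k)) has_vector_derivative
     (\<Sum>l<p. A ((\<phi> \<circ> h) t) $$ (j, l) * vector_derivative (\<phi> \<circ> h) (at t) * U (h t) $$ (l, k))) (at t)"
    if "t \<in> {0..1}" "j < p" "k < p" for t j k
    using field_vector_diff_chain_at[OF h_der U[OF h_in[OF that(1)] that(2,3)]] vd[OF that(1)]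
    by (simp add: o_def sum_distrib_left mult_ac)
  have "continuation_along p A (\<phi> \<circ> h) (U s1) (\<lambda>t. U (h t))"
    unfolding continuation_along_def
  proof (intro conjI exI[of _ "{}"] ballI allI impI)
    show "U (h 0) = U s1" by (simp add: h_def linepath_def)
    show "continuous_on {0..1} (\<lambda>t. U (h t) $$ (j, k))" if "j < p" "k < p" for j k
      using der that by (intro continuous_at_imp_continuous_on ballI has_vector_derivative_continuous) auto
  qed (use der car in \<open>auto intro: has_vector_derivative_at_within\<close>)
  from continuation_along_mult_right[OF this car(2)[of s1]]
  have "continuation_along p A (\<phi> \<circ> h) (1\<^sub>m p) (\<lambda>t. U (h t) * Z s1)" using UZ s by simp
  moreover have "path_image (\<phi> \<circ> h) \<subseteq> - \<Sigma>" using img \<phi>(2) by (auto simp: path_image_compose)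
  ultimately show ?thesis
    unfolding transports_def using vp
    by (intro exI[of _ "\<phi> \<circ> h"] exI[of _ "\<lambda>t. U (h t) * Z s1"])
      (auto simp: h_def linepath_def pathstart_def pathfinish_def)
qed

section \<open>Growth in logarithmic coordinates\<close>

text \<open>The local hypothesis is symmetric in \<open>w\<close> and \<open>w'\<close>, so the set
  where \<open>Q\<close> holds and its complement are both open.\<close>

lemma connected_propagation:
  assumes S: "connected S" "open S" and "z0 \<in> S" "Q z0" "z \<in> S"
    and loc: "\<And>z. z \<in> S \<Longrightarrow> \<exists>r>0. \<forall>w\<in>ball z r. \<forall>w'\<in>ball z r. Q w \<longrightarrow> Q w'"
  shows "Q z"
proof (rule ccontr)
  assume "\<not> Q z"
  have op: "open {w \<in> S. Q w}" "open {w \<in> S. \<not> Q w}"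
    unfolding open_contains_ball
  proof (safe)
    fix w assume w: "w \<in> S" "Q w"
    obtain r1 where r1: "r1 > 0" "ball w r1 \<subseteq> S" using \<open>open S\<close> w open_contains_ball by blast
    obtain r2 where r2: "r2 > 0" "\<forall>u\<in>ball w r2. \<forall>u'\<in>ball w r2. Q u \<longrightarrow> Q u'" using loc w by blast
    show "\<exists>e>0. ball w e \<subseteq> {w \<in> S. Q w}"
      using r1 r2 w by (intro exI[of _ "min r1 r2"]) (auto simp: subset_eq)
  next
    fix w assume w: "w \<in> S" "\<not> Q w"
    obtain r1 where r1: "r1 > 0" "ball w r1 \<subseteq> S" using \<open>open S\<close> w open_contains_ball by blast
    obtain r2 where r2: "r2 > 0" "\<forall>u\<in>ball w r2. \<forall>u'\<in>ball w r2. Q u \<longrightarrow> Q u'" using loc w by blast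
    show "\<exists>e>0. ball w e \<subseteq> {w \<in> S. \<not> Q w}"
      using r1 r2 w by (intro exI[of _ "min r1 r2"]) (auto simp: subset_eq)
  qed
  from connectedD[OF S(1) op] show False
    using \<open>z0 \<in> S\<close> \<open>Q z0\<close> \<open>z \<in> S\<close> \<open>\<not> Q z\<close> by auto
qed

definition log_halfplane :: "real \<Rightarrow> complex set" where
  "log_halfplane r = {s. Re s < ln r}"

lemma log_halfplane_props: "convex (log_halfplane r)" "open (log_halfplane r)"
  unfolding log_halfplane_def by (simp_all add: convex_halfspace_Re_lt open_halfspace_Re_lt)

lemma exp_log_halfplane: "0 < r \<Longrightarrow> s \<in> log_halfplane r \<Longrightarrow> exp s \<in> ball 0 r - {0}"
  using exp_less_cancel_iff[of "Re s" "ln r"] by (auto simp: log_halfplane_def)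

lemma Ln_log_halfplane: "u \<in> ball 0 r - {0} \<Longrightarrow> Ln u \<in> log_halfplane r"
  using ln_less_cancel_iff[of "norm u" r] by (auto simp: log_halfplane_def intro: ln_strict_mono)

text \<open>In the coordinate s = ln u with bounded imaginary part, this is polynomial growth in
  1/|u| near 0. Bounding by |s| rather than |u| admits multivalued functions, powers of u with
  complex exponent included, and is stable under sums and products.\<close>

definition moderate_on :: "complex set \<Rightarrow> (complex \<Rightarrow> complex) \<Rightarrow> bool" where
  "moderate_on D h \<longleftrightarrow> (\<exists>C\<ge>0. \<exists>N::nat. \<forall>s\<in>D. norm (h s) \<le> C * exp (N * norm s))"

lemma moderate_onI:
  assumes "\<And>s. s \<in> D \<Longrightarrow> norm (h s) \<le> C * exp (k * norm (s - s1))" "0 \<le> C" "0 \<le> k"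
  shows "moderate_on D h"
proof -
  obtain N :: nat where N: "k \<le> N" using real_arch_simple by blast
  have "norm (h s) \<le> (C * exp (k * norm s1)) * exp (N * norm s)" if "s \<in> D" for s
  proof -
    have "k * norm (s - s1) \<le> k * (norm s + norm s1)"
      using assms(3) by (intro mult_left_mono norm_triangle_ineq4)
    also have "\<dots> \<le> N * norm s + k * norm s1" using N by (simp add: algebra_simps mult_right_mono)
    finally have "exp (k * norm (s - s1)) \<le> exp (N * norm s) * exp (k * norm s1)"
      by (simp flip: exp_add)
    then have "C * exp (k * norm (s - s1)) \<le> C * (exp (N * norm s) * exp (k * norm s1))"
      using assms(2) by (rule mult_left_mono)
    then show ?thesis using assms(1)[OF that] by (simp add: mult_ac)
  qed
  then show ?thesis unfolding moderate_on_def using assms(2)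
    by (intro exI[of _ "C * exp (k * norm s1)"] conjI exI[of _ N]) auto
qed

lemma moderate_on_const: "moderate_on D (\<lambda>s. c)"
  unfolding moderate_on_def by (intro exI[of _ "norm c"] conjI exI[of _ 0]) auto

lemma moderate_on_mult:
  assumes "moderate_on D g" "moderate_on D h"
  shows "moderate_on D (\<lambda>s. g s * h s)"
proof -
  obtain C N where C: "C \<ge> 0" "\<And>s. s \<in> D \<Longrightarrow> norm (g s) \<le> C * exp (real N * norm s)"
    using assms(1) by (auto simp: moderate_on_def)
  obtain C' N' where C': "C' \<ge> 0" "\<And>s. s \<in> D \<Longrightarrow> norm (h s) \<le> C' * exp (real N' * norm s)"
    using assms(2) by (auto simp: moderate_on_def)
  have "norm (g s * h s) \<le> (C * C') * exp (real (N + N') * norm s)" if "s \<in> D" for s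
  proof -
    have "norm (g s * h s) \<le> (C * exp (real N * norm s)) * (C' * exp (real N' * norm s))"
      unfolding norm_mult using C C' that by (intro mult_mono) auto
    moreover have "exp (real (N + N') * norm s) = exp (real N * norm s) * exp (real N' * norm s)"
      by (simp add: distrib_right exp_add)
    ultimately show ?thesis by (simp add: mult_ac)
  qed
  then show ?thesis unfolding moderate_on_def using C(1) C'(1)
    by (intro exI[of _ "C * C'"] conjI exI[of _ "N + N'"]) auto
qed

lemma moderate_on_add:
  assumes "moderate_on D g" "moderate_on D h"
  shows "moderate_on D (\<lambda>s. g s + h s)"
proof -
  obtain C N where C: "C \<ge> 0" "\<And>s. s \<in> D \<Longrightarrow> norm (g s) \<le> C * exp (real N * norm s)"
    using assms(1) by (auto simp: moderate_on_def)
  obtain C' N' where C': "C' \<ge> 0" "\<And>s. s \<in> D \<Longrightarrow> norm (h s) \<le> C' * exp (real N' * norm s)"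
    using assms(2) by (auto simp: moderate_on_def)
  have "norm (g s + h s) \<le> (C + C') * exp (real (N + N') * norm s)" if "s \<in> D" for s
  proof -
    have "C * exp (real N * norm s) \<le> C * exp (real (N + N') * norm s)"
      "C' * exp (real N' * norm s) \<le> C' * exp (real (N + N') * norm s)"
      using C(1) C'(1) by (auto intro!: mult_left_mono mult_right_mono)
    then show ?thesis using C(2)[OF that] C'(2)[OF that] norm_triangle_ineq[of "g s" "h s"]
      by (simp add: distrib_right)
  qed
  then show ?thesis unfolding moderate_on_def using C(1) C'(1)
    by (intro exI[of _ "C + C'"] conjI exI[of _ "N + N'"]) auto
qed

lemma moderate_on_sum:
  "(\<And>i. i \<in> I \<Longrightarrow> moderate_on D (h i)) \<Longrightarrow> moderate_on D (\<lambda>s. \<Sum>i\<in>I. h i s)"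
  by (induction I rule: infinite_finite_induct) (auto intro: moderate_on_add moderate_on_const)

lemma moderate_on_prod:
  "(\<And>i. i \<in> I \<Longrightarrow> moderate_on D (h i)) \<Longrightarrow> moderate_on D (\<lambda>s. \<Prod>i\<in>I. h i s)"
  by (induction I rule: infinite_finite_induct) (auto intro: moderate_on_mult moderate_on_const)

lemma moderate_on_exp: "moderate_on D (\<lambda>s. exp (\<mu> * s))"
proof (rule moderate_onI[of _ _ 1 "norm \<mu>" 0])
  fix s
  have "norm (exp (\<mu> * s)) \<le> exp (norm (\<mu> * s))" by (rule norm_exp)
  then show "norm (exp (\<mu> * s)) \<le> 1 * exp (norm \<mu> * norm (s - 0))" by (simp add: norm_mult)
qed auto

lemma moderate_on_Ln_bound:
  assumes "0 < r" and h: "moderate_on (log_halfplane r) h"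
  obtains C and N :: nat where "0 < C" "\<And>u. u \<in> ball 0 r - {0} \<Longrightarrow> norm (h (Ln u)) \<le> C / norm u ^ N"
proof -
  obtain C N where C: "C \<ge> 0" "\<And>s. s \<in> log_halfplane r \<Longrightarrow> norm (h s) \<le> C * exp (real N * norm s)"
    using h by (auto simp: moderate_on_def)
  \<comment> \<open>The principal branch contributes at most pi to the imaginary part. The term
    \<open>2 * \<bar>ln r\<bar>\<close> covers points with |u| > 1, where
    \<open>- ln (norm u)\<close> has the wrong sign.\<close>
  define D where "D = 2 * \<bar>ln r\<bar> + pi"
  have "norm (h (Ln u)) \<le> ((C + 1) * exp (real N * D)) / norm u ^ N" if u: "u \<in> ball 0 r - {0}" for u
  proof -
    have u0: "0 < norm u" "norm u < r" using u by auto
    have "norm (Ln u) \<le> \<bar>Re (Ln u)\<bar> + \<bar>Im (Ln u)\<bar>" by (rule cmod_le)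
    also have "\<bar>Im (Ln u)\<bar> \<le> pi" using u Im_Ln_le_pi[of u] mpi_less_Im_Ln[of u] by auto
    also have "\<bar>Re (Ln u)\<bar> \<le> - ln (norm u) + 2 * \<bar>ln r\<bar>"
      using Ln_log_halfplane[OF u] u0 by (auto simp: log_halfplane_def)
    finally have "norm (Ln u) \<le> - ln (norm u) + D" by (simp add: D_def)
    then have "real N * norm (Ln u) \<le> real N * (- ln (norm u) + D)" by (rule mult_left_mono) auto
    also have "\<dots> = real N * D + - (real N * ln (norm u))" by (simp add: algebra_simps)
    finally have "exp (real N * norm (Ln u)) \<le> exp (real N * D) * exp (- (real N * ln (norm u)))"
      by (simp flip: exp_add)
    also have "exp (- (real N * ln (norm u))) = 1 / norm u ^ N"
      using u0 by (simp add: exp_minus exp_of_nat_mult inverse_eq_divide)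
    finally have e: "exp (real N * norm (Ln u)) \<le> exp (real N * D) / norm u ^ N" by simp
    have "norm (h (Ln u)) \<le> C * exp (real N * norm (Ln u))" using C(2) Ln_log_halfplane[OF u] by blast
    also have "\<dots> \<le> (C + 1) * (exp (real N * D) / norm u ^ N)" using e C(1) by (intro mult_mono) auto
    finally show ?thesis by simp
  qed
  then show ?thesis using C(1) by (intro that[of "(C + 1) * exp (real N * D)" N]) auto
qed

lemma periodic_int:
  fixes h :: "complex \<Rightarrow> complex"
  assumes per: "\<And>s. s \<in> log_halfplane r \<Longrightarrow> h (s + 2 * pi * \<i>) = h s" and "s \<in> log_halfplane r"
  shows "h (s + of_int k * (2 * pi * \<i>)) = h s"
proof -
  have 1: "h (w + of_nat m * (2 * pi * \<i>)) = h w" if "w \<in> log_halfplane r" for m :: nat and w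
  proof (induction m)
    case (Suc m)
    have "h (w + of_nat m * (2 * pi * \<i>) + 2 * pi * \<i>) = h (w + of_nat m * (2 * pi * \<i>))"
      using that by (intro per) (auto simp: log_halfplane_def)
    then show ?case using Suc by (simp add: algebra_simps)
  qed simp
  show ?thesis
  proof (cases "0 \<le> k")
    case True
    then show ?thesis using 1[OF assms(2), of "nat k"] by simp
  next
    case False
    have "s + of_int k * (2 * pi * \<i>) \<in> log_halfplane r" using assms(2) by (simp add: log_halfplane_def)
    from 1[OF this, of "nat (- k)"] False show ?thesis by (simp add: algebra_simps)
  qed
qed

text \<open>Periodicity makes \<open>h\<close> independent of the branch of the logarithm, so the
  jump of \<open>Ln\<close> across the negative real axis does not matter.\<close>

lemma periodic_descends:
  fixes h :: "complex \<Rightarrow> complex"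
  assumes per: "\<And>s. s \<in> log_halfplane r \<Longrightarrow> h (s + 2 * pi * \<i>) = h s" and "0 < r"
    and hol: "h holomorphic_on log_halfplane r"
  shows "s \<in> log_halfplane r \<Longrightarrow> h (Ln (exp s)) = h s"
    and "(\<lambda>u. h (Ln u)) holomorphic_on (ball 0 r - {0})"
proof -
  show 1: "h (Ln (exp s)) = h s" if "s \<in> log_halfplane r" for s
  proof -
    have "exp (Ln (exp s)) = exp s" by simp
    then obtain k :: int where "Ln (exp s) = s + of_int k * (2 * pi * \<i>)"
      unfolding exp_eq by (auto simp: mult_ac)
    then show ?thesis using periodic_int[where h=h and r=r, OF per that] by simp
  qed
  show "(\<lambda>u. h (Ln u)) holomorphic_on (ball 0 r - {0})"
  proof (subst holomorphic_on_open)
    show "open (ball (0::complex) r - {0})" by auto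
    show "\<forall>u\<in>ball 0 r - {0}. \<exists>f'. ((\<lambda>u. h (Ln u)) has_field_derivative f') (at u)"
    proof
      fix u :: complex assume u: "u \<in> ball 0 r - {0}"
      \<comment> \<open>A branch of the logarithm that is holomorphic near \<open>u\<close>, also
        when \<open>u\<close> lies on the cut: the argument \<open>w / u\<close> is close to
        1.\<close>
      define L where "L w = Ln u + Ln (w / u)" for w
      have L: "exp (L w) = w" if "w \<noteq> 0" for w using u that by (simp add: L_def exp_add)
      have L_in: "L w \<in> log_halfplane r" if "w \<in> ball 0 r - {0}" for w
      proof -
        have "norm w = exp (Re (L w))" using L[of w] that norm_exp_eq_Re[of "L w"] by simp
        then have "Re (L w) = ln (norm w)" by simp
        then show ?thesis using Ln_log_halfplane[OF that] that by (simp add: log_halfplane_def)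
      qed
      obtain h' where "(h has_field_derivative h') (at (L u))"
        using hol L_in[OF u] log_halfplane_props(2) by (auto simp: holomorphic_on_open)
      moreover have "(L has_field_derivative (1 / u)) (at u)"
        unfolding L_def using u by (auto intro!: derivative_eq_intros)
      ultimately have "((\<lambda>w. h (L w)) has_field_derivative h' * (1 / u)) (at u)"
        by (rule DERIV_chain2)
      then have "((\<lambda>u. h (Ln u)) has_field_derivative h' * (1 / u)) (at u)"
      proof (rule has_field_derivative_transform_within_open)
        show "open (ball (0::complex) r - {0})" by auto
        show "h (L w) = h (Ln w)" if "w \<in> ball 0 r - {0}" for w
          using 1[OF L_in[OF that]] L[of w] that by simp
      qed (use u in auto)
      then show "\<exists>f'. ((\<lambda>u. h (Ln u)) has_field_derivative f') (at u)" by blast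
    qed
  qed
qed

text \<open>\<open>h\<close> descends to a holomorphic function on the punctured disc with at most a
  pole at 0. As it is not identically zero, it has finite order there and is bounded below by a
  power of |u|.\<close>

lemma periodic_moderate_lower_bound:
  fixes h :: "complex \<Rightarrow> complex"
  assumes per: "\<And>s. s \<in> log_halfplane r \<Longrightarrow> h (s + 2 * pi * \<i>) = h s" and r: "0 < r"
    and hol: "h holomorphic_on log_halfplane r" and mod: "moderate_on (log_halfplane r) h"
    and nz: "s1 \<in> log_halfplane r" "h s1 \<noteq> 0"
  obtains \<rho> c and m :: nat where "0 < \<rho>" "\<rho> \<le> r" "0 < c"
    and "\<And>u. u \<in> ball 0 \<rho> - {0} \<Longrightarrow> c * norm u ^ m \<le> norm (h (Ln u))"
proof -
  define H where "H u = h (Ln u)" for u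
  have desc: "\<And>s. s \<in> log_halfplane r \<Longrightarrow> h (Ln (exp s)) = h s"
    "(\<lambda>u. h (Ln u)) holomorphic_on (ball 0 r - {0})"
    using periodic_descends[of r h] per r hol by blast+
  obtain C and N :: nat where C: "0 < C" "\<And>u. u \<in> ball 0 r - {0} \<Longrightarrow> norm (H u) \<le> C / norm u ^ N"
    using moderate_on_Ln_bound[OF r mod] unfolding H_def by blast
  have "(\<lambda>u. u ^ N * H u) holomorphic_on (ball 0 r - {0})"
    unfolding H_def by (intro holomorphic_intros desc(2))
  moreover have "\<forall>\<^sub>F u in at 0. norm (u ^ N * H u) \<le> C"
    unfolding eventually_at
  proof (intro exI[of _ r] conjI ballI impI)
    fix u :: complex assume "u \<noteq> 0 \<and> dist u 0 < r"
    then have "norm (H u) \<le> C / norm u ^ N" "0 < norm u" using C(2)[of u] by auto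
    then show "norm (u ^ N * H u) \<le> C" by (simp add: norm_mult norm_power field_simps)
  qed (use r in auto)
  ultimately obtain g where g: "g holomorphic_on ball 0 r" "\<And>u. u \<in> ball 0 r - {0} \<Longrightarrow> g u = u ^ N * H u"
    using holomorphic_on_extend_bounded[of "\<lambda>u. u ^ N * H u" "ball 0 r" 0] r by auto
  \<comment> \<open>The extra factor \<open>u\<close> forces \<open>f 0 = 0\<close>, so that a lower
    bound for \<open>f - f 0\<close> is one for \<open>f\<close>; it also makes \<open>f\<close>
    non-constant, since \<open>f u1 \<noteq> 0\<close>.\<close>
  define f where "f u = u * g u" for u
  have f_hol: "f holomorphic_on ball 0 r" unfolding f_def by (intro holomorphic_intros g(1))
  define u1 where "u1 = exp s1"
  have u1: "u1 \<in> ball 0 r - {0}" unfolding u1_def by (rule exp_log_halfplane[OF r nz(1)])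
  have "H u1 \<noteq> 0" using desc(1)[OF nz(1)] nz(2) by (simp add: H_def u1_def)
  then have ne: "f u1 \<noteq> f 0" using u1 g(2)[OF u1] by (auto simp: f_def)
  have in_ball: "0 \<in> ball 0 r" "u1 \<in> ball 0 r" using r u1 by auto
  obtain c m \<rho> where c: "0 < c" "0 < \<rho>" "ball (0 :: complex) \<rho> \<subseteq> ball 0 r"
    "\<And>w. w \<in> ball 0 \<rho> \<Longrightarrow> c * norm (w - 0) ^ m \<le> norm (f w - f 0)"
    by (rule holomorphic_lower_bound_difference[OF f_hol open_ball connected_ball in_ball ne]) (rule that)
  show ?thesis
  proof (rule that[of "min \<rho> r" "c / r ^ Suc N" m])
    fix u :: complex assume u: "u \<in> ball 0 (min \<rho> r) - {0}"
    have "c * norm u ^ m \<le> norm (u * g u)" using c(4)[of u] u by (simp add: f_def)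
    also have "\<dots> = norm u ^ Suc N * norm (H u)" using g(2)[of u] u by (simp add: norm_mult norm_power)
    also have "\<dots> \<le> r ^ Suc N * norm (H u)" using u by (intro mult_right_mono power_mono) auto
    finally show "c / r ^ Suc N * norm u ^ m \<le> norm (h (Ln u))" using r by (simp add: H_def field_simps)
  qed (use c r in auto)
qed

section \<open>Rationality\<close>

lemma entire_polynomial_growth_poly:
  assumes "f holomorphic_on UNIV" "\<And>z. R \<le> norm z \<Longrightarrow> norm (f z) \<le> C * norm z ^ m"
  shows "\<exists>q. \<forall>z. f z = poly q z"
proof (intro exI allI)
  fix z
  have "f z = (\<Sum>k\<le>m. (deriv ^^ k) f 0 / fact k * z ^ k)"
    by (rule Liouville_polynomial[OF assms])
  also have "\<dots> = poly (\<Sum>k\<le>m. monom ((deriv ^^ k) f 0 / fact k) k) z"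
    by (simp add: poly_sum poly_monom)
  finally show "f z = poly (\<Sum>k\<le>m. monom ((deriv ^^ k) f 0 / fact k) k) z" .
qed

text \<open>A power of the product of the \<open>z - c\<close> removes the poles, and Liouville's
  theorem with polynomial growth at infinity does the rest. The claim for all
  \<open>m \<ge> N\<close> allows one exponent to serve finitely many functions.\<close>

lemma moderate_growth_rational:
  fixes f :: "complex \<Rightarrow> complex"
  assumes S: "finite S" and hol: "f holomorphic_on - S"
    and fin: "\<And>c. c \<in> S \<Longrightarrow> \<exists>C k. \<forall>\<^sub>F z in at c. norm (f z) \<le> C / norm (z - c) ^ (k :: nat)"
    and inf: "\<exists>C k. \<forall>\<^sub>F z in at_infinity. norm (f z) \<le> C * norm z ^ (k :: nat)"
  obtains N :: nat where "\<And>m. N \<le> m \<Longrightarrow> \<exists>q. \<forall>z. z \<notin> S \<longrightarrow> (\<Prod>c\<in>S. z - c) ^ m * f z = poly q z"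
proof -
  have "\<forall>c. \<exists>k C. c \<in> S \<longrightarrow> (\<forall>\<^sub>F z in at c. norm (f z) \<le> C / norm (z - c) ^ (k :: nat))"
    using fin by blast
  then obtain k C where kC: "\<And>c. c \<in> S \<Longrightarrow> \<forall>\<^sub>F z in at c. norm (f z) \<le> C c / norm (z - c) ^ (k c :: nat)"
    by metis
  \<comment> \<open>Any number above all pole orders would do; the sum is a convenient one.\<close>
  define N where "N = (\<Sum>c\<in>S. k c)"
  show ?thesis
  proof (rule that[of N])
    fix m assume m: "N \<le> m"
    define P where "P z = (\<Prod>c\<in>S. z - c) ^ m" for z
    have "\<exists>g. g holomorphic_on UNIV \<and> (\<forall>z\<in>UNIV - S. g z = P z * f z)"
    proof (rule removable_singularities[OF S])
      show "(\<lambda>z. P z * f z) holomorphic_on UNIV - S"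
        unfolding P_def by (intro holomorphic_intros) (use hol in \<open>simp add: Compl_eq_Diff_UNIV\<close>)
      fix c assume c: "c \<in> S"
      have "k c \<le> m" using m member_le_sum[OF c, of k] S by (simp add: N_def)
      define Q where "Q z = (z - c) ^ (m - k c) * (\<Prod>c'\<in>S - {c}. z - c') ^ m" for z
      have "P z = (z - c) ^ k c * Q z" for z
        using S c \<open>k c \<le> m\<close> unfolding P_def Q_def
        by (subst prod.remove[OF S c]) (simp add: power_mult_distrib flip: power_add mult.assoc)
      moreover have "Q \<midarrow>c\<rightarrow> Q c"
        unfolding Q_def by (intro tendsto_intros)
      then have "\<forall>\<^sub>F z in at c. norm (Q z) < norm (Q c) + 1"
        by (intro order_tendstoD[OF tendsto_norm]) auto
      then have "\<forall>\<^sub>F z in at c. norm ((z - c) ^ k c * Q z * f z) \<le> \<bar>C c\<bar> * (norm (Q c) + 1)"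
        using kC[OF c] eventually_neq_at_within[of c c UNIV]
      proof eventually_elim
        case (elim z)
        have "norm ((z - c) ^ k c * Q z * f z) = norm (Q z) * (norm (z - c) ^ k c * norm (f z))"
          by (simp add: norm_mult norm_power)
        also have "\<dots> \<le> (norm (Q c) + 1) * \<bar>C c\<bar>"
        proof (intro mult_mono)
          have "norm (z - c) ^ k c * norm (f z) \<le> C c" using elim by (simp add: field_simps)
          then show "norm (z - c) ^ k c * norm (f z) \<le> \<bar>C c\<bar>" by simp
        qed (use elim in auto)
        finally show ?case by (simp add: mult_ac)
      qed
      ultimately show "(\<lambda>z. P z * f z) \<in> O[at c](\<lambda>_. 1)"
        by (intro bigoI[of _ "\<bar>C c\<bar> * (norm (Q c) + 1)"]) simp
    qed simp
    then obtain g where g: "g holomorphic_on UNIV" "\<And>z. z \<notin> S \<Longrightarrow> g z = P z * f z" by blast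
    obtain C' k' where "\<forall>\<^sub>F z in at_infinity. norm (f z) \<le> C' * norm z ^ (k' :: nat)" using inf by blast
    then obtain R1 where R1: "\<And>z. R1 \<le> norm z \<Longrightarrow> norm (f z) \<le> C' * norm z ^ k'"
      by (auto simp: eventually_at_infinity)
    define R2 where "R2 = (\<Sum>c\<in>S. norm c) + 1"
    have R2: "norm c < R2" if "c \<in> S" for c
      using member_le_sum[OF that, of norm] S by (simp add: R2_def)
    have "norm (g z) \<le> (2 ^ (card S * m) * \<bar>C'\<bar>) * norm z ^ (card S * m + k')" if z: "max R1 R2 \<le> norm z" for z
    proof -
      have "z \<notin> S" using R2[of z] z by auto
      have "norm (\<Prod>c\<in>S. z - c) \<le> (\<Prod>c\<in>S. 2 * norm z)"
        unfolding prod_norm[symmetric]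
      proof (intro prod_mono conjI norm_ge_zero)
        fix c assume "c \<in> S"
        then show "norm (z - c) \<le> 2 * norm z" using R2[of c] z norm_triangle_ineq4[of z c] by simp
      qed
      then have "norm (P z) \<le> (2 * norm z) ^ (card S * m)"
        unfolding P_def norm_power by (auto simp: power_mult intro!: power_mono)
      moreover have "norm (f z) \<le> \<bar>C'\<bar> * norm z ^ k'"
      proof -
        have "C' * norm z ^ k' \<le> \<bar>C'\<bar> * norm z ^ k'" by (intro mult_right_mono) auto
        then show ?thesis using R1[of z] z by simp
      qed
      ultimately have "norm (P z) * norm (f z) \<le> (2 * norm z) ^ (card S * m) * (\<bar>C'\<bar> * norm z ^ k')"
        by (intro mult_mono) auto
      then show ?thesis using g(2)[OF \<open>z \<notin> S\<close>] by (simp add: norm_mult power_mult_distrib power_add mult_ac)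
    qed
    then have "\<exists>q. \<forall>z. g z = poly q z" by (rule entire_polynomial_growth_poly[OF g(1)])
    then obtain q where "\<And>z. g z = poly q z" by blast
    then show "\<exists>q. \<forall>z. z \<notin> S \<longrightarrow> (\<Prod>c\<in>S. z - c) ^ m * f z = poly q z"
      using g(2) by (intro exI[of _ q]) (auto simp: P_def)
  qed
qed

section \<open>The field of subspaces spanned by the leading columns\<close>

definition tame_on :: "complex set \<Rightarrow> (complex \<Rightarrow> complex) \<Rightarrow> bool" where
  "tame_on D h \<longleftrightarrow> h holomorphic_on D \<and> moderate_on D h"

lemma tame_on_const: "tame_on D (\<lambda>s. c)"
  by (simp add: tame_on_def moderate_on_const)

lemma tame_on_mult: "tame_on D g \<Longrightarrow> tame_on D h \<Longrightarrow> tame_on D (\<lambda>s. g s * h s)"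
  by (simp add: tame_on_def moderate_on_mult holomorphic_on_mult)

lemma tame_on_sum: "(\<And>i. i \<in> I \<Longrightarrow> tame_on D (h i)) \<Longrightarrow> tame_on D (\<lambda>s. \<Sum>i\<in>I. h i s)"
  by (simp add: tame_on_def moderate_on_sum holomorphic_on_sum)

lemma tame_on_prod: "(\<And>i. i \<in> I \<Longrightarrow> tame_on D (h i)) \<Longrightarrow> tame_on D (\<lambda>s. \<Prod>i\<in>I. h i s)"
  by (simp add: tame_on_def moderate_on_prod holomorphic_on_prod)

lemma tame_on_det:
  assumes "\<And>i j. i < m \<Longrightarrow> j < m \<Longrightarrow> tame_on D (\<lambda>s. X s i j)"
  shows "tame_on D (\<lambda>s. det (mat m m (\<lambda>(i, j). X s i j)))"
proof -
  have less: "\<pi> i < m" if "\<pi> permutes {0..<m}" "i < m" for \<pi> i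
    using permutes_in_image[OF that(1), of i] that(2) by simp
  have "det (mat m m (\<lambda>(i, j). X s i j)) = (\<Sum>\<pi> | \<pi> permutes {0..<m}. signof \<pi> * (\<Prod>i = 0..<m. X s i (\<pi> i)))" for s
    by (subst det_def'[of _ m]) (auto intro!: sum.cong prod.cong simp: less)
  moreover have "tame_on D (\<lambda>s. \<Sum>\<pi> | \<pi> permutes {0..<m}. signof \<pi> * (\<Prod>i = 0..<m. X s i (\<pi> i)))"
    using assms by (intro tame_on_sum tame_on_mult tame_on_prod tame_on_const) (auto simp: less)
  ultimately show ?thesis by simp
qed

lemma tame_on_adj_mat:
  assumes X: "\<And>i j. i < m \<Longrightarrow> j < m \<Longrightarrow> tame_on D (\<lambda>s. X s i j)" and ij: "i < m" "j < m"
  shows "tame_on D (\<lambda>s. adj_mat (mat m m (\<lambda>(i, j). X s i j)) $$ (i, j))"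
proof -
  have "adj_mat (mat m m (\<lambda>(i, j). X s i j)) $$ (i, j) = (- 1) ^ (j + i) *
      det (mat (m - 1) (m - 1) (\<lambda>(k, l). X s (if k < j then k else Suc k) (if l < i then l else Suc l)))" for s
  proof -
    have "mat_delete (mat m m (\<lambda>(i, j). X s i j)) j i
      = mat (m - 1) (m - 1) (\<lambda>(k, l). X s (if k < j then k else Suc k) (if l < i then l else Suc l))"
      using ij by (intro eq_matI) (auto simp: mat_delete_def)
    then show ?thesis using ij by (simp add: adj_mat_def cofactor_def)
  qed
  moreover have "tame_on D (\<lambda>s. (- 1) ^ (j + i) *
      det (mat (m - 1) (m - 1) (\<lambda>(k, l). X s (if k < j then k else Suc k) (if l < i then l else Suc l))))"
    using ij by (intro tame_on_mult tame_on_const tame_on_det X) auto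
  ultimately show ?thesis by simp
qed

section \<open>The coefficient matrix and its covariant derivative\<close>

lemma fuchs_coeff_carrier: "fuchs_coeff p n a B z \<in> carrier_mat p p"
  by (simp add: fuchs_coeff_def)

lemma fuchs_coeff_index:
  "j < p \<Longrightarrow> l < p \<Longrightarrow> fuchs_coeff p n a B z $$ (j, l) = (\<Sum>i<n. B i $$ (j, l) / (z - a i))"
  by (simp add: fuchs_coeff_def)

lemma fuchs_coeff_holomorphic:
  assumes "j < p" "l < p"
  shows "(\<lambda>z. fuchs_coeff p n a B z $$ (j, l)) holomorphic_on - (a ` {..<n})"
  unfolding fuchs_coeff_index[OF assms] by (intro holomorphic_intros) auto

lemma poly_nabla_num:
  assumes "l < p" "z \<notin> a ` {..<n}"
  shows "poly (nabla_num p n a B x l) z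
    = poly (node_poly n a) z * ((\<Sum>m<p. fuchs_coeff p n a B z $$ (l, m) * poly (x m) z) - poly (pderiv (x l)) z)"
proof -
  have nz: "z - a i \<noteq> 0" if "i < n" for i using that assms(2) by auto
  have "poly (node_poly n a) z * (\<Sum>m<p. fuchs_coeff p n a B z $$ (l, m) * poly (x m) z)
    = (\<Sum>m<p. \<Sum>i<n. poly (node_poly n a) z * (B i $$ (l, m) / (z - a i)) * poly (x m) z)"
    using assms(1) by (simp add: fuchs_coeff_index sum_distrib_left sum_distrib_right mult.assoc)
  also have "\<dots> = (\<Sum>m<p. \<Sum>i<n. B i $$ (l, m) * (poly (conode_poly n a i) z * poly (x m) z))"
  proof (intro sum.cong refl)
    fix m i assume "i \<in> {..<n}"
    then show "poly (node_poly n a) z * (B i $$ (l, m) / (z - a i)) * poly (x m) z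
       = B i $$ (l, m) * (poly (conode_poly n a i) z * poly (x m) z)"
      using nz[of i] poly_node_poly_split[of i n a z] by simp
  qed
  also have "\<dots> = (\<Sum>i<n. \<Sum>m<p. B i $$ (l, m) * (poly (conode_poly n a i) z * poly (x m) z))"
    by (rule sum.swap)
  finally show ?thesis by (simp add: nabla_num_def poly_sum right_diff_distrib)
qed

text \<open>The fundamental matrix is normalised to be the identity at \<open>z0\<close>, so
  transports along loops at \<open>z0\<close> are the monodromy matrices themselves.
  \<open>loops\<close> keeps just one zero corner of the block structure, the one cut off by the
  first \<open>d\<close> columns.\<close>

locale fuchsian_subspace =
  fixes p n d :: nat and a :: "nat \<Rightarrow> complex" and B :: "nat \<Rightarrow> complex mat" and z0 :: complex
  assumes dp: "d \<le> p" and z0: "z0 \<notin> a ` {..<n}"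
    and loops: "\<And>T j l. transports p (fuchs_coeff p n a B) (a ` {..<n}) z0 z0 T \<Longrightarrow>
      d \<le> j \<Longrightarrow> j < p \<Longrightarrow> l < d \<Longrightarrow> T $$ (j, l) = 0"
begin

abbreviation "A \<equiv> fuchs_coeff p n a B"
abbreviation "sing \<equiv> a ` {..<n}"
abbreviation "conn \<equiv> transports p A sing"

text \<open>The inverse must itself be a transport back to \<open>z0\<close>. Composing it with
  another transport to \<open>z\<close> gives a transport along a loop at \<open>z0\<close>, which
  is what \<open>loops\<close> controls.\<close>

definition reach :: "complex \<Rightarrow> complex mat \<Rightarrow> bool" where
  "reach z M \<longleftrightarrow> conn z0 z M \<and> (\<exists>N. conn z z0 N \<and> N * M = 1\<^sub>m p \<and> M * N = 1\<^sub>m p)"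

lemma reach_carrier: "reach z M \<Longrightarrow> M \<in> carrier_mat p p"
  unfolding reach_def using transports_carrier by blast

lemma reach_base: "reach z0 (1\<^sub>m p)"
proof -
  have "continuation_along p A (linepath z0 z0) (1\<^sub>m p) (\<lambda>t. 1\<^sub>m p)"
    unfolding continuation_along_def by (auto intro!: exI[of _ "{}"])
  then have "conn z0 z0 (1\<^sub>m p)"
    unfolding transports_def using z0 by (intro exI[of _ "linepath z0 z0"] exI[of _ "\<lambda>t. 1\<^sub>m p"]) auto
  then show ?thesis unfolding reach_def by (auto intro!: exI[of _ "1\<^sub>m p"])
qed

lemma reach_step:
  assumes M: "reach z M" and T: "conn z w T" "conn w z T'" "T * T' = 1\<^sub>m p" "T' * T = 1\<^sub>m p"
  shows "reach w (T * M)"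
proof -
  obtain N where N: "conn z z0 N" "N * M = 1\<^sub>m p" "M * N = 1\<^sub>m p" using M by (auto simp: reach_def)
  have c: "M \<in> carrier_mat p p" "N \<in> carrier_mat p p" "T \<in> carrier_mat p p" "T' \<in> carrier_mat p p"
    using M N(1) T(1,2) reach_carrier transports_carrier by blast+
  have "conn z0 w (T * M)" using M T(1) transports_trans unfolding reach_def by blast
  moreover have "conn w z0 (N * T')" using T(2) N(1) transports_trans by blast
  moreover have "(N * T') * (T * M) = N * ((T' * T) * M)"
    using c by (simp add: assoc_mult_mat[of _ p p _ p _ p])
  moreover have "(T * M) * (N * T') = T * ((M * N) * T')"
    using c by (simp add: assoc_mult_mat[of _ p p _ p _ p])
  ultimately show ?thesis unfolding reach_def using N T(3,4) c by (auto intro!: exI[of _ "N * T'"])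
qed

text \<open>Going out by one path and back by the other is a loop at \<open>z0\<close>, so
  \<open>G\<close> inherits the zero corner. Hence the span of the first \<open>d\<close> columns
  does not depend on the path.\<close>

lemma reach_unique:
  assumes M: "reach z M" "reach z M'"
  obtains G where "G \<in> carrier_mat p p" "M = M' * G" "\<And>j l. d \<le> j \<Longrightarrow> j < p \<Longrightarrow> l < d \<Longrightarrow> G $$ (j, l) = 0"
proof -
  obtain N where N: "conn z z0 N" "M' * N = 1\<^sub>m p" using M(2) by (auto simp: reach_def)
  have c: "M \<in> carrier_mat p p" "N \<in> carrier_mat p p" "M' \<in> carrier_mat p p"
    using M N(1) reach_carrier transports_carrier by blast+
  have "conn z0 z0 (N * M)" using M(1) N(1) transports_trans unfolding reach_def by blast
  moreover have "M' * (N * M) = M" using c N(2) by (simp flip: assoc_mult_mat[of _ p p _ p _ p])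
  ultimately show ?thesis using c loops by (intro that[of "N * M"]) auto
qed

definition topmat :: "complex mat \<Rightarrow> complex mat" where
  "topmat M = mat d d (\<lambda>(i, j). M $$ (i, j))"

lemma topmat_carrier: "topmat M \<in> carrier_mat d d"
  by (simp add: topmat_def)

lemma sum_lower_block_zero:
  assumes "G \<in> carrier_mat p p" "\<And>j l. d \<le> j \<Longrightarrow> j < p \<Longrightarrow> l < d \<Longrightarrow> G $$ (j, l) = 0" "l < d"
  shows "(\<Sum>m<p. f m * G $$ (m, l)) = (\<Sum>m<d. f m * (G $$ (m, l) :: complex))"
  using assms dp by (intro sum.mono_neutral_right) auto

text \<open>Because of the zero corner of \<open>G\<close>, the top left block is multiplicative. A
  change of path thus rescales the top minor by one number, and its vanishing is a property of the
  point.\<close>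

lemma det_topmat_mult:
  assumes M: "M \<in> carrier_mat p p" and G: "G \<in> carrier_mat p p"
    "\<And>j l. d \<le> j \<Longrightarrow> j < p \<Longrightarrow> l < d \<Longrightarrow> G $$ (j, l) = 0"
  shows "det (topmat (M * G)) = det (topmat M) * det (topmat G)"
proof -
  have "topmat (M * G) = topmat M * topmat G"
  proof (rule eq_matI)
    fix i j assume "i < dim_row (topmat M * topmat G)" "j < dim_col (topmat M * topmat G)"
    then have ij: "i < d" "j < d" by (auto simp: topmat_def)
    have "(M * G) $$ (i, j) = (\<Sum>m<p. M $$ (i, m) * G $$ (m, j))"
      using ij dp by (intro index_mult_sum[OF M G(1)]) auto
    also have "\<dots> = (\<Sum>m<d. M $$ (i, m) * G $$ (m, j))" by (rule sum_lower_block_zero[OF G ij(2)])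
    also have "\<dots> = (topmat M * topmat G) $$ (i, j)"
      using ij by (subst index_mult_sum[OF topmat_carrier topmat_carrier ij]) (simp add: topmat_def)
    finally show "topmat (M * G) $$ (i, j) = (topmat M * topmat G) $$ (i, j)"
      using ij by (simp add: topmat_def)
  qed (auto simp: topmat_def)
  then show ?thesis using det_mult[OF topmat_carrier topmat_carrier] by simp
qed

text \<open>The points where the subspace is a graph over its first \<open>d\<close> coordinates, a
  condition read off from one Pluecker coordinate.\<close>

definition good :: "complex \<Rightarrow> bool" where
  "good z \<longleftrightarrow> (\<exists>M. reach z M \<and> det (topmat M) \<noteq> 0)"

lemma good_iff:
  assumes "reach z M"
  shows "good z \<longleftrightarrow> det (topmat M) \<noteq> 0"
proof
  assume "good z"
  then obtain M' where M': "reach z M'" "det (topmat M') \<noteq> 0" by (auto simp: good_def)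
  obtain G where "G \<in> carrier_mat p p" "M' = M * G" "\<And>j l. d \<le> j \<Longrightarrow> j < p \<Longrightarrow> l < d \<Longrightarrow> G $$ (j, l) = 0"
    using reach_unique[OF M'(1) assms] by blast
  then show "det (topmat M) \<noteq> 0" using det_topmat_mult[OF reach_carrier[OF assms], of G] M'(2) by auto
qed (use assms good_def in blast)

definition F :: "complex \<Rightarrow> (nat \<Rightarrow> complex) \<Rightarrow> bool" where
  "F z v \<longleftrightarrow> (\<exists>M c. reach z M \<and> (\<forall>l<p. v l = (\<Sum>j<d. M $$ (l, j) * c j)))"

lemma F_iff:
  assumes "reach z M"
  shows "F z v \<longleftrightarrow> (\<exists>c. \<forall>l<p. v l = (\<Sum>j<d. M $$ (l, j) * c j))"
proof
  assume "F z v"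
  then obtain M' c where M': "reach z M'" "\<forall>l<p. v l = (\<Sum>j<d. M' $$ (l, j) * c j)" by (auto simp: F_def)
  obtain G where G: "G \<in> carrier_mat p p" "M' = M * G" "\<And>j l. d \<le> j \<Longrightarrow> j < p \<Longrightarrow> l < d \<Longrightarrow> G $$ (j, l) = 0"
    using reach_unique[OF M'(1) assms] by blast
  have "v l = (\<Sum>m<d. M $$ (l, m) * (\<Sum>j<d. G $$ (m, j) * c j))" if l: "l < p" for l
  proof -
    have "M' $$ (l, j) = (\<Sum>m<d. M $$ (l, m) * G $$ (m, j))" if "j < d" for j
      unfolding G(2) using that dp l
      by (subst index_mult_sum[OF reach_carrier[OF assms] G(1)]) (auto intro!: sum_lower_block_zero G)
    then have "v l = (\<Sum>j<d. (\<Sum>m<d. M $$ (l, m) * G $$ (m, j)) * c j)" using M'(2) l by simp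
    also have "\<dots> = (\<Sum>m<d. M $$ (l, m) * (\<Sum>j<d. G $$ (m, j) * c j))"
      by (simp add: sum_distrib_left sum_distrib_right mult.assoc) (rule sum.swap)
    finally show ?thesis .
  qed
  then show "\<exists>c. \<forall>l<p. v l = (\<Sum>j<d. M $$ (l, j) * c j)"
    by (intro exI[of _ "\<lambda>m. \<Sum>j<d. G $$ (m, j) * c j"]) simp
qed (use assms in \<open>auto simp: F_def\<close>)

lemma F_top_zero:
  assumes "good z" "F z v" "\<And>l. l < d \<Longrightarrow> v l = 0" "l < p"
  shows "v l = 0"
proof -
  obtain M where M: "reach z M" "det (topmat M) \<noteq> 0" using assms(1) by (auto simp: good_def)
  obtain c where c: "\<And>l. l < p \<Longrightarrow> v l = (\<Sum>j<d. M $$ (l, j) * c j)" using F_iff[OF M(1)] assms(2) by auto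
  obtain Y where Y: "\<And>i j. i < d \<Longrightarrow> j < d \<Longrightarrow>
      (\<Sum>k<d. Y i k * M $$ (k, j)) = (if i = j then det (topmat M) else 0)"
    unfolding topmat_def by (rule adjugate_entries[where X="\<lambda>i j. M $$ (i, j)" and d=d]) blast
  have "c i = 0" if i: "i < d" for i
  proof -
    have "0 = (\<Sum>k<d. Y i k * (\<Sum>j<d. M $$ (k, j) * c j))" using c assms(3) dp by simp
    also have "\<dots> = (\<Sum>j<d. (\<Sum>k<d. Y i k * M $$ (k, j)) * c j)"
      by (simp add: sum_distrib_left sum_distrib_right mult.assoc) (rule sum.swap)
    also have "\<dots> = (\<Sum>j<d. if j = i then det (topmat M) * c j else 0)"
      using Y i by (intro sum.cong) auto
    finally show ?thesis using M(2) i by simp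
  qed
  then show ?thesis using c[OF assms(4)] by simp
qed

lemma F_zero: "good z \<Longrightarrow> F z (\<lambda>l. 0)"
  unfolding good_def F_def by (auto intro!: exI[of _ "\<lambda>j. 0"])

lemma F_add: "F z u \<Longrightarrow> F z v \<Longrightarrow> F z (\<lambda>l. u l + v l)"
proof -
  assume u: "F z u" and v: "F z v"
  then obtain M where M: "reach z M" by (auto simp: F_def)
  obtain c c' where "\<forall>l<p. u l = (\<Sum>j<d. M $$ (l, j) * c j)" "\<forall>l<p. v l = (\<Sum>j<d. M $$ (l, j) * c' j)"
    using u v F_iff[OF M] by auto
  then show ?thesis unfolding F_iff[OF M]
    by (intro exI[of _ "\<lambda>j. c j + c' j"]) (simp add: distrib_left sum.distrib)
qed

lemma F_scale: "F z u \<Longrightarrow> F z (\<lambda>l. u l * b)"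
proof -
  assume "F z u"
  then obtain M c where "reach z M" "\<forall>l<p. u l = (\<Sum>j<d. M $$ (l, j) * c j)" by (auto simp: F_def)
  then show ?thesis unfolding F_def
    by (intro exI[of _ M] exI[of _ "\<lambda>j. c j * b"]) (simp add: sum_distrib_right mult.assoc)
qed

lemma F_cong: "F z u \<Longrightarrow> (\<And>l. l < p \<Longrightarrow> u l = v l) \<Longrightarrow> F z v"
  unfolding F_def by auto

text \<open>Column \<open>j\<close> of the frame of \<open>F z\<close> that is the identity in the
  first \<open>d\<close> rows. At good points its entries below \<open>p\<close> are determined by
  \<open>F z\<close> alone, hence single-valued in \<open>z\<close>, and are quotients of Pluecker
  coordinates.\<close>

definition normal_col :: "nat \<Rightarrow> complex \<Rightarrow> nat \<Rightarrow> complex" where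
  "normal_col j z = (SOME v. F z v \<and> (\<forall>i<d. v i = (if i = j then 1 else 0)))"

lemma normal_col:
  assumes M: "reach z M" "det (topmat M) \<noteq> 0" and j: "j < d"
  shows "F z (normal_col j z)" "i < d \<Longrightarrow> normal_col j z i = (if i = j then 1 else 0)"
    and "l < p \<Longrightarrow> normal_col j z l = (\<Sum>k<d. M $$ (l, k) * adj_mat (topmat M) $$ (k, j)) / det (topmat M)"
proof -
  define v where "v l = (\<Sum>k<d. M $$ (l, k) * adj_mat (topmat M) $$ (k, j)) / det (topmat M)" for l
  have "v l = (\<Sum>k<d. M $$ (l, k) * (adj_mat (topmat M) $$ (k, j) / det (topmat M)))" for l
    by (simp add: v_def sum_divide_distrib)
  then have Fv: "F z v" unfolding F_iff[OF M(1)]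
    by (intro exI[of _ "\<lambda>k. adj_mat (topmat M) $$ (k, j) / det (topmat M)"]) simp
  have v_top: "v i = (if i = j then 1 else 0)" if i: "i < d" for i
  proof -
    have "(\<Sum>k<d. M $$ (i, k) * adj_mat (topmat M) $$ (k, j)) = (topmat M * adj_mat (topmat M)) $$ (i, j)"
      using i by (subst index_mult_sum[OF topmat_carrier adj_mat(1)[OF topmat_carrier] i j]) (simp add: topmat_def)
    also have "\<dots> = (if i = j then det (topmat M) else 0)"
      using adj_mat(2)[OF topmat_carrier, of M] i j by simp
    finally show ?thesis using M(2) by (simp add: v_def)
  qed
  have nc: "F z (normal_col j z) \<and> (\<forall>i<d. normal_col j z i = (if i = j then 1 else 0))"
    unfolding normal_col_def by (rule someI[of _ v]) (use Fv v_top in blast)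
  then show "F z (normal_col j z)" "i < d \<Longrightarrow> normal_col j z i = (if i = j then 1 else 0)" by auto
  have "F z (\<lambda>l. normal_col j z l + v l * (- 1))" using nc Fv by (intro F_add F_scale) auto
  moreover have "good z" using M good_def by blast
  ultimately have "normal_col j z l + v l * (- 1) = 0" if "l < p" for l
    using F_top_zero[of z "\<lambda>l. normal_col j z l + v l * (- 1)" l] nc v_top that by simp
  then show "l < p \<Longrightarrow> normal_col j z l = (\<Sum>k<d. M $$ (l, k) * adj_mat (topmat M) $$ (k, j)) / det (topmat M)"
    by (simp add: v_def add_eq_0_iff)
qed

text \<open>A horizontal frame \<open>V\<close> of the system pulled back by \<open>\<phi>\<close>,
  tied to the base point by \<open>reach\<close>, together with its inverse \<open>W\<close>. The
  adjoint equation for \<open>W\<close> is kept because both the uniqueness of solutions and the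
  differentiation of membership in \<open>F\<close> rest on it.\<close>

definition flat_frame ::
  "(complex \<Rightarrow> complex) \<Rightarrow> (complex \<Rightarrow> complex) \<Rightarrow> complex set \<Rightarrow> (complex \<Rightarrow> complex mat) \<Rightarrow> (complex \<Rightarrow> complex mat) \<Rightarrow> bool" where
  "flat_frame \<phi> \<phi>' D V W \<longleftrightarrow> (\<forall>s. V s \<in> carrier_mat p p \<and> W s \<in> carrier_mat p p) \<and>
     (\<forall>s\<in>D. V s * W s = 1\<^sub>m p \<and> W s * V s = 1\<^sub>m p \<and> reach (\<phi> s) (V s)) \<and>
     (\<forall>s\<in>D. \<forall>i<p. \<forall>j<p.
        ((\<lambda>s. V s $$ (i, j)) has_field_derivative (\<Sum>l<p. A (\<phi> s) $$ (i, l) * \<phi>' s * V s $$ (l, j))) (at s) \<and>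
        ((\<lambda>s. W s $$ (i, j)) has_field_derivative - (\<Sum>l<p. W s $$ (i, l) * (A (\<phi> s) $$ (l, j) * \<phi>' s))) (at s))"

text \<open>What matters is that \<open>K\<close> bounds the coefficients in the chart, that is,
  including the factor \<open>\<phi>'\<close>: this gives moderate growth of \<open>V\<close> on all
  of \<open>D\<close>.\<close>

lemma flat_frame_exists:
  assumes D: "convex D" "open D" "s1 \<in> D"
    and \<phi>: "\<And>s. s \<in> D \<Longrightarrow> (\<phi> has_field_derivative \<phi>' s) (at s)" "\<And>s. s \<in> D \<Longrightarrow> \<phi> s \<notin> sing"
    and \<phi>': "\<phi>' holomorphic_on D"
    and bound: "\<And>s i j. s \<in> D \<Longrightarrow> i < p \<Longrightarrow> j < p \<Longrightarrow> norm (A (\<phi> s) $$ (i, j) * \<phi>' s) \<le> K"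
    and M: "reach (\<phi> s1) M"
  obtains V W where "flat_frame \<phi> \<phi>' D V W" "V s1 = M"
    "\<And>i j. i < p \<Longrightarrow> j < p \<Longrightarrow> tame_on D (\<lambda>s. V s $$ (i, j))"
proof -
  have \<phi>_hol: "\<phi> holomorphic_on D" using \<phi>(1) D(2) by (auto simp: holomorphic_on_open)
  have hol: "(\<lambda>s. A (\<phi> s) $$ (i, j) * \<phi>' s) holomorphic_on D" if "i < p" "j < p" for i j
  proof (intro holomorphic_on_mult \<phi>')
    have "((\<lambda>z. A z $$ (i, j)) \<circ> \<phi>) holomorphic_on D"
      using \<phi>(2) by (intro holomorphic_on_compose_gen[OF \<phi>_hol fuchs_coeff_holomorphic[OF that]]) auto
    then show "(\<lambda>s. A (\<phi> s) $$ (i, j)) holomorphic_on D" by (simp add: o_def)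
  qed
  obtain U Z where UZ: "\<And>z. U z \<in> carrier_mat p p" "\<And>z. Z z \<in> carrier_mat p p" "U s1 = 1\<^sub>m p"
    "\<And>z. z \<in> D \<Longrightarrow> Z z * U z = 1\<^sub>m p" "\<And>z. z \<in> D \<Longrightarrow> U z * Z z = 1\<^sub>m p"
    and dU: "\<And>z i j. z \<in> D \<Longrightarrow> i < p \<Longrightarrow> j < p \<Longrightarrow>
           ((\<lambda>z. U z $$ (i, j)) has_field_derivative (\<Sum>l<p. A (\<phi> z) $$ (i, l) * \<phi>' z * U z $$ (l, j))) (at z)"
    and dZ: "\<And>z i j. z \<in> D \<Longrightarrow> i < p \<Longrightarrow> j < p \<Longrightarrow>
           ((\<lambda>z. Z z $$ (i, j)) has_field_derivative - (\<Sum>l<p. Z z $$ (i, l) * (A (\<phi> z) $$ (l, j) * \<phi>' z))) (at z)"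
    and bU: "\<And>z i j. z \<in> D \<Longrightarrow> i < p \<Longrightarrow> j < p \<Longrightarrow> norm (U z $$ (i, j)) \<le> exp (p * K * norm (z - s1))"
    by (rule fundamental_matrix_exists[OF D, where A = "\<lambda>s i j. A (\<phi> s) $$ (i, j) * \<phi>' s" and p = p and K = K])
      (use hol bound that in blast)+
  obtain N where N: "N * M = 1\<^sub>m p" "M * N = 1\<^sub>m p" and Nc: "N \<in> carrier_mat p p"
    using M transports_carrier by (auto simp: reach_def)
  have Mc: "M \<in> carrier_mat p p" using reach_carrier[OF M] .
  define V where "V s = U s * M" for s
  define W where "W s = N * Z s" for s
  have V_entry: "V s $$ (i, j) = (\<Sum>m<p. U s $$ (i, m) * M $$ (m, j))" if "i < p" "j < p" for s i j
    unfolding V_def using index_mult_sum[OF UZ(1) Mc that] .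
  have W_entry: "W s $$ (i, j) = (\<Sum>m<p. N $$ (i, m) * Z s $$ (m, j))" if "i < p" "j < p" for s i j
    unfolding W_def using index_mult_sum[OF Nc UZ(2) that] .
  have Z1: "Z s1 = 1\<^sub>m p" using UZ(4)[OF D(3)] UZ(2)[of s1] UZ(3) by simp
  have reach_V: "reach (\<phi> s) (V s)" if s: "s \<in> D" for s
  proof -
    note tr = transports_chart[OF D(1,2), of \<phi> \<phi>' sing U p Z A, OF \<phi> UZ(1,2,5) dU]
    \<comment> \<open>Both directions are needed, since \<open>reach\<close> asks for the inverse
      transport as well.\<close>
    have "conn (\<phi> s1) (\<phi> s) (U s * Z s1)" "conn (\<phi> s) (\<phi> s1) (U s1 * Z s)"
      using tr D(3) s by auto
    then have "conn (\<phi> s1) (\<phi> s) (U s)" "conn (\<phi> s) (\<phi> s1) (Z s)"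
      using UZ(1,2)[of s] by (simp_all add: Z1 UZ(3))
    from reach_step[OF M this] show ?thesis using UZ(4,5)[OF s] by (simp add: V_def)
  qed
  have VW: "V s * W s = 1\<^sub>m p" "W s * V s = 1\<^sub>m p" if s: "s \<in> D" for s
  proof -
    have "V s * W s = U s * ((M * N) * Z s)"
      unfolding V_def W_def using Mc Nc UZ(1,2)[of s] by (simp add: assoc_mult_mat[of _ p p _ p _ p])
    then show "V s * W s = 1\<^sub>m p" using N UZ(2)[of s] UZ(5)[OF s] by simp
    have "W s * V s = N * ((Z s * U s) * M)"
      unfolding V_def W_def using Mc Nc UZ(1,2)[of s] by (simp add: assoc_mult_mat[of _ p p _ p _ p])
    then show "W s * V s = 1\<^sub>m p" using N UZ(4)[OF s] Mc by simp
  qed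
  have dV: "((\<lambda>s. V s $$ (i, j)) has_field_derivative (\<Sum>l<p. A (\<phi> s) $$ (i, l) * \<phi>' s * V s $$ (l, j))) (at s)"
    if "s \<in> D" "i < p" "j < p" for s i j
  proof -
    have "((\<lambda>s. \<Sum>m<p. U s $$ (i, m) * M $$ (m, j)) has_field_derivative
       (\<Sum>m<p. (\<Sum>l<p. A (\<phi> s) $$ (i, l) * \<phi>' s * U s $$ (l, m)) * M $$ (m, j))) (at s)"
      using dU[OF that(1,2)] by (intro DERIV_sum DERIV_cmult_right) auto
    also have "(\<Sum>m<p. (\<Sum>l<p. A (\<phi> s) $$ (i, l) * \<phi>' s * U s $$ (l, m)) * M $$ (m, j))
       = (\<Sum>l<p. A (\<phi> s) $$ (i, l) * \<phi>' s * V s $$ (l, j))"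
      using that(3) by (simp add: V_entry sum_distrib_left sum_distrib_right mult.assoc) (rule sum.swap)
    finally show ?thesis using that by (simp add: V_entry)
  qed
  have dW: "((\<lambda>s. W s $$ (i, j)) has_field_derivative - (\<Sum>l<p. W s $$ (i, l) * (A (\<phi> s) $$ (l, j) * \<phi>' s))) (at s)"
    if "s \<in> D" "i < p" "j < p" for s i j
  proof -
    have "((\<lambda>s. \<Sum>m<p. N $$ (i, m) * Z s $$ (m, j)) has_field_derivative
       (\<Sum>m<p. N $$ (i, m) * - (\<Sum>l<p. Z s $$ (m, l) * (A (\<phi> s) $$ (l, j) * \<phi>' s)))) (at s)"
      using dZ[OF that(1) _ that(3)] by (intro DERIV_sum DERIV_cmult) auto
    also have "(\<Sum>m<p. N $$ (i, m) * - (\<Sum>l<p. Z s $$ (m, l) * (A (\<phi> s) $$ (l, j) * \<phi>' s)))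
       = - (\<Sum>m<p. \<Sum>l<p. N $$ (i, m) * Z s $$ (m, l) * (A (\<phi> s) $$ (l, j) * \<phi>' s))"
      by (simp add: sum_distrib_left sum_negf mult.assoc)
    also have "(\<Sum>m<p. \<Sum>l<p. N $$ (i, m) * Z s $$ (m, l) * (A (\<phi> s) $$ (l, j) * \<phi>' s))
       = (\<Sum>l<p. W s $$ (i, l) * (A (\<phi> s) $$ (l, j) * \<phi>' s))"
      using that(2) by (subst sum.swap) (simp add: W_entry sum_distrib_right)
    finally show ?thesis using that by (simp add: W_entry)
  qed
  have "tame_on D (\<lambda>s. V s $$ (i, j))" if ij: "i < p" "j < p" for i j
  proof -
    have K: "0 \<le> K" using order_trans[OF norm_ge_zero bound[OF D(3) ij]] .
    have "tame_on D (\<lambda>s. U s $$ (i, m))" if "m < p" for m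
      unfolding tame_on_def
    proof
      show "(\<lambda>s. U s $$ (i, m)) holomorphic_on D"
        using dU[OF _ ij(1) that] D(2) by (auto simp: holomorphic_on_open)
      show "moderate_on D (\<lambda>s. U s $$ (i, m))"
        by (rule moderate_onI[of _ _ 1 "p * K" s1]) (use bU ij that K in auto)
    qed
    then show ?thesis unfolding V_entry[OF ij] by (intro tame_on_sum tame_on_mult tame_on_const) auto
  qed
  moreover have "V s1 = M" using UZ(3) Mc by (simp add: V_def)
  moreover have "flat_frame \<phi> \<phi>' D V W"
  proof -
    have "V s \<in> carrier_mat p p" "W s \<in> carrier_mat p p" for s
      unfolding V_def W_def by (rule mult_carrier_mat[OF UZ(1) Mc], rule mult_carrier_mat[OF Nc UZ(2)])
    then show ?thesis unfolding flat_frame_def using VW reach_V dV dW by blast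
  qed
  ultimately show ?thesis using that by blast
qed

text \<open>The product of \<open>W\<close> with any solution has derivative zero, so two solutions
  differ by a constant factor on the right.\<close>

lemma flat_frame_unique:
  assumes VW: "flat_frame \<phi> \<phi>' D V W" and D: "convex D" "s1 \<in> D" "s \<in> D"
    and V2: "\<And>s. V2 s \<in> carrier_mat p p"
    and dV2: "\<And>s i j. s \<in> D \<Longrightarrow> i < p \<Longrightarrow> j < p \<Longrightarrow>
      ((\<lambda>s. V2 s $$ (i, j)) has_field_derivative (\<Sum>l<p. A (\<phi> s) $$ (i, l) * \<phi>' s * V2 s $$ (l, j))) (at s)"
  shows "V2 s = V s * (W s1 * V2 s1)"
proof -
  have c: "V s \<in> carrier_mat p p" "W s \<in> carrier_mat p p" for s using VW by (auto simp: flat_frame_def)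
  have dW: "((\<lambda>s. W s $$ (i, j)) has_field_derivative - (\<Sum>l<p. W s $$ (i, l) * (A (\<phi> s) $$ (l, j) * \<phi>' s))) (at s)"
    if "s \<in> D" "i < p" "j < p" for s i j
    using VW that unfolding flat_frame_def by blast
  have "W s * V2 s = W s1 * V2 s1"
  proof (rule eq_matI)
    fix i j assume "i < dim_row (W s1 * V2 s1)" "j < dim_col (W s1 * V2 s1)"
    then have ij: "i < p" "j < p" using c(2)[of s1] V2[of s1] by auto
    have "((\<lambda>s. \<Sum>l<p. W s $$ (i, l) * V2 s $$ (l, j)) has_field_derivative 0) (at s)" if s: "s \<in> D" for s
    proof -
      let ?c = "\<lambda>l m. A (\<phi> s) $$ (l, m) * \<phi>' s"
      have "((\<lambda>s. \<Sum>l<p. W s $$ (i, l) * V2 s $$ (l, j)) has_field_derivative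
         (\<Sum>l<p. (- (\<Sum>m<p. W s $$ (i, m) * ?c m l)) * V2 s $$ (l, j) + (\<Sum>m<p. ?c l m * V2 s $$ (m, j)) * W s $$ (i, l))) (at s)"
        using dW[OF s ij(1)] dV2[OF s _ ij(2)] by (intro DERIV_sum DERIV_mult) auto
      also have "(\<Sum>l<p. (- (\<Sum>m<p. W s $$ (i, m) * ?c m l)) * V2 s $$ (l, j) + (\<Sum>m<p. ?c l m * V2 s $$ (m, j)) * W s $$ (i, l))
         = - (\<Sum>l<p. \<Sum>m<p. W s $$ (i, m) * ?c m l * V2 s $$ (l, j)) + (\<Sum>l<p. \<Sum>m<p. W s $$ (i, l) * ?c l m * V2 s $$ (m, j))"
        by (simp add: sum.distrib sum_subtractf sum_distrib_left sum_distrib_right sum_negf mult_ac)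
      also have "(\<Sum>l<p. \<Sum>m<p. W s $$ (i, l) * ?c l m * V2 s $$ (m, j)) = (\<Sum>l<p. \<Sum>m<p. W s $$ (i, m) * ?c m l * V2 s $$ (l, j))"
        by (rule sum.swap)
      finally show ?thesis by simp
    qed
    then have "\<exists>k. \<forall>s\<in>D. (\<Sum>l<p. W s $$ (i, l) * V2 s $$ (l, j)) = k"
      using has_field_derivative_zero_constant[OF D(1)] by (blast intro: has_field_derivative_at_within)
    then show "(W s * V2 s) $$ (i, j) = (W s1 * V2 s1) $$ (i, j)"
      unfolding index_mult_sum[OF c(2) V2 ij] using D(2,3) by metis
  qed (use c(2) V2 in \<open>simp_all add: carrier_matD[OF c(2)] carrier_matD[OF V2]\<close>)
  moreover have "V s * (W s * V2 s) = V2 s"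
    using VW D(3) c[of s] V2[of s] by (simp add: flat_frame_def flip: assoc_mult_mat[of _ p p _ p _ p])
  ultimately show ?thesis by simp
qed

section \<open>Local frames and density of good points\<close>

definition Bnorm :: real where
  "Bnorm = (\<Sum>i<n. \<Sum>j<p. \<Sum>l<p. norm (B i $$ (j, l)))"

text \<open>Here \<open>s\<close> stands for the derivative of a chart. Since the poles are simple,
  only the ratios of \<open>s\<close> to the distances \<open>z - a i\<close> have to be bounded,
  and these stay bounded in logarithmic coordinates.\<close>

lemma coeff_bound:
  assumes "j < p" "l < p" "0 \<le> K" "\<And>i. i < n \<Longrightarrow> norm (s / (z - a i)) \<le> K"
  shows "norm (A z $$ (j, l) * s) \<le> Bnorm * K"
proof -
  have "norm (A z $$ (j, l) * s) = norm (\<Sum>i<n. B i $$ (j, l) * (s / (z - a i)))"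
    using assms(1,2) by (simp add: fuchs_coeff_index sum_distrib_right)
  also have "\<dots> \<le> (\<Sum>i<n. norm (B i $$ (j, l)) * K)"
    unfolding norm_mult using assms(4) by (intro sum_norm_le) (simp only: norm_mult, intro mult_left_mono, auto)
  also have "\<dots> = (\<Sum>i<n. norm (B i $$ (j, l))) * K" by (simp add: sum_distrib_right)
  also have "(\<Sum>i<n. norm (B i $$ (j, l))) \<le> Bnorm"
    unfolding Bnorm_def
  proof (intro sum_mono)
    fix i
    have "norm (B i $$ (j, l)) \<le> (\<Sum>l<p. norm (B i $$ (j, l)))"
      using assms(2) by (intro member_le_sum) auto
    also have "\<dots> \<le> (\<Sum>j<p. \<Sum>l<p. norm (B i $$ (j, l)))"
      using assms(1) by (intro member_le_sum[of j _ "\<lambda>j. \<Sum>l<p. norm (B i $$ (j, l))"]) (auto intro: sum_nonneg)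
    finally show "norm (B i $$ (j, l)) \<le> (\<Sum>j<p. \<Sum>l<p. norm (B i $$ (j, l)))" .
  qed
  finally show ?thesis using assms(3) by (simp add: mult_right_mono)
qed

lemma disc_frame:
  assumes z: "z \<notin> sing"
  obtains r where "0 < r" "ball z r \<inter> sing = {}"
    and "\<And>w M. w \<in> ball z r \<Longrightarrow> reach w M \<Longrightarrow> \<exists>V W. flat_frame (\<lambda>w. w) (\<lambda>w. 1) (ball z r) V W \<and>
      (\<forall>i<p. \<forall>j<p. tame_on (ball z r) (\<lambda>s. V s $$ (i, j)))"
proof -
  obtain \<delta> where \<delta>: "0 < \<delta>" "\<And>s. s \<in> sing \<Longrightarrow> s \<noteq> z \<Longrightarrow> \<delta> \<le> dist z s"
    using finite_set_avoid[of sing z] by auto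
  \<comment> \<open>Half the distance suffices to keep every point of the disc at distance at least
    \<open>r\<close> from all singular points.\<close>
  define r where "r = \<delta> / 2"
  have far: "r \<le> norm (w - a i)" if "w \<in> ball z r" "i < n" for w i
  proof -
    have "\<delta> \<le> dist z (a i)" using \<delta>(2)[of "a i"] that z by auto
    then show ?thesis using that(1) dist_triangle[of z "a i" w] by (simp add: r_def dist_norm norm_minus_commute)
  qed
  have r: "0 < r" using \<delta>(1) by (simp add: r_def)
  show ?thesis
  proof (rule that[OF r])
    show disj: "ball z r \<inter> sing = {}" using far r by fastforce
    fix w M assume w: "w \<in> ball z r" and M: "reach w M"
    have bound: "norm (A s $$ (i, j) * 1) \<le> Bnorm * (1 / r)" if "s \<in> ball z r" "i < p" "j < p" for s i j
    proof (rule coeff_bound[OF that(2,3)])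
      show "norm (1 / (s - a k)) \<le> 1 / r" if "k < n" for k
        using far[OF \<open>s \<in> ball z r\<close> that] r by (simp add: norm_divide frac_le)
    qed (use r in auto)
    obtain V W where "flat_frame (\<lambda>w. w) (\<lambda>w. 1) (ball z r) V W" "V w = M"
      "\<And>i j. i < p \<Longrightarrow> j < p \<Longrightarrow> tame_on (ball z r) (\<lambda>s. V s $$ (i, j))"
      by (rule flat_frame_exists[of "ball z r" w "\<lambda>w. w" "\<lambda>w. 1" "Bnorm * (1 / r)" M])
        (use w M disj bound in auto)
    then show "\<exists>V W. flat_frame (\<lambda>w. w) (\<lambda>w. 1) (ball z r) V W \<and>
      (\<forall>i<p. \<forall>j<p. tame_on (ball z r) (\<lambda>s. V s $$ (i, j)))" by blast
  qed
qed

lemma reach_not_sing: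
  assumes "reach z M"
  shows "z \<notin> sing"
proof -
  obtain \<gamma> where "pathfinish \<gamma> = z" "path_image \<gamma> \<subseteq> - sing"
    using assms unfolding reach_def transports_def by blast
  then show ?thesis using pathfinish_in_path_image[of \<gamma>] by auto
qed

lemma good_not_sing: "good z \<Longrightarrow> z \<notin> sing"
  using reach_not_sing by (auto simp: good_def)

lemma disc_frame_at:
  assumes "reach z M"
  obtains r V W where "0 < r" "flat_frame (\<lambda>w. w) (\<lambda>w. 1) (ball z r) V W"
    "\<And>i j. i < p \<Longrightarrow> j < p \<Longrightarrow> tame_on (ball z r) (\<lambda>s. V s $$ (i, j))"
proof (rule disc_frame[OF reach_not_sing[OF assms]])
  fix r assume r: "0 < r" "ball z r \<inter> sing = {}"
    "\<And>w M. w \<in> ball z r \<Longrightarrow> reach w M \<Longrightarrow> \<exists>V W. flat_frame (\<lambda>w. w) (\<lambda>w. 1) (ball z r) V W \<and>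
      (\<forall>i<p. \<forall>j<p. tame_on (ball z r) (\<lambda>s. V s $$ (i, j)))"
  show thesis using r(3)[OF _ assms] r(1) that by auto
qed

lemma tame_det_topmat:
  assumes "\<And>i j. i < p \<Longrightarrow> j < p \<Longrightarrow> tame_on D (\<lambda>s. V s $$ (i, j))"
  shows "tame_on D (\<lambda>s. det (topmat (V s)))"
  unfolding topmat_def using assms dp by (intro tame_on_det) auto

lemma tame_normal_num:
  assumes "\<And>i j. i < p \<Longrightarrow> j < p \<Longrightarrow> tame_on D (\<lambda>s. V s $$ (i, j))" "l < p" "j < d"
  shows "tame_on D (\<lambda>s. \<Sum>k<d. V s $$ (l, k) * adj_mat (topmat (V s)) $$ (k, j))"
  unfolding topmat_def using assms dp by (intro tame_on_sum tame_on_mult tame_on_adj_mat) auto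

lemma flat_frame_reach: "flat_frame \<phi> \<phi>' D V W \<Longrightarrow> s \<in> D \<Longrightarrow> reach (\<phi> s) (V s)"
  unfolding flat_frame_def by blast

text \<open>Both claims propagate together through the connected complement of the singular points:
  a frame on a small disc requires a transport to one of its points, and the identity theorem for
  the top minor requires one good point in the disc. They start at \<open>z0\<close>, where the top
  block is the identity.\<close>

lemma reach_and_good_dense:
  assumes z: "z \<notin> sing"
  shows "(\<exists>M. reach z M) \<and> (\<forall>\<epsilon>>0. \<exists>w\<in>ball z \<epsilon>. good w)"
proof (rule connected_propagation[of "- sing" z0 _ z])
  show "connected (- sing)"
    using connected_open_delete_finite[of "UNIV :: complex set" sing] by (simp add: Compl_eq_Diff_UNIV connected_UNIV)
  show "open (- sing)" by (intro open_Compl finite_imp_closed) auto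
  have "topmat (1\<^sub>m p) = 1\<^sub>m d" using dp by (intro eq_matI) (auto simp: topmat_def)
  then have "good z0" using good_iff[OF reach_base] by simp
  then show "(\<exists>M. reach z0 M) \<and> (\<forall>\<epsilon>>0. \<exists>w\<in>ball z0 \<epsilon>. good w)"
    using reach_base by (auto intro: bexI[of _ z0])
  fix y assume "y \<in> - sing"
  then have "y \<notin> sing" by simp
  obtain r where r: "0 < r" "\<And>w M. w \<in> ball y r \<Longrightarrow> reach w M \<Longrightarrow> \<exists>V W. flat_frame (\<lambda>w. w) (\<lambda>w. 1) (ball y r) V W \<and>
      (\<forall>i<p. \<forall>j<p. tame_on (ball y r) (\<lambda>s. V s $$ (i, j)))"
    by (rule disc_frame[OF \<open>y \<notin> sing\<close>]) blast
  have "(\<exists>M. reach w' M) \<and> (\<forall>\<epsilon>>0. \<exists>s\<in>ball w' \<epsilon>. good s)"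
    if w: "w \<in> ball y r" "w' \<in> ball y r" and M: "reach w M" and dense: "\<forall>\<epsilon>>0. \<exists>s\<in>ball w \<epsilon>. good s" for w w' M
  proof
    obtain V W where V: "flat_frame (\<lambda>w. w) (\<lambda>w. 1) (ball y r) V W"
      "\<And>i j. i < p \<Longrightarrow> j < p \<Longrightarrow> tame_on (ball y r) (\<lambda>s. V s $$ (i, j))"
      using r(2)[OF w(1) M] by auto
    note reach_V = flat_frame_reach[OF V(1)]
    show "\<exists>M. reach w' M" using reach_V[OF w(2)] by blast
    show "\<forall>\<epsilon>>0. \<exists>s\<in>ball w' \<epsilon>. good s"
    proof (intro allI impI, rule ccontr)
      fix \<epsilon> :: real assume \<epsilon>: "0 < \<epsilon>" and no: "\<not> (\<exists>s\<in>ball w' \<epsilon>. good s)"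
      have E: "(\<lambda>s. det (topmat (V s))) holomorphic_on ball y r"
        using tame_det_topmat[OF V(2)] by (simp add: tame_on_def)
      obtain \<epsilon>1 where "0 < \<epsilon>1" "ball w \<epsilon>1 \<subseteq> ball y r" using w(1) open_ball open_contains_ball by metis
      then obtain s where s: "s \<in> ball y r" "good s" using dense by blast
      \<comment> \<open>Without good points near \<open>w'\<close> the top minor vanishes on an open
        set, hence on the whole disc, in contradiction to the good point \<open>s\<close>.\<close>
      have "det (topmat (V s)) = 0"
      proof (rule analytic_continuation_open[of "ball w' \<epsilon> \<inter> ball y r" "ball y r" "\<lambda>s. det (topmat (V s))" "\<lambda>s. 0"])
        show "ball w' \<epsilon> \<inter> ball y r \<noteq> {}" using w(2) \<epsilon> centre_in_ball[of w' \<epsilon>] by blast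
        show "det (topmat (V t)) = 0" if "t \<in> ball w' \<epsilon> \<inter> ball y r" for t
          using good_iff[OF reach_V, of t] no that by auto
      qed (use E s in auto)
      then show False using good_iff[OF reach_V[OF s(1)]] s(2) by simp
    qed
  qed
  then show "\<exists>r>0. \<forall>w\<in>ball y r. \<forall>w'\<in>ball y r. (\<exists>M. reach w M) \<and> (\<forall>\<epsilon>>0. \<exists>s\<in>ball w \<epsilon>. good s) \<longrightarrow>
      (\<exists>M. reach w' M) \<and> (\<forall>\<epsilon>>0. \<exists>s\<in>ball w' \<epsilon>. good s)"
    using r(1) by blast
qed (use z z0 in auto)

lemma good_in_open:
  assumes "open X" "x \<in> X" "x \<notin> sing"
  obtains w where "w \<in> X" "good w"
proof -
  obtain \<epsilon> where "0 < \<epsilon>" "ball x \<epsilon> \<subseteq> X" using assms(1,2) open_contains_ball by blast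
  then show ?thesis using reach_and_good_dense[OF assms(3)] that by blast
qed

text \<open>In the coordinate \<open>s = ln u\<close> the punctured disc becomes a half plane on which the system has
  bounded coefficients. All top minors pick up the same scalar under \<open>s \<mapsto> s + 2\<pi>i\<close>, so a single
  power of \<open>u\<close> makes them single-valued; no normal form of the system is needed.\<close>
lemma puncture_growth:
  assumes r: "0 < r"
    and \<psi>: "\<And>u. u \<in> ball 0 r - {0} \<Longrightarrow> (\<psi> has_field_derivative \<psi>' u) (at u)" "\<And>u. u \<in> ball 0 r - {0} \<Longrightarrow> \<psi> u \<notin> sing"
    and \<psi>': "\<psi>' holomorphic_on ball 0 r - {0}"
    and bound: "\<And>u i j. u \<in> ball 0 r - {0} \<Longrightarrow> i < p \<Longrightarrow> j < p \<Longrightarrow> norm (A (\<psi> u) $$ (i, j) * (\<psi>' u * u)) \<le> K"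
    and u1: "u1 \<in> ball 0 r - {0}" "good (\<psi> u1)"
  obtains \<rho> where "0 < \<rho>" "\<rho> \<le> r" "\<And>u. u \<in> ball 0 \<rho> - {0} \<Longrightarrow> good (\<psi> u)"
    and "\<And>l j. l < p \<Longrightarrow> j < d \<Longrightarrow> \<exists>C k. \<forall>u\<in>ball 0 \<rho> - {0}. norm (normal_col j (\<psi> u) l) \<le> C / norm u ^ (k :: nat)"
proof -
  define D where "D = log_halfplane r"
  have D: "convex D" "open D" by (simp_all add: D_def log_halfplane_props)
  have exp_in: "exp s \<in> ball 0 r - {0}" if "s \<in> D" for s using exp_log_halfplane[OF r] that by (simp add: D_def)
  define \<phi> where "\<phi> s = \<psi> (exp s)" for s
  define \<phi>' where "\<phi>' s = \<psi>' (exp s) * exp s" for s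
  define s1 where "s1 = Ln u1"
  have s1: "s1 \<in> D" "exp s1 = u1" using u1 Ln_log_halfplane[of u1 r] by (auto simp: s1_def D_def)
  have d\<phi>: "(\<phi> has_field_derivative \<phi>' s) (at s)" if "s \<in> D" for s
    unfolding \<phi>_def \<phi>'_def by (rule DERIV_chain2[OF \<psi>(1)[OF exp_in[OF that]] DERIV_exp])
  have \<phi>_sing: "\<phi> s \<notin> sing" if "s \<in> D" for s unfolding \<phi>_def by (rule \<psi>(2)[OF exp_in[OF that]])
  have "(\<psi>' \<circ> exp) holomorphic_on D"
    using exp_in by (intro holomorphic_on_compose_gen[OF _ \<psi>'] holomorphic_on_exp) auto
  then have \<phi>'_hol: "\<phi>' holomorphic_on D" unfolding \<phi>'_def by (intro holomorphic_intros) (simp add: o_def)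
  have b: "norm (A (\<phi> s) $$ (i, j) * \<phi>' s) \<le> K" if "s \<in> D" "i < p" "j < p" for s i j
    unfolding \<phi>_def \<phi>'_def by (rule bound[OF exp_in[OF that(1)] that(2,3)])
  obtain M where "reach (\<phi> s1) M" using u1(2) s1(2) by (auto simp: good_def \<phi>_def)
  then obtain V W where VW: "flat_frame \<phi> \<phi>' D V W" "V s1 = M"
    and tame: "\<And>i j. i < p \<Longrightarrow> j < p \<Longrightarrow> tame_on D (\<lambda>s. V s $$ (i, j))"
    using flat_frame_exists[OF D s1(1), of \<phi> \<phi>' K M] d\<phi> \<phi>_sing \<phi>'_hol b by blast
  note reach_V = flat_frame_reach[OF VW(1)]
  have Vc: "V s \<in> carrier_mat p p" "W s \<in> carrier_mat p p" for s using VW(1) by (auto simp: flat_frame_def)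
  define E where "E s = det (topmat (V s))" for s
  have E_tame: "tame_on D E" unfolding E_def by (rule tame_det_topmat[OF tame])
  define \<tau> where "\<tau> = complex_of_real (2 * pi) * \<i>"
  have \<tau>_in: "s + \<tau> \<in> D" if "s \<in> D" for s using that by (simp add: D_def log_halfplane_def \<tau>_def)
  have exp_\<tau>: "exp (s + \<tau>) = exp s" for s by (simp add: exp_add \<tau>_def)
  have \<phi>_\<tau>: "\<phi> (s + \<tau>) = \<phi> s" "\<phi>' (s + \<tau>) = \<phi>' s" for s by (simp_all add: \<phi>_def \<phi>'_def exp_\<tau>)
  define G where "G = W s1 * V (s1 + \<tau>)"
  have Gc: "G \<in> carrier_mat p p" unfolding G_def by (rule mult_carrier_mat[OF Vc(2) Vc(1)])
  \<comment> \<open>The pulled-back system is invariant under the translation by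
    \<open>\<tau>\<close>, so the translated frame is again a solution; \<open>G\<close> is the
    local monodromy in this frame.\<close>
  have V_\<tau>: "V (s + \<tau>) = V s * G" if "s \<in> D" for s
    unfolding G_def
  proof (rule flat_frame_unique[OF VW(1) D(1) s1(1) that, of "\<lambda>s. V (s + \<tau>)"])
    show "V (s + \<tau>) \<in> carrier_mat p p" for s by (rule Vc)
    fix s i j assume *: "s \<in> D" "i < p" "j < p"
    have "((\<lambda>s. V s $$ (i, j)) has_field_derivative
       (\<Sum>l<p. A (\<phi> (s + \<tau>)) $$ (i, l) * \<phi>' (s + \<tau>) * V (s + \<tau>) $$ (l, j))) (at (s + \<tau>))"
      using VW(1) \<tau>_in[OF *(1)] *(2,3) unfolding flat_frame_def by blast
    then show "((\<lambda>s. V (s + \<tau>) $$ (i, j)) has_field_derivative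
       (\<Sum>l<p. A (\<phi> s) $$ (i, l) * \<phi>' s * V (s + \<tau>) $$ (l, j))) (at s)"
      by (simp add: \<phi>_\<tau> DERIV_shift)
  qed
  \<comment> \<open>\<open>V (s1 + \<tau>)\<close> and \<open>V s1\<close> are transports to the
    same point of the plane, so path independence gives the zero corner.\<close>
  have G_low: "G $$ (j, l) = 0" if "d \<le> j" "j < p" "l < d" for j l
  proof -
    have "reach (\<phi> s1) (V (s1 + \<tau>))" using reach_V[OF \<tau>_in[OF s1(1)]] by (simp add: \<phi>_\<tau>)
    then obtain G' where G': "G' \<in> carrier_mat p p" "V (s1 + \<tau>) = V s1 * G'"
      "\<And>j l. d \<le> j \<Longrightarrow> j < p \<Longrightarrow> l < d \<Longrightarrow> G' $$ (j, l) = 0"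
      using reach_unique[OF _ reach_V[OF s1(1)]] by blast
    have "W s1 * V s1 = 1\<^sub>m p" using VW(1) s1(1) by (auto simp: flat_frame_def)
    then have "G = G'" unfolding G_def G'(2)
      using Vc[of s1] G'(1) by (simp flip: assoc_mult_mat[of _ p p _ p _ p])
    then show ?thesis using G'(3) that by simp
  qed
  define \<kappa> where "\<kappa> = det (topmat G)"
  have E_\<tau>: "E (s + \<tau>) = E s * \<kappa>" if "s \<in> D" for s
    unfolding E_def \<kappa>_def V_\<tau>[OF that] by (rule det_topmat_mult[OF Vc(1) Gc G_low])
  have good_E: "good (\<phi> s) \<longleftrightarrow> E s \<noteq> 0" if "s \<in> D" for s
    unfolding E_def by (rule good_iff[OF reach_V[OF that]])
  have E1: "E s1 \<noteq> 0" using good_E[OF s1(1)] u1(2) s1(2) by (simp add: \<phi>_def)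
  then have "E (s1 + \<tau>) \<noteq> 0" using good_E[OF \<tau>_in[OF s1(1)]] good_E[OF s1(1)] by (simp add: \<phi>_\<tau>)
  then have \<kappa>: "\<kappa> \<noteq> 0" using E_\<tau>[OF s1(1)] by auto
  \<comment> \<open>Chosen so that \<open>exp (\<mu> * \<tau>)\<close> is the inverse of the
    multiplier \<open>\<kappa>\<close> of the top minor.\<close>
  define \<mu> where "\<mu> = - (Ln \<kappa> / \<tau>)"
  have "\<tau> \<noteq> 0" by (simp add: \<tau>_def)
  define h where "h s = E s * exp (\<mu> * s)" for s
  have h_per: "h (s + complex_of_real (2 * pi) * \<i>) = h s" if "s \<in> log_halfplane r" for s
  proof -
    have "exp (\<mu> * (s + \<tau>)) = exp (\<mu> * s) / \<kappa>"
    proof -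
      have "\<mu> * \<tau> = - Ln \<kappa>" using \<open>\<tau> \<noteq> 0\<close> by (simp add: \<mu>_def)
      then show ?thesis using \<kappa> by (simp add: distrib_left exp_diff)
    qed
    then have "h (s + \<tau>) = h s" using E_\<tau>[of s] that \<kappa> by (simp add: h_def D_def)
    then show ?thesis by (simp add: \<tau>_def)
  qed
  have exp_tame: "tame_on D (\<lambda>s. exp (\<mu> * s))"
    by (auto simp: tame_on_def moderate_on_exp intro!: holomorphic_intros)
  have "tame_on D h" unfolding h_def by (intro tame_on_mult E_tame exp_tame)
  then have h_tame: "h holomorphic_on log_halfplane r" "moderate_on (log_halfplane r) h"
    by (auto simp: tame_on_def D_def)
  have h1: "s1 \<in> log_halfplane r" "h s1 \<noteq> 0" using s1(1) E1 by (auto simp: D_def h_def)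
  obtain \<rho> c and m :: nat where \<rho>: "0 < \<rho>" "\<rho> \<le> r" "0 < c"
    and low: "\<And>u. u \<in> ball 0 \<rho> - {0} \<Longrightarrow> c * norm u ^ m \<le> norm (h (Ln u))"
    by (rule periodic_moderate_lower_bound[of r h s1]) (use h_per r h_tame h1 that in blast)+
  have Ln_in: "Ln u \<in> D" "\<phi> (Ln u) = \<psi> u" if "u \<in> ball 0 \<rho> - {0}" for u
  proof -
    have "u \<in> ball 0 r - {0}" using that \<rho>(2) by auto
    then show "Ln u \<in> D" "\<phi> (Ln u) = \<psi> u" using Ln_log_halfplane[of u r] by (auto simp: D_def \<phi>_def)
  qed
  have h_nz: "h (Ln u) \<noteq> 0" if "u \<in> ball 0 \<rho> - {0}" for u
  proof -
    have "0 < c * norm u ^ m" using that \<rho>(3) by simp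
    then show ?thesis using low[OF that] by auto
  qed
  then have E_nz: "E (Ln u) \<noteq> 0" if "u \<in> ball 0 \<rho> - {0}" for u using that by (auto simp: h_def)
  show ?thesis
  proof (rule that[OF \<rho>(1,2)])
    show "good (\<psi> u)" if "u \<in> ball 0 \<rho> - {0}" for u
      using good_E[OF Ln_in(1)[OF that]] E_nz[OF that] Ln_in(2)[OF that] by simp
    fix l j assume lj: "l < p" "j < d"
    \<comment> \<open>The numerator receives the same exponential factor as \<open>h\<close>, which
      leaves the quotient unchanged. An upper bound is enough for it; the lower bound concerns only
      \<open>h\<close>.\<close>
    define num where "num s = (\<Sum>k<d. V s $$ (l, k) * adj_mat (topmat (V s)) $$ (k, j)) * exp (\<mu> * s)" for s
    have "tame_on D num" unfolding num_def by (intro tame_on_mult exp_tame tame_normal_num[OF tame] lj)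
    then have "moderate_on (log_halfplane r) num" by (simp add: tame_on_def D_def)
    then obtain C and k :: nat where C: "0 < C" "\<And>u. u \<in> ball 0 r - {0} \<Longrightarrow> norm (num (Ln u)) \<le> C / norm u ^ k"
      using moderate_on_Ln_bound[OF r] by blast
    have "norm (normal_col j (\<psi> u) l) \<le> (C / c) / norm u ^ (k + m)" if u: "u \<in> ball 0 \<rho> - {0}" for u
    proof -
      have "normal_col j (\<psi> u) l
         = (\<Sum>k<d. V (Ln u) $$ (l, k) * adj_mat (topmat (V (Ln u))) $$ (k, j)) / E (Ln u)"
        using normal_col(3)[OF reach_V[OF Ln_in(1)[OF u]] _ lj(2,1)] E_nz[OF u] Ln_in(2)[OF u] by (simp add: E_def)
      also have "\<dots> = num (Ln u) / h (Ln u)" by (simp add: num_def h_def)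
      finally have "norm (normal_col j (\<psi> u) l) = norm (num (Ln u)) / norm (h (Ln u))" by (simp add: norm_divide)
      also have "\<dots> \<le> (C / norm u ^ k) / (c * norm u ^ m)"
        using C(2)[of u] low[OF u] u \<rho> C(1) by (intro frac_le) auto
      finally show ?thesis by (simp add: power_add field_simps)
    qed
    then show "\<exists>C k. \<forall>u\<in>ball 0 \<rho> - {0}. norm (normal_col j (\<psi> u) l) \<le> C / norm u ^ (k :: nat)" by blast
  qed
qed

text \<open>Regular and singular \<open>c\<close> are treated alike. In the coordinate ln(z - c) the
  coefficients involve the ratios u/(c + u - a_i): the ratio is 1 if a_i = c and of modulus at most
  1 otherwise, as |u| is below half the distance from \<open>c\<close> to a_i.\<close>

lemma good_near_point:
  obtains \<rho> where "0 < \<rho>" "\<And>z. z \<in> ball c \<rho> - {c} \<Longrightarrow> good z"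
    and "\<And>l j. l < p \<Longrightarrow> j < d \<Longrightarrow> \<exists>C k. \<forall>z\<in>ball c \<rho> - {c}. norm (normal_col j z l) \<le> C / norm (z - c) ^ (k :: nat)"
proof -
  obtain \<delta> where \<delta>: "0 < \<delta>" "\<And>s. s \<in> sing \<Longrightarrow> s \<noteq> c \<Longrightarrow> \<delta> \<le> dist c s"
    using finite_set_avoid[of sing c] by auto
  define r where "r = \<delta> / 2"
  have r: "0 < r" using \<delta>(1) by (simp add: r_def)
  have far: "norm u \<le> norm (c + u - a i)" if "u \<in> ball 0 r - {0}" "i < n" for u i
  proof (cases "a i = c")
    case False
    then have "\<delta> \<le> norm (c - a i)" using \<delta>(2)[of "a i"] that by (auto simp: dist_norm)
    then show ?thesis using that(1) norm_triangle_ineq4[of "c + u - a i" u] by (simp add: r_def algebra_simps)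
  qed simp
  have nsing: "c + u \<notin> sing" if "u \<in> ball 0 r - {0}" for u
  proof
    assume "c + u \<in> sing"
    then obtain i where "i < n" "c + u = a i" by auto
    then show False using far[OF that, of i] that by simp
  qed
  define X where "X = ball c r - {c}"
  have "c + of_real (r / 2) \<in> X" using r by (auto simp: X_def dist_norm)
  moreover have "c + of_real (r / 2) \<notin> sing" using r by (intro nsing) auto
  moreover have "open X" by (auto simp: X_def)
  ultimately obtain w where w: "w \<in> X" "good w" using good_in_open by blast
  have u1: "w - c \<in> ball 0 r - {0}" "good (c + (w - c))" using w by (auto simp: X_def dist_norm norm_minus_commute)
  have bound: "norm (A (c + u) $$ (i, j) * (1 * u)) \<le> Bnorm * 1" if u: "u \<in> ball 0 r - {0}" and ij: "i < p" "j < p" for u i j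
  proof (rule coeff_bound[OF ij])
    fix k assume k: "k < n"
    have "c + u - a k \<noteq> 0" using nsing[OF u] k by auto
    then show "norm (1 * u / (c + u - a k)) \<le> 1" using far[OF u k] by (simp add: norm_divide)
  qed simp
  have der: "((\<lambda>u. c + u) has_field_derivative 1) (at u)" for u
    by (auto intro!: derivative_eq_intros)
  obtain \<rho> where \<rho>: "0 < \<rho>" "\<And>u. u \<in> ball 0 \<rho> - {0} \<Longrightarrow> good (c + u)"
    "\<And>l j. l < p \<Longrightarrow> j < d \<Longrightarrow> \<exists>C k. \<forall>u\<in>ball 0 \<rho> - {0}. norm (normal_col j (c + u) l) \<le> C / norm u ^ (k :: nat)"
    by (rule puncture_growth[of r "\<lambda>u. c + u" "\<lambda>u. 1" "Bnorm * 1" "w - c", OF r der nsing _ bound u1]) (auto intro: that)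
  show ?thesis
  proof (rule that[OF \<rho>(1)])
    have shift: "z - c \<in> ball 0 \<rho> - {0}" if "z \<in> ball c \<rho> - {c}" for z
      using that by (auto simp: dist_norm norm_minus_commute)
    show "good z" if "z \<in> ball c \<rho> - {c}" for z using \<rho>(2)[OF shift[OF that]] by simp
    fix l j assume "l < p" "j < d"
    then obtain C and k :: nat where "\<And>u. u \<in> ball 0 \<rho> - {0} \<Longrightarrow> norm (normal_col j (c + u) l) \<le> C / norm u ^ k"
      using \<rho>(3) by blast
    then have "norm (normal_col j z l) \<le> C / norm (z - c) ^ k" if "z \<in> ball c \<rho> - {c}" for z
      using shift[OF that] by fastforce
    then show "\<exists>C k. \<forall>z\<in>ball c \<rho> - {c}. norm (normal_col j z l) \<le> C / norm (z - c) ^ (k :: nat)" by blast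
  qed
qed

text \<open>With the chart 1/u followed by the logarithm, the coefficients involve -1/(1 - a_i u),
  which is bounded by 2 as soon as |a_i u| \<le> 1/2.\<close>

lemma good_near_infinity:
  obtains R where "0 < R" "\<And>z. R < norm z \<Longrightarrow> good z"
    and "\<And>l j. l < p \<Longrightarrow> j < d \<Longrightarrow> \<exists>C k. \<forall>z. R < norm z \<longrightarrow> norm (normal_col j z l) \<le> C * norm z ^ (k :: nat)"
proof -
  \<comment> \<open>The added 1 keeps \<open>s\<close> positive when all \<open>a i\<close> are zero
    or \<open>n = 0\<close>, so that the radius 1/(2s) makes sense.\<close>
  define s where "s = (\<Sum>i<n. norm (a i)) + 1"
  have s: "norm (a i) \<le> s" if "i < n" for i
    using that member_le_sum[of i "{..<n}" "\<lambda>i. norm (a i)"] by (simp add: s_def)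
  have s1: "1 \<le> s" unfolding s_def by (simp add: sum_nonneg)
  define r where "r = 1 / (2 * s)"
  have r: "0 < r" using s1 by (simp add: r_def)
  have half: "1 / 2 \<le> norm (1 - a i * u)" if "u \<in> ball 0 r - {0}" "i < n" for u i
  proof -
    have "norm (a i * u) \<le> s * r" unfolding norm_mult using s[OF that(2)] that(1) s1 by (intro mult_mono) auto
    also have "s * r = 1 / 2" using s1 by (simp add: r_def)
    finally show ?thesis using norm_triangle_ineq2[of 1 "a i * u"] by simp
  qed
  have nsing: "1 / u \<notin> sing" if u: "u \<in> ball 0 r - {0}" for u
  proof
    assume "1 / u \<in> sing"
    then obtain i where i: "i < n" "1 / u = a i" by auto
    have "1 - a i * u = 0" using u unfolding i(2)[symmetric] by simp
    then show False using half[OF u i(1)] by simp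
  qed
  define X where "X = {z :: complex. 1 / r < norm z}"
  have X: "1 / z \<in> ball 0 r - {0}" if "z \<in> X" for z
  proof -
    have "0 < norm z" using that r by (auto simp: X_def intro: less_trans[of 0 "1 / r"])
    then show ?thesis using that r by (auto simp: X_def norm_divide field_simps)
  qed
  have zX: "of_real (2 / r) \<in> X" using r by (simp add: X_def norm_divide divide_strict_right_mono)
  have "of_real (2 / r) \<notin> sing" using nsing[OF X[OF zX]] by simp
  moreover have "open X" unfolding X_def by (intro open_Collect_less continuous_intros)
  ultimately obtain w where w: "w \<in> X" "good w" using good_in_open zX by blast
  have u1: "1 / w \<in> ball 0 r - {0}" "good (1 / (1 / w))" using X[OF w(1)] w(2) by auto
  have bound: "norm (A (1 / u) $$ (i, j) * ((- 1 / u\<^sup>2) * u)) \<le> Bnorm * 2"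
    if u: "u \<in> ball 0 r - {0}" and ij: "i < p" "j < p" for u i j
  proof (rule coeff_bound[OF ij])
    fix k assume k: "k < n"
    have "u \<noteq> 0" using u by simp
    moreover have "1 - a k * u \<noteq> 0" using half[OF u k] by auto
    ultimately have "(- 1 / u\<^sup>2) * u / (1 / u - a k) = - 1 / (1 - a k * u)"
      by (simp add: field_simps power2_eq_square)
    moreover have "1 / norm (1 - a k * u) \<le> 1 / (1 / 2)" using half[OF u k] by (intro divide_left_mono) auto
    ultimately show "norm ((- 1 / u\<^sup>2) * u / (1 / u - a k)) \<le> 2" by (simp only: norm_divide) simp
  qed simp
  have der: "((\<lambda>u. 1 / u) has_field_derivative (- 1 / u\<^sup>2)) (at u)" if "u \<in> ball 0 r - {0}" for u :: complex
    using that by (auto intro!: derivative_eq_intros simp: power2_eq_square)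
  have hol: "(\<lambda>u::complex. - 1 / u\<^sup>2) holomorphic_on ball 0 r - {0}" by (intro holomorphic_intros) auto
  obtain \<rho> where \<rho>: "0 < \<rho>" "\<And>u. u \<in> ball 0 \<rho> - {0} \<Longrightarrow> good (1 / u)"
    "\<And>l j. l < p \<Longrightarrow> j < d \<Longrightarrow> \<exists>C k. \<forall>u\<in>ball 0 \<rho> - {0}. norm (normal_col j (1 / u) l) \<le> C / norm u ^ (k :: nat)"
    by (rule puncture_growth[of r "\<lambda>u. 1 / u" "\<lambda>u. - 1 / u\<^sup>2" "Bnorm * 2" "1 / w", OF r der nsing hol bound u1]) (auto intro: that)
  have inv: "1 / z \<in> ball 0 \<rho> - {0}" if "1 / \<rho> < norm z" for z :: complex
  proof -
    have "0 < norm z" using that \<rho>(1) by (auto intro: less_trans[of 0 "1 / \<rho>"])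
    then show ?thesis using that \<rho>(1) by (auto simp: norm_divide field_simps)
  qed
  show ?thesis
  proof (rule that[of "1 / \<rho>"])
    show "0 < 1 / \<rho>" using \<rho>(1) by simp
    show "good z" if "1 / \<rho> < norm z" for z using \<rho>(2)[OF inv[OF that]] by simp
    fix l j assume "l < p" "j < d"
    then obtain C and k :: nat where C: "\<And>u. u \<in> ball 0 \<rho> - {0} \<Longrightarrow> norm (normal_col j (1 / u) l) \<le> C / norm u ^ k"
      using \<rho>(3) by blast
    have "norm (normal_col j z l) \<le> C * norm z ^ k" if "1 / \<rho> < norm z" for z
      using C[OF inv[OF that]] by (simp add: norm_inverse power_inverse divide_inverse)
    then show "\<exists>C k. \<forall>z. 1 / \<rho> < norm z \<longrightarrow> norm (normal_col j z l) \<le> C * norm z ^ (k :: nat)" by blast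
  qed
qed

text \<open>Every point of the plane has a punctured neighbourhood of good points, and so has
  infinity; compactness of a large disc gives finiteness.\<close>

lemma finite_not_good: "finite {z. \<not> good z}"
proof -
  obtain R where R: "\<And>z :: complex. R < norm z \<Longrightarrow> good z" by (rule good_near_infinity) blast
  have "finite (cball 0 R \<inter> {z. \<not> good z})"
  proof (rule finite_not_islimpt_in_compact)
    fix c :: complex assume "c \<in> cball 0 R"
    obtain \<rho> where \<rho>: "0 < \<rho>" "\<And>z. z \<in> ball c \<rho> - {c} \<Longrightarrow> good z" by (rule good_near_point[of c]) blast
    show "\<not> c islimpt {z. \<not> good z}"
    proof
      assume "c islimpt {z. \<not> good z}"
      then obtain y where "\<not> good y" "y \<noteq> c" "dist y c < \<rho>" using \<rho>(1) by (auto simp: islimpt_approachable)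
      then show False using \<rho>(2)[of y] by (auto simp: dist_commute)
    qed
  qed auto
  moreover have "{z. \<not> good z} \<subseteq> cball 0 R" using R by (auto simp: not_less[symmetric])
  ultimately show ?thesis by (simp add: Int_absorb1)
qed

section \<open>The polynomial frame\<close>

lemma normal_col_holomorphic:
  assumes lj: "l < p" "j < d"
  shows "(\<lambda>z. normal_col j z l) holomorphic_on - {z. \<not> good z}"
proof -
  have "open (- {z. \<not> good z})" by (intro open_Compl finite_imp_closed finite_not_good)
  moreover have "\<exists>f'. ((\<lambda>z. normal_col j z l) has_field_derivative f') (at z)" if gz: "good z" for z
  proof -
    obtain M where M: "reach z M" using gz by (auto simp: good_def)
    obtain r V W where r: "0 < r" and V: "flat_frame (\<lambda>w. w) (\<lambda>w. 1) (ball z r) V W"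
      "\<And>i j. i < p \<Longrightarrow> j < p \<Longrightarrow> tame_on (ball z r) (\<lambda>s. V s $$ (i, j))"
      using disc_frame_at[OF M] by blast
    note reach_V = flat_frame_reach[OF V(1)]
    define O' where "O' = ball z r - {z. \<not> good z}"
    have O': "open O'" unfolding O'_def by (intro open_Diff finite_imp_closed finite_not_good) auto
    have E: "det (topmat (V w)) \<noteq> 0" if "w \<in> O'" for w
      using good_iff[OF reach_V, of w] that by (auto simp: O'_def)
    have "(\<lambda>w. (\<Sum>k<d. V w $$ (l, k) * adj_mat (topmat (V w)) $$ (k, j)) / det (topmat (V w))) holomorphic_on O'"
    proof (rule holomorphic_on_divide)
      show "(\<lambda>w. \<Sum>k<d. V w $$ (l, k) * adj_mat (topmat (V w)) $$ (k, j)) holomorphic_on O'"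
        using tame_normal_num[OF V(2) lj] by (auto simp: tame_on_def O'_def intro: holomorphic_on_subset)
      show "(\<lambda>w. det (topmat (V w))) holomorphic_on O'"
        using tame_det_topmat[OF V(2)] by (auto simp: tame_on_def O'_def intro: holomorphic_on_subset)
    qed (rule E)
    then have "(\<lambda>z. normal_col j z l) holomorphic_on O'"
    proof (rule holomorphic_transform)
      fix w assume w: "w \<in> O'"
      show "(\<Sum>k<d. V w $$ (l, k) * adj_mat (topmat (V w)) $$ (k, j)) / det (topmat (V w)) = normal_col j w l"
        using normal_col(3)[OF reach_V E[OF w] lj(2,1)] w by (simp add: O'_def)
    qed
    moreover have "z \<in> O'" using gz r by (simp add: O'_def)
    ultimately show ?thesis using O' by (auto simp: holomorphic_on_open)
  qed
  ultimately show ?thesis by (auto simp: holomorphic_on_open)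
qed

lemma F_subspace_family: "subspace_family p d F {z. \<not> good z}"
  by unfold_locales (use finite_not_good dp F_zero F_add F_scale F_cong F_top_zero in auto)

text \<open>The normalised columns are rational with poles only at points that are not good.
  Multiplied by a common power of \<open>D\<close> they become polynomial, and the top block becomes
  a multiple of the identity, which makes independence evident.\<close>

lemma poly_frame_exists: "\<exists>x. subspace_family.poly_frame p d F x"
proof -
  interpret subspace_family p d F "{z. \<not> good z}" by (rule F_subspace_family)
  define D where "D z = (\<Prod>c\<in>{z. \<not> good z}. z - c)" for z
  have D: "D z \<noteq> 0" if "good z" for z unfolding D_def using that finite_not_good by (auto simp: prod_zero_iff)
  have "\<exists>N. \<forall>m\<ge>N. \<exists>q. \<forall>z. good z \<longrightarrow> D z ^ m * normal_col j z l = poly q z" if lj: "l < p" "j < d" for l j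
  proof -
    obtain N :: nat where "\<And>m. N \<le> m \<Longrightarrow> \<exists>q. \<forall>z. z \<notin> {z. \<not> good z} \<longrightarrow>
        (\<Prod>c\<in>{z. \<not> good z}. z - c) ^ m * normal_col j z l = poly q z"
    proof (rule moderate_growth_rational[OF finite_not_good normal_col_holomorphic[OF lj]])
      fix c
      obtain \<rho> where \<rho>: "0 < \<rho>"
        "\<And>l j. l < p \<Longrightarrow> j < d \<Longrightarrow> \<exists>C k. \<forall>z\<in>ball c \<rho> - {c}. norm (normal_col j z l) \<le> C / norm (z - c) ^ (k :: nat)"
        by (rule good_near_point[of c]) blast
      then obtain C and k :: nat where "\<forall>z\<in>ball c \<rho> - {c}. norm (normal_col j z l) \<le> C / norm (z - c) ^ k"
        using lj by blast
      then have "\<forall>\<^sub>F z in at c. norm (normal_col j z l) \<le> C / norm (z - c) ^ k"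
        unfolding eventually_at using \<rho>(1) by (intro exI[of _ \<rho>]) (auto simp: dist_commute)
      then show "\<exists>C k. \<forall>\<^sub>F z in at c. norm (normal_col j z l) \<le> C / norm (z - c) ^ (k :: nat)" by blast
    next
      obtain R where R: "0 < R"
        "\<And>l j. l < p \<Longrightarrow> j < d \<Longrightarrow> \<exists>C k. \<forall>z. R < norm z \<longrightarrow> norm (normal_col j z l) \<le> C * norm z ^ (k :: nat)"
        by (rule good_near_infinity) blast
      then obtain C and k :: nat where "\<forall>z. R < norm z \<longrightarrow> norm (normal_col j z l) \<le> C * norm z ^ k"
        using lj by blast
      then have "\<forall>\<^sub>F z in at_infinity. norm (normal_col j z l) \<le> C * norm z ^ k"
        unfolding eventually_at_infinity by (intro exI[of _ "R + 1"]) auto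
      then show "\<exists>C k. \<forall>\<^sub>F z in at_infinity. norm (normal_col j z l) \<le> C * norm z ^ (k :: nat)" by blast
    qed (rule that)
    then show ?thesis unfolding D_def by auto
  qed
  then have "\<forall>l j. \<exists>N. l < p \<longrightarrow> j < d \<longrightarrow> (\<forall>m\<ge>N. \<exists>q. \<forall>z. good z \<longrightarrow> D z ^ m * normal_col j z l = poly q z)"
    by blast
  then obtain N where N: "\<And>l j m. l < p \<Longrightarrow> j < d \<Longrightarrow> N l j \<le> m \<Longrightarrow>
      \<exists>q. \<forall>z. good z \<longrightarrow> D z ^ m * normal_col j z l = poly q z" by metis
  \<comment> \<open>A single exponent for all entries, so that a column is rescaled as a whole and
    stays in \<open>F z\<close>.\<close>
  define m where "m = (\<Sum>l<p. \<Sum>j<d. N l j)"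
  have "N l j \<le> m" if "l < p" "j < d" for l j
  proof -
    have "N l j \<le> (\<Sum>j<d. N l j)" using that by (intro member_le_sum) auto
    also have "\<dots> \<le> m" unfolding m_def using that(1) by (intro member_le_sum[of l _ "\<lambda>l. \<Sum>j<d. N l j"]) auto
    finally show ?thesis .
  qed
  then have "\<forall>l j. \<exists>q. l < p \<longrightarrow> j < d \<longrightarrow> (\<forall>z. good z \<longrightarrow> D z ^ m * normal_col j z l = poly q z)"
    using N by blast
  then obtain x where x: "\<And>l j z. l < p \<Longrightarrow> j < d \<Longrightarrow> good z \<Longrightarrow> D z ^ m * normal_col j z l = poly (x l j) z"
    by metis
  have "frame_at x z" if z: "z \<notin> {z. \<not> good z}" for z
    unfolding frame_at_def
  proof (intro conjI allI impI)
    have gz: "good z" using z by simp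
    then obtain M where M: "reach z M" "det (topmat M) \<noteq> 0" by (auto simp: good_def)
    show "F z (\<lambda>l. poly (x l j) z)" if j: "j < d" for j
      using F_cong[OF z F_scale[OF z normal_col(1)[OF M j], of "D z ^ m"]] x[OF _ j gz] by (simp add: mult.commute)
    show "indep_cols p d (\<lambda>l j. poly (x l j) z)"
      unfolding indep_cols_def
    proof (intro allI impI)
      fix c i assume c: "\<forall>l<p. (\<Sum>j<d. poly (x l j) z * c j) = 0" and i: "i < d"
      have "0 = (\<Sum>j<d. poly (x i j) z * c j)" using c i dp by simp
      also have "\<dots> = (\<Sum>j<d. if j = i then D z ^ m * c j else 0)"
        using normal_col(2)[OF M _ i] i dp by (intro sum.cong) (auto simp: x[OF _ _ gz, symmetric])
      also have "\<dots> = D z ^ m * c i" using i by simp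
      finally show "c i = 0" using D[OF gz] by simp
    qed
  qed
  then show ?thesis unfolding poly_frame_def using finite_not_good by blast
qed

text \<open>Membership expressed by linear equations, the last \<open>p - d\<close> rows of the
  inverse matrix. Unlike a parametrisation with unknown coefficients, this form can be
  differentiated.\<close>

lemma F_iff_inverse:
  assumes M: "reach z M" and N: "N \<in> carrier_mat p p" "N * M = 1\<^sub>m p" "M * N = 1\<^sub>m p"
  shows "F z v \<longleftrightarrow> (\<forall>i. d \<le> i \<longrightarrow> i < p \<longrightarrow> (\<Sum>l<p. N $$ (i, l) * v l) = 0)"
proof
  assume "F z v"
  then obtain c where c: "\<And>l. l < p \<Longrightarrow> v l = (\<Sum>j<d. M $$ (l, j) * c j)" using F_iff[OF M] by auto
  show "\<forall>i. d \<le> i \<longrightarrow> i < p \<longrightarrow> (\<Sum>l<p. N $$ (i, l) * v l) = 0"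
  proof (intro allI impI)
    fix i assume i: "d \<le> i" "i < p"
    have "(\<Sum>l<p. N $$ (i, l) * v l) = (\<Sum>j<d. (\<Sum>l<p. N $$ (i, l) * M $$ (l, j)) * c j)"
      using c by (simp add: sum_distrib_left sum_distrib_right mult.assoc) (rule sum.swap)
    also have "\<dots> = (\<Sum>j<d. (N * M) $$ (i, j) * c j)"
      using i dp by (intro sum.cong refl) (simp add: index_mult_sum[OF N(1) reach_carrier[OF M], symmetric] del: index_mult_mat)
    also have "\<dots> = 0" unfolding N(2) using i by (intro sum.neutral) auto
    finally show "(\<Sum>l<p. N $$ (i, l) * v l) = 0" .
  qed
next
  assume low: "\<forall>i. d \<le> i \<longrightarrow> i < p \<longrightarrow> (\<Sum>l<p. N $$ (i, l) * v l) = 0"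
  define c where "c i = (\<Sum>l<p. N $$ (i, l) * v l)" for i
  have "v l = (\<Sum>j<d. M $$ (l, j) * c j)" if l: "l < p" for l
  proof -
    have "(\<Sum>j<d. M $$ (l, j) * c j) = (\<Sum>j<p. M $$ (l, j) * c j)"
      using dp low by (intro sum.mono_neutral_left) (auto simp: c_def)
    also have "\<dots> = (\<Sum>k<p. (\<Sum>j<p. M $$ (l, j) * N $$ (j, k)) * v k)"
      unfolding c_def by (simp add: sum_distrib_left sum_distrib_right mult.assoc) (rule sum.swap)
    also have "\<dots> = (\<Sum>k<p. (M * N) $$ (l, k) * v k)"
      using l by (intro sum.cong refl) (simp add: index_mult_sum[OF reach_carrier[OF M] N(1), symmetric] del: index_mult_mat)
    also have "\<dots> = (\<Sum>k<p. if k = l then v k else 0)" unfolding N(3) using l by (intro sum.cong) auto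
    finally show ?thesis using l by simp
  qed
  then show "F z v" unfolding F_iff[OF M] by (intro exI[of _ c]) simp
qed

text \<open>Along a section \<open>x\<close> of \<open>F\<close> the lower rows of
  \<open>W x\<close> vanish identically. Differentiating with W' = - W A shows that the same rows of
  W (A x - x') vanish; multiplication by \<open>node_poly\<close> keeps the vector in
  \<open>F z\<close>.\<close>

lemma F_nabla_num:
  assumes S: "finite S" and x: "\<And>z. z \<notin> S \<Longrightarrow> F z (\<lambda>l. poly (x l) z)"
    and z: "z \<notin> S" "good z"
  shows "F z (\<lambda>l. poly (nabla_num p n a B x l) z)"
proof -
  note zs = good_not_sing[OF z(2)]
  obtain M where M: "reach z M" using z by (auto simp: good_def)
  obtain r V W where "0 < r" and VW: "flat_frame (\<lambda>w. w) (\<lambda>w. 1) (ball z r) V W"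
    by (rule disc_frame_at[OF M]) (rule that)
  then have zr: "z \<in> ball z r" by simp
  have F_W: "F w v \<longleftrightarrow> (\<forall>i. d \<le> i \<longrightarrow> i < p \<longrightarrow> (\<Sum>l<p. W w $$ (i, l) * v l) = 0)" if "w \<in> ball z r" for w v
    using VW that by (intro F_iff_inverse[OF flat_frame_reach[OF VW that]]) (auto simp: flat_frame_def)
  have dW: "((\<lambda>w. W w $$ (i, j)) has_field_derivative - (\<Sum>l<p. W z $$ (i, l) * A z $$ (l, j))) (at z)"
    if "i < p" "j < p" for i j
  proof -
    have "((\<lambda>w. W w $$ (i, j)) has_field_derivative - (\<Sum>l<p. W z $$ (i, l) * (A z $$ (l, j) * 1))) (at z)"
      using VW zr that unfolding flat_frame_def by blast
    then show ?thesis by simp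
  qed
  have key: "(\<Sum>l<p. W z $$ (i, l) * ((\<Sum>m<p. A z $$ (l, m) * poly (x m) z) - poly (pderiv (x l)) z)) = 0"
    if i: "d \<le> i" "i < p" for i
  proof -
    have 1: "((\<lambda>w. \<Sum>l<p. W w $$ (i, l) * poly (x l) w) has_field_derivative
       (\<Sum>l<p. - (\<Sum>m<p. W z $$ (i, m) * A z $$ (m, l)) * poly (x l) z + poly (pderiv (x l)) z * W z $$ (i, l))) (at z)"
      using dW[OF i(2)] by (intro DERIV_sum DERIV_mult poly_DERIV) auto
    have "((\<lambda>w. \<Sum>l<p. W w $$ (i, l) * poly (x l) w) has_field_derivative 0) (at z)"
    proof (rule has_field_derivative_transform_within_open[of "\<lambda>w. 0"])
      show "open (ball z r - S)" using S by (intro open_Diff finite_imp_closed) auto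
      show "0 = (\<Sum>l<p. W w $$ (i, l) * poly (x l) w)" if "w \<in> ball z r - S" for w
        using F_W[of w "\<lambda>l. poly (x l) w"] x[of w] that i by auto
    qed (use zr z in auto)
    with 1 have "(\<Sum>l<p. - (\<Sum>m<p. W z $$ (i, m) * A z $$ (m, l)) * poly (x l) z + poly (pderiv (x l)) z * W z $$ (i, l)) = 0"
      by (rule DERIV_unique)
    then have "(\<Sum>l<p. (\<Sum>m<p. W z $$ (i, m) * A z $$ (m, l)) * poly (x l) z) = (\<Sum>l<p. W z $$ (i, l) * poly (pderiv (x l)) z)"
      by (simp add: sum.distrib sum_subtractf sum_negf mult.commute)
    moreover have "(\<Sum>l<p. (\<Sum>m<p. W z $$ (i, m) * A z $$ (m, l)) * poly (x l) z)
       = (\<Sum>l<p. W z $$ (i, l) * (\<Sum>m<p. A z $$ (l, m) * poly (x m) z))"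
      by (simp add: sum_distrib_left sum_distrib_right mult.assoc) (rule sum.swap)
    ultimately show ?thesis by (simp add: right_diff_distrib sum_subtractf)
  qed
  have "F z (\<lambda>l. (\<Sum>m<p. A z $$ (l, m) * poly (x m) z) - poly (pderiv (x l)) z)"
    unfolding F_W[OF zr] using key by blast
  from F_scale[OF this, of "poly (node_poly n a) z"]
  show ?thesis by (rule F_cong) (simp add: poly_nabla_num[OF _ zs] mult.commute)
qed

text \<open>Invariance of \<open>F z\<close> under \<open>B i\<close>, in coordinates: it is applied
  to the leading columns of \<open>M\<close> and tested with the lower rows of its inverse.\<close>

theorem residues_preserve_subspace:
  assumes inj: "inj_on a {..<n}" and n: "0 < n" and d: "0 < d"
    and B: "\<And>i. i < n \<Longrightarrow> B i \<in> carrier_mat p p"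
    and B_sum: "\<And>l m. l < p \<Longrightarrow> m < p \<Longrightarrow> (\<Sum>i<n. B i $$ (l, m)) = 0"
    and ev: "\<And>i \<beta>. i < n \<Longrightarrow> eigenvalue (B i) \<beta> \<Longrightarrow> - 1 / (real n * real d) < Re \<beta>"
  obtains S where "finite S"
    and "\<And>z M N i l j. z \<notin> S \<Longrightarrow> reach z M \<Longrightarrow> N \<in> carrier_mat p p \<Longrightarrow> N * M = 1\<^sub>m p \<Longrightarrow> M * N = 1\<^sub>m p \<Longrightarrow>
      i < n \<Longrightarrow> d \<le> l \<Longrightarrow> l < p \<Longrightarrow> j < d \<Longrightarrow> (N * (B i * M)) $$ (l, j) = 0"
proof -
  interpret subspace_family p d F "{z. \<not> good z}" by (rule F_subspace_family)
  obtain x0 where x0: "poly_frame x0" using poly_frame_exists by blast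
  have nabla: "\<exists>S'. finite S' \<and> (\<forall>z. z \<notin> S' \<longrightarrow> F z (\<lambda>l. poly (nabla_num p n a B x l) z))"
    if "finite S" "\<And>z. z \<notin> S \<Longrightarrow> F z (\<lambda>l. poly (x l) z)" for x S
    using F_nabla_num[OF that] that(1) finite_not_good by (intro exI[of _ "S \<union> {z. \<not> good z}"]) auto
  obtain S where S: "finite S"
    "\<And>z i v. z \<notin> S \<Longrightarrow> i < n \<Longrightarrow> F z v \<Longrightarrow> F z (\<lambda>l. \<Sum>m<p. B i $$ (l, m) * v m)"
    by (rule nabla_invariant_constant[OF inj n d B B_sum ev x0 nabla]) (use that in blast)+
  show ?thesis
  proof (rule that[OF S(1)])
    fix z M N i l j
    assume z: "z \<notin> S" and M: "reach z M" and N: "N \<in> carrier_mat p p" "N * M = 1\<^sub>m p" "M * N = 1\<^sub>m p"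
      and i: "i < n" and l: "d \<le> l" "l < p" and j: "j < d"
    have Mc: "M \<in> carrier_mat p p" by (rule reach_carrier[OF M])
    have "M $$ (k, j) = (\<Sum>m<d. M $$ (k, m) * (if m = j then 1 else 0))" for k
      using j by (simp add: if_distrib cong: if_cong)
    then have "F z (\<lambda>k. M $$ (k, j))" unfolding F_iff[OF M] by (intro exI[of _ "\<lambda>m. if m = j then 1 else 0"]) simp
    from S(2)[OF z i this] have "(\<Sum>k<p. N $$ (l, k) * (\<Sum>m<p. B i $$ (k, m) * M $$ (m, j))) = 0"
      unfolding F_iff_inverse[OF M N] using l by blast
    moreover have "(B i * M) $$ (k, j) = (\<Sum>m<p. B i $$ (k, m) * M $$ (m, j))" if "k < p" for k
      using that j dp by (intro index_mult_sum[OF B[OF i] Mc]) auto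
    moreover have "(N * (B i * M)) $$ (l, j) = (\<Sum>k<p. N $$ (l, k) * (B i * M) $$ (k, j))"
      using l j dp by (intro index_mult_sum[OF N(1) mult_carrier_mat[OF B[OF i] Mc]]) auto
    ultimately show "(N * (B i * M)) $$ (l, j) = 0" by simp
  qed
qed

end

section \<open>Block structure\<close>

lemma sum_list_take_mono: "k \<le> m \<Longrightarrow> sum_list (take k ms) \<le> sum_list (take m (ms :: nat list))"
  using take_add[of k "m - k" ms] by simp

lemma block_of_less_iff:
  assumes "j < sum_list ms" "l < sum_list ms"
  shows "block_of ms l < block_of ms j \<longleftrightarrow> (\<exists>s. Suc s < length ms \<and> l < sum_list (take (Suc s) ms) \<and> sum_list (take (Suc s) ms) \<le> j)"
proof -
  have ex: "i < sum_list (take (Suc (length ms - 1)) ms)" if "i < sum_list ms" for i using that by simp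
  have block: "i < sum_list (take (Suc (block_of ms i)) ms)" if "i < sum_list ms" for i
    unfolding block_of_def using ex[OF that] by (rule LeastI)
  show ?thesis
  proof
    assume less: "block_of ms l < block_of ms j"
    have "\<not> j < sum_list (take (Suc (block_of ms l)) ms)"
      using less unfolding block_of_def[of ms j] by (rule not_less_Least)
    moreover have "block_of ms j \<le> length ms - 1"
      unfolding block_of_def by (rule Least_le) (use ex assms in blast)
    ultimately show "\<exists>s. Suc s < length ms \<and> l < sum_list (take (Suc s) ms) \<and> sum_list (take (Suc s) ms) \<le> j"
      using block[OF assms(2)] less by (intro exI[of _ "block_of ms l"]) auto
  next
    assume "\<exists>s. Suc s < length ms \<and> l < sum_list (take (Suc s) ms) \<and> sum_list (take (Suc s) ms) \<le> j"
    then obtain s where s: "l < sum_list (take (Suc s) ms)" "sum_list (take (Suc s) ms) \<le> j" by blast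
    have "block_of ms l \<le> s" unfolding block_of_def by (rule Least_le) (rule s(1))
    moreover have "s < block_of ms j"
    proof (rule ccontr)
      assume "\<not> s < block_of ms j"
      then have "sum_list (take (Suc (block_of ms j)) ms) \<le> sum_list (take (Suc s) ms)"
        by (intro sum_list_take_mono) simp
      then show False using block[OF assms(1)] s(2) by simp
    qed
    ultimately show "block_of ms l < block_of ms j" by simp
  qed
qed

text \<open>Block triangularity splits into one zero corner for each proper partial sum of the block
  sizes, so each cut can be treated as a separate two-block problem.\<close>

lemma block_upper_tri_iff:
  "block_upper_tri ms M \<longleftrightarrow> M \<in> carrier_mat (sum_list ms) (sum_list ms) \<and>
     (\<forall>s j l. Suc s < length ms \<longrightarrow> j < sum_list ms \<longrightarrow> sum_list (take (Suc s) ms) \<le> j \<longrightarrow>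
        l < sum_list (take (Suc s) ms) \<longrightarrow> M $$ (j, l) = 0)"
  unfolding block_upper_tri_def
  using block_of_less_iff[of _ ms] by (meson less_le_trans less_trans le_less_trans)

lemma fuchs_coeff_conjugate:
  assumes B: "\<And>i. i < n \<Longrightarrow> B i \<in> carrier_mat p p" and Y: "Y0 \<in> carrier_mat p p" "Y1 \<in> carrier_mat p p" "Y0 * Y1 = 1\<^sub>m p"
  shows "fuchs_coeff p n a B z * Y0 = Y0 * fuchs_coeff p n a (\<lambda>i. Y1 * (B i * Y0)) z"
proof (rule eq_matI)
  define B' where "B' i = Y1 * (B i * Y0)" for i
  fix j l assume "j < dim_row (Y0 * fuchs_coeff p n a (\<lambda>i. Y1 * (B i * Y0)) z)"
    "l < dim_col (Y0 * fuchs_coeff p n a (\<lambda>i. Y1 * (B i * Y0)) z)"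
  then have jl: "j < p" "l < p" using Y by (auto simp: fuchs_coeff_def)
  have B'c: "B' i \<in> carrier_mat p p" if "i < n" for i unfolding B'_def using B[OF that] Y by auto
  have "Y0 * B' i = (Y0 * Y1) * (B i * Y0)" if "i < n" for i
    unfolding B'_def using assoc_mult_mat[OF Y(1,2) mult_carrier_mat[OF B[OF that] Y(1)]] by simp
  then have YB: "Y0 * B' i = B i * Y0" if "i < n" for i
    using that Y(3) left_mult_one_mat[OF mult_carrier_mat[OF B[OF that] Y(1)]] by simp
  have "(fuchs_coeff p n a B z * Y0) $$ (j, l) = (\<Sum>m<p. (\<Sum>i<n. B i $$ (j, m) / (z - a i)) * Y0 $$ (m, l))"
    using jl by (subst index_mult_sum[OF fuchs_coeff_carrier Y(1) jl]) (simp add: fuchs_coeff_index)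
  also have "\<dots> = (\<Sum>i<n. (\<Sum>m<p. B i $$ (j, m) * Y0 $$ (m, l)) / (z - a i))"
    by (simp add: sum_distrib_right sum_divide_distrib) (rule sum.swap)
  also have "\<dots> = (\<Sum>i<n. (\<Sum>m<p. Y0 $$ (j, m) * B' i $$ (m, l)) / (z - a i))"
    using index_mult_sum[OF B Y(1) jl] index_mult_sum[OF Y(1) B'c jl] YB by (intro sum.cong) auto
  also have "\<dots> = (\<Sum>m<p. Y0 $$ (j, m) * (\<Sum>i<n. B' i $$ (m, l) / (z - a i)))"
    by (simp add: sum_distrib_left sum_divide_distrib) (rule sum.swap)
  also have "\<dots> = (Y0 * fuchs_coeff p n a B' z) $$ (j, l)"
    using jl by (subst index_mult_sum[OF Y(1) fuchs_coeff_carrier jl]) (simp add: fuchs_coeff_index)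
  finally show "(fuchs_coeff p n a B z * Y0) $$ (j, l) = (Y0 * fuchs_coeff p n a (\<lambda>i. Y1 * (B i * Y0)) z) $$ (j, l)"
    unfolding B'_def .
qed (use Y in \<open>auto simp: fuchs_coeff_def\<close>)

theorem theorem1:
  fixes n p :: nat and a :: "nat \<Rightarrow> complex" and B :: "nat \<Rightarrow> complex mat"
    and ms :: "nat list"
  assumes distinct: "inj_on a {..<n}"
    and B_dim: "\<forall>i<n. B i \<in> carrier_mat p p"
    and B_sum: "\<forall>j<p. \<forall>k<p. (\<Sum>i<n. B i $$ (j, k)) = 0"
    and blocks: "length ms \<ge> 2" "\<forall>s<length ms. ms ! s > 0" "sum_list ms = p"
    and monodromy: "\<exists>z0 Y0. z0 \<notin> a ` {..<n} \<and> Y0 \<in> carrier_mat p p \<and> invertible_mat Y0 \<and>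
        (\<forall>\<gamma> \<Phi> G. valid_path \<gamma> \<and> pathstart \<gamma> = z0 \<and> pathfinish \<gamma> = z0 \<and>
            path_image \<gamma> \<subseteq> - (a ` {..<n}) \<and>
            continuation_along p (fuchs_coeff p n a B) \<gamma> Y0 \<Phi> \<and>
            G \<in> carrier_mat p p \<and> monodromy_of Y0 \<Phi> G
          \<longrightarrow> block_upper_tri ms G)"
    and exponents: "\<forall>i<n. \<forall>\<beta>. eigenvalue (B i) \<beta> \<longrightarrow>
        Re \<beta> > - 1 / (real n * real (p - last ms))"
  shows "\<exists>C D. C \<in> carrier_mat p p \<and> D \<in> carrier_mat p p \<and>
           C * D = 1\<^sub>m p \<and> D * C = 1\<^sub>m p \<and>
           (\<forall>i<n. block_upper_tri ms (C * B i * D))"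
proof (cases "n = 0")
  case True
  then show ?thesis by (intro exI[of _ "1\<^sub>m p"]) auto
next
  case False
  obtain z0 Y0 where z0: "z0 \<notin> a ` {..<n}" and Y0: "Y0 \<in> carrier_mat p p" "invertible_mat Y0"
    and loop: "\<And>\<gamma> \<Phi> G. valid_path \<gamma> \<Longrightarrow> pathstart \<gamma> = z0 \<Longrightarrow> pathfinish \<gamma> = z0 \<Longrightarrow>
            path_image \<gamma> \<subseteq> - (a ` {..<n}) \<Longrightarrow>
            continuation_along p (fuchs_coeff p n a B) \<gamma> Y0 \<Phi> \<Longrightarrow>
            G \<in> carrier_mat p p \<Longrightarrow> monodromy_of Y0 \<Phi> G \<Longrightarrow> block_upper_tri ms G"
    using monodromy by blast
  obtain Y1 where Y01: "Y0 * Y1 = 1\<^sub>m p" "Y1 * Y0 = 1\<^sub>m p" and Y1: "Y1 \<in> carrier_mat p p"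
  proof -
    obtain Y1 where 1: "Y0 * Y1 = 1\<^sub>m p" "Y1 * Y0 = 1\<^sub>m (dim_row Y1)"
      using Y0 by (auto simp: invertible_mat_def inverts_mat_def)
    have "dim_col Y1 = p" using arg_cong[OF 1(1), of dim_col] by simp
    moreover have "dim_row Y1 = p" using arg_cong[OF 1(2), of dim_col] Y0 by simp
    ultimately show thesis using 1 that[of Y1] by auto
  qed
  have B: "B i \<in> carrier_mat p p" if "i < n" for i using B_dim that by blast
  \<comment> \<open>Conjugation by the initial value makes the fundamental matrix the identity at
    \<open>z0\<close>; the monodromy matrices of the new system are those of the old one with
    respect to \<open>Y0\<close>.\<close>
  define B' where "B' i = Y1 * (B i * Y0)" for i
  have B': "B' i \<in> carrier_mat p p" if "i < n" for i unfolding B'_def using B[OF that] Y0 Y1 by auto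
  have B'_sum: "(\<Sum>i<n. B' i $$ (j, l)) = 0" if "j < p" "l < p" for j l
  proof -
    have "B' i $$ (j, l) = (\<Sum>m<p. \<Sum>k<p. Y1 $$ (j, m) * B i $$ (m, k) * Y0 $$ (k, l))" if i: "i < n" for i
    proof -
      have "B' i $$ (j, l) = (\<Sum>m<p. Y1 $$ (j, m) * (B i * Y0) $$ (m, l))"
        unfolding B'_def using \<open>j < p\<close> \<open>l < p\<close> by (intro index_mult_sum[OF Y1 mult_carrier_mat[OF B[OF i] Y0(1)]])
      also have "\<dots> = (\<Sum>m<p. Y1 $$ (j, m) * (\<Sum>k<p. B i $$ (m, k) * Y0 $$ (k, l)))"
        using index_mult_sum[OF B[OF i] Y0(1) _ \<open>l < p\<close>] by (intro sum.cong) auto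
      finally show ?thesis by (simp add: sum_distrib_left mult.assoc)
    qed
    then have "(\<Sum>i<n. B' i $$ (j, l)) = (\<Sum>i<n. \<Sum>m<p. \<Sum>k<p. Y1 $$ (j, m) * B i $$ (m, k) * Y0 $$ (k, l))" by simp
    also have "\<dots> = (\<Sum>m<p. \<Sum>k<p. \<Sum>i<n. Y1 $$ (j, m) * B i $$ (m, k) * Y0 $$ (k, l))"
      by (subst sum.swap) (intro sum.cong refl sum.swap)
    also have "\<dots> = (\<Sum>m<p. \<Sum>k<p. Y1 $$ (j, m) * (\<Sum>i<n. B i $$ (m, k)) * Y0 $$ (k, l))"
      by (simp add: sum_distrib_left sum_distrib_right)
    also have "\<dots> = 0" using B_sum by simp
    finally show ?thesis .
  qed
  have B'_ev: "eigenvalue (B i) \<beta>" if i: "i < n" and \<beta>: "eigenvalue (B' i) \<beta>" for i \<beta>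
  proof -
    have "similar_mat (B' i) (B i)"
      by (rule similar_matI[of _ _ Y1 Y0 p]) (use B[OF i] B'[OF i] Y0 Y1 Y01 in \<open>auto simp: B'_def assoc_mult_mat[of _ p p _ p _ p]\<close>)
    then show ?thesis using \<beta> char_poly_similar eigenvalue_root_char_poly[OF B[OF i]] eigenvalue_root_char_poly[OF B'[OF i]]
      by metis
  qed
  define ds where "ds s = sum_list (take (Suc s) ms)" for s
  \<comment> \<open>Excluding the last block is what limits every cut to p - m^k, so the single
    assumed bound on the exponents implies the one required for each \<open>ds s\<close>.\<close>
  have ds_le: "ds s \<le> p - last ms" if "Suc s < length ms" for s
  proof -
    have "ms \<noteq> []" using blocks(1) by auto
    then have "p = sum_list (butlast ms) + last ms"
      using blocks(3) append_butlast_last_id[of ms] by (metis sum_list.Cons sum_list.Nil sum_list.append add.right_neutral)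
    moreover have "ds s \<le> sum_list (take (length ms - 1) ms)"
      unfolding ds_def using that by (intro sum_list_take_mono) simp
    ultimately show ?thesis by (simp add: butlast_conv_take)
  qed
  have ds_pos: "0 < ds s" for s
  proof -
    obtain m ms' where "ms = m # ms'" using blocks(1) by (cases ms) auto
    then show ?thesis using blocks(2) by (auto simp: ds_def)
  qed
  have loc: "fuchsian_subspace p n (ds s) a B' z0" if s: "Suc s < length ms" for s
  proof
    show "ds s \<le> p" using ds_le[OF s] by simp
    show "z0 \<notin> a ` {..<n}" by (rule z0)
    fix T j l
    assume T: "transports p (fuchs_coeff p n a B') (a ` {..<n}) z0 z0 T" and jl: "ds s \<le> j" "j < p" "l < ds s"
    obtain \<gamma> \<Phi> where \<gamma>: "valid_path \<gamma>" "pathstart \<gamma> = z0" "pathfinish \<gamma> = z0" "path_image \<gamma> \<subseteq> - (a ` {..<n})"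
      and \<Phi>: "continuation_along p (fuchs_coeff p n a B') \<gamma> (1\<^sub>m p) \<Phi>" "\<Phi> 1 = T"
      using T unfolding transports_def by blast
    have "continuation_along p (fuchs_coeff p n a B) \<gamma> (Y0 * 1\<^sub>m p) (\<lambda>t. Y0 * \<Phi> t)"
      by (rule continuation_along_mult_left[OF \<Phi>(1) Y0(1) fuchs_coeff_carrier fuchs_coeff_carrier])
        (unfold B'_def, rule fuchs_coeff_conjugate[OF B Y0(1) Y1 Y01(1)])
    then have "continuation_along p (fuchs_coeff p n a B) \<gamma> Y0 (\<lambda>t. Y0 * \<Phi> t)" using Y0(1) by simp
    from loop[OF \<gamma> this transports_carrier[OF T]] have "block_upper_tri ms T"
      using \<Phi>(2) by (simp add: monodromy_of_def)
    then show "T $$ (j, l) = 0" unfolding block_upper_tri_iff using s jl blocks(3) by (auto simp: ds_def)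
  qed
  have "\<exists>S. finite S \<and> (\<forall>z M N i l j. z \<notin> S \<longrightarrow> fuchsian_subspace.reach p n a B' z0 z M \<longrightarrow>
      N \<in> carrier_mat p p \<longrightarrow> N * M = 1\<^sub>m p \<longrightarrow> M * N = 1\<^sub>m p \<longrightarrow> i < n \<longrightarrow> ds s \<le> l \<longrightarrow> l < p \<longrightarrow> j < ds s \<longrightarrow>
      (N * (B' i * M)) $$ (l, j) = 0)" if s: "Suc s < length ms" for s
  proof -
    interpret fuchsian_subspace p n "ds s" a B' z0 by (rule loc[OF s])
    have "- 1 / (real n * real (ds s)) < Re \<beta>" if "i < n" "eigenvalue (B' i) \<beta>" for i \<beta>
    proof -
      have "real n * real (ds s) \<le> real n * real (p - last ms)" using ds_le[OF s] by (intro mult_left_mono) auto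
      then have "1 / (real n * real (p - last ms)) \<le> 1 / (real n * real (ds s))"
        using False ds_pos[of s] by (intro divide_left_mono mult_pos_pos) auto
      moreover have "- 1 / (real n * real (p - last ms)) < Re \<beta>" using exponents B'_ev that by blast
      ultimately show ?thesis by simp
    qed
    then obtain S where "finite S"
      "\<And>z M N i l j. z \<notin> S \<Longrightarrow> reach z M \<Longrightarrow> N \<in> carrier_mat p p \<Longrightarrow> N * M = 1\<^sub>m p \<Longrightarrow> M * N = 1\<^sub>m p \<Longrightarrow>
      i < n \<Longrightarrow> ds s \<le> l \<Longrightarrow> l < p \<Longrightarrow> j < ds s \<Longrightarrow> (N * (B' i * M)) $$ (l, j) = 0"
      using residues_preserve_subspace[OF distinct _ ds_pos B' B'_sum] False by blast
    then show ?thesis by blast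
  qed
  then obtain S where S: "\<And>s. Suc s < length ms \<Longrightarrow> finite (S s)"
    "\<And>s z M N i l j. Suc s < length ms \<Longrightarrow> z \<notin> S s \<Longrightarrow> fuchsian_subspace.reach p n a B' z0 z M \<Longrightarrow>
      N \<in> carrier_mat p p \<Longrightarrow> N * M = 1\<^sub>m p \<Longrightarrow> M * N = 1\<^sub>m p \<Longrightarrow> i < n \<Longrightarrow> ds s \<le> l \<Longrightarrow> l < p \<Longrightarrow> j < ds s \<Longrightarrow>
      (N * (B' i * M)) $$ (l, j) = 0"
    by metis
  have "finite ((\<Union>s\<in>{s. Suc s < length ms}. S s) \<union> a ` {..<n})"
    using S(1) by (intro finite_UnI finite_UN_I) (auto intro: finite_subset[of _ "{..<length ms}"])
  then obtain z where z: "z \<notin> (\<Union>s\<in>{s. Suc s < length ms}. S s) \<union> a ` {..<n}"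
    using ex_new_if_finite[OF infinite_UNIV_char_0] by blast
  have "Suc 0 < length ms" using blocks(1) by simp
  interpret fuchsian_subspace p n "ds 0" a B' z0 by (rule loc[OF \<open>Suc 0 < length ms\<close>])
  \<comment> \<open>\<open>reach\<close> does not involve the size of the cut, so one
    \<open>M\<close>, at a point outside all exceptional sets, serves every \<open>s\<close> at
    once.\<close>
  obtain M where M: "reach z M" using reach_and_good_dense[of z] z by auto
  then obtain N where N: "N \<in> carrier_mat p p" "N * M = 1\<^sub>m p" "M * N = 1\<^sub>m p"
    using transports_carrier unfolding reach_def by blast
  have Mc: "M \<in> carrier_mat p p" by (rule reach_carrier[OF M])
  note car = N(1) Y1 Y0(1) Mc
  \<comment> \<open>\<open>Y0 * M\<close> is the value at \<open>z\<close> of a continuation of the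
    given fundamental matrix, and the required \<open>C\<close> is its inverse.\<close>
  show ?thesis
  proof (rule exI[of _ "N * Y1"], rule exI[of _ "Y0 * M"], intro conjI allI impI)
    show "N * Y1 \<in> carrier_mat p p" "Y0 * M \<in> carrier_mat p p" using car by auto
    have "(N * Y1) * (Y0 * M) = N * ((Y1 * Y0) * M)" using car by (simp add: assoc_mult_mat[of _ p p _ p _ p])
    then show "(N * Y1) * (Y0 * M) = 1\<^sub>m p" using Y01 Mc N by simp
    have "(Y0 * M) * (N * Y1) = Y0 * ((M * N) * Y1)" using car by (simp add: assoc_mult_mat[of _ p p _ p _ p])
    then show "(Y0 * M) * (N * Y1) = 1\<^sub>m p" using Y01 Y1 N by simp
    fix i assume i: "i < n"
    have eq: "(N * Y1) * B i * (Y0 * M) = N * (B' i * M)"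
      unfolding B'_def using car B[OF i] by (simp add: assoc_mult_mat[of _ p p _ p _ p])
    show "block_upper_tri ms ((N * Y1) * B i * (Y0 * M))"
      unfolding eq block_upper_tri_iff blocks(3)
    proof (intro conjI allI impI)
      show "N * (B' i * M) \<in> carrier_mat p p" using N(1) Mc B'[OF i] by auto
      fix s j l assume "Suc s < length ms" "j < p" "sum_list (take (Suc s) ms) \<le> j" "l < sum_list (take (Suc s) ms)"
      then show "(N * (B' i * M)) $$ (j, l) = 0" using S(2)[OF _ _ M N i, of s j l] z by (auto simp: ds_def)
    qed
  qed
qed

end
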